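(* Assume ($\nu$0), ($\nu$1) with $\sigma\ne1$, (L1)–(L2), (F2), (H1), (M). Fix $M>0$ and consider parameters $\rho>0$, $h=T/N\in(0,1)$, $r\in(0,1)$, $\epsilon>0$ with $\rho^2/h\le M$ and $h/r^\sigma\le M$ if $\sigma\in(0,1)$, respectively $\rho^2/h\le M$ and $h\,r^{1-2\sigma}\le M$ if $\sigma\in(1,2)$. Then there exists $C_0>0$ such that for all such parameters, all $\mu\in C([0,T],P(\mathbb{R}^d))$ and all $t_1,t_2\in[0,T]$, $d_0\big(m^\epsilon_{\rho,h}[\mu](t_1),m^\epsilon_{\rho,h}[\mu](t_2)\big)\le C_0\sqrt{|t_1-t_2|}$.
   Context: $P(\mathbb{R}^d)$: Borel probability measures with metric $d_0(\mu_1,\mu_2)=\sup\{\int f\,d(\mu_1-\mu_2): f$ Lipschitz, $\|f\|_\infty\le1,\|Df\|_\infty\le1\}$. $\nu$ nonnegative Radon measure on $\mathbb{R}^d\setminus\{0\}$; $L$ Lagrangian, $H(x,p)=\sup_q\{p\cdot q-L(x,q)\}$; $F,G:\mathbb{R}^d\times P(\mathbb{R}^d)\to\mathbb{R}$; $m_0\in P(\mathbb{R}^d)$. ($\nu$0) $\int1\wedge|z|^2\nu(dz)<\infty$. ($\nu$1) $\exists\sigma\in(0,2),C>0$: $0\le\frac{d\nu}{dz}\le C|z|^{-d-\sigma}$ for $|z|<1$. (L1) $L(x,\cdot)$ convex, $L(x,q)/|q|\to\infty$. (L2) $|L(x,q)-L(y,q)|\le L_L|x-y|$. (F2) $|F(x,\mu_1)-F(y,\mu_2)|\le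 L_F(|x-y|+d_0(\mu_1,\mu_2))$, same for $G$. (H1) $D_pH$ continuous, $|D_pH(x,p)|\le C_R$ for $|p|\le R$. (M) $m_0\in P(\mathbb{R}^d)$. Discretization: $t_k=kh$, $x_i=i\rho$, $\beta_i(x)=\prod_l\max\{0,1-|x_l-(x_i)_l|/\rho\}$, $I[v]=\sum_iv_i\beta_i$; $b_r=\int_{r<|z|<1}z\nu(dz)$, $\sigma_r=(\frac12\int_{|z|<r}zz^T\nu(dz))^{1/2}$ with columns $\sigma_r^m$, $\lambda_r=\nu(\{|z|>r\})$, $\bar b(\alpha)=-\alpha-b_r$; $S_{\rho,h,r}[\mu](v,i,k)=\inf_{\alpha}\{hF(x_i,\mu(t_k))+hL(x_i,\alpha)+\frac{e^{-h\lambda_r}}{2d}\sum_{m=1}^d(I[v](x_i+h\bar b(\alpha)+\sqrt{hd}\sigma_r^m)+I[v](x_i+h\bar b(\alpha)-\sqrt{hd}\sigma_r^m))+\frac{1-e^{-h\lambda_r}}{\lambda_r}\int_{|z|\ge r}I[v](x_i+z)\nu(dz)\}$. Discrete HJB: $u_{i,N}=G(x_i,\mu(T))$, $u_{i,k}=S_{\rho,h,r}[\mu](u_{\cdot,k+1},i,k)$; $u_{\rho,h}[\mu](t,x)=\sum_i\beta_i(x)u_{i,[t/h]}$; $u^\epsilon_{\rho,h}[\mu]=u_{\rho,h}[\mu](t,\cdot)*\eta_\epsilon$ (standard mollifier). Discrete FPK: with $w=u^\epsilon_{\rho,h}[\mu]$, $\Phi^{\epsilon,\pm}_{j,k,p}=x_j-h(D_pH(x_j,Dw(t_k,x_j))+b_r)\pm\sqrt{hd}\sigma_r^p$,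 $\mathbf B(i,j,k)=\frac{e^{-h\lambda_r}}{2d}\sum_p(\beta_i(\Phi^{\epsilon,+}_{j,k,p})+\beta_i(\Phi^{\epsilon,-}_{j,k,p}))+\frac{1-e^{-h\lambda_r}}{\lambda_r}\int_{|z|>r}\beta_i(x_j+z)\nu(dz)$, $E_i=x_i+\frac\rho2(-1,1)^d$, $m_{i,0}=m_0(E_i)$, $m_{i,k+1}=\sum_jm_{j,k}\mathbf B(i,j,k)$; $m^\epsilon_{\rho,h}[\mu](t_k,x)=\rho^{-d}\sum_im_{i,k}\mathbb 1_{E_i}(x)$, linear in $t$ on $[t_k,t_{k+1}]$. *)

theory Defs
  imports "HOL-Probability.Probability"
begin

definition prob_meas :: "(real^'n::finite) measure set" where
  "prob_meas = {m. prob_space m \<and> sets m = sets borel}"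

definition d0 :: "(real^'n::finite) measure \<Rightarrow> (real^'n) measure \<Rightarrow> real" where
  "d0 m1 m2 = Sup {(integral\<^sup>L m1 f) - (integral\<^sup>L m2 f) | f.
      (\<forall>x. \<bar>f x\<bar> \<le> 1) \<and> 1-lipschitz_on UNIV f}"

definition cont_flow :: "real \<Rightarrow> (real \<Rightarrow> (real^'n::finite) measure) \<Rightarrow> bool" where
  "cont_flow T \<mu> \<longleftrightarrow> (\<forall>t\<in>{0..T}. \<mu> t \<in> prob_meas) \<and>
     (\<forall>t\<in>{0..T}. \<forall>e>0. \<exists>\<delta>>0. \<forall>s\<in>{0..T}. \<bar>s - t\<bar> < \<delta> \<longrightarrow> d0 (\<mu> s) (\<mu> t) < e)"

definition ham :: "(real^'n::finite \<Rightarrow> real^'n \<Rightarrow> real) \<Rightarrow> real^'n \<Rightarrow> real^'n \<Rightarrow> real" where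
  "ham L x p = Sup (range (\<lambda>q. p \<bullet> q - L x q))"

definition grad :: "(real^'n::finite \<Rightarrow> real) \<Rightarrow> real^'n \<Rightarrow> real^'n" where
  "grad f p = (THE g. (f has_derivative (\<lambda>v. g \<bullet> v)) (at p))"

definition DpH :: "(real^'n::finite \<Rightarrow> real^'n \<Rightarrow> real) \<Rightarrow> real^'n \<Rightarrow> real^'n \<Rightarrow> real^'n" where
  "DpH L x p = grad (ham L x) p"

definition grid :: "real \<Rightarrow> int^'n::finite \<Rightarrow> real^'n" where
  "grid \<rho> i = (\<chi> l. \<rho> * of_int (i $ l))"

definition hat :: "real \<Rightarrow> int^'n::finite \<Rightarrow> real^'n \<Rightarrow> real" where
  "hat \<rho> i x = (\<Prod>l\<in>UNIV. max 0 (1 - \<bar>x $ l - grid \<rho> i $ l\<bar> / \<rho>))"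

definition interp :: "real \<Rightarrow> (int^'n::finite \<Rightarrow> real) \<Rightarrow> real^'n \<Rightarrow> real" where
  "interp \<rho> v x = (\<Sum>\<^sub>\<infinity>i. v i * hat \<rho> i x)"

definition boxE :: "real \<Rightarrow> int^'n::finite \<Rightarrow> (real^'n) set" where
  "boxE \<rho> i = {x. \<forall>l. \<bar>x $ l - grid \<rho> i $ l\<bar> < \<rho> / 2}"

definition lev_b :: "(real^'n::finite) measure \<Rightarrow> real \<Rightarrow> real^'n" where
  "lev_b \<nu> r = set_lebesgue_integral \<nu> {z. r < norm z \<and> norm z < 1} (\<lambda>z. z)"

definition lev_cov :: "(real^'n::finite) measure \<Rightarrow> real \<Rightarrow> real^'n^'n" where
  "lev_cov \<nu> r = (\<chi> a b. (1/2) * set_lebesgue_integral \<nu> {z. norm z < r} (\<lambda>z. z $ a * z $ b))"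

definition psd_sqrt :: "real^'n^'n \<Rightarrow> real^'n^'n::finite" where
  "psd_sqrt A = (THE S. transpose S = S \<and> (\<forall>x. 0 \<le> x \<bullet> (S *v x)) \<and> S ** S = A)"

definition lev_sig :: "(real^'n::finite) measure \<Rightarrow> real \<Rightarrow> real^'n^'n" where
  "lev_sig \<nu> r = psd_sqrt (lev_cov \<nu> r)"

definition lev_lam :: "(real^'n::finite) measure \<Rightarrow> real \<Rightarrow> real" where
  "lev_lam \<nu> r = measure \<nu> {z. r < norm z}"

definition schemeS ::
  "(real^'n::finite) measure \<Rightarrow> (real^'n \<Rightarrow> real^'n \<Rightarrow> real) \<Rightarrow> (real^'n \<Rightarrow> (real^'n) measure \<Rightarrow> real)
   \<Rightarrow> real \<Rightarrow> real \<Rightarrow> real \<Rightarrow> (real \<Rightarrow> (real^'n) measure) \<Rightarrow> (int^'n \<Rightarrow> real) \<Rightarrow> int^'n \<Rightarrow> nat \<Rightarrow> real" where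
  "schemeS \<nu> L F \<rho> h r \<mu> v i k =
     (let x = grid \<rho> i; lam = lev_lam \<nu> r; \<sigma> = lev_sig \<nu> r; d = real CARD('n) in
      Inf (range (\<lambda>\<alpha>.
        h * F x (\<mu> (real k * h)) + h * L x \<alpha>
        + exp (- h * lam) / (2 * d) *
            (\<Sum>m\<in>UNIV. interp \<rho> v (x + h *\<^sub>R (- \<alpha> - lev_b \<nu> r) + sqrt (h * d) *\<^sub>R column m \<sigma>)
                       + interp \<rho> v (x + h *\<^sub>R (- \<alpha> - lev_b \<nu> r) - sqrt (h * d) *\<^sub>R column m \<sigma>))
        + (1 - exp (- h * lam)) / lam *
            set_lebesgue_integral \<nu> {z. r \<le> norm z} (\<lambda>z. interp \<rho> v (x + z)))))"

text \<open>Backward recursion: hjb_back j gives the values at time index N - j.\<close>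
primrec hjb_back ::
  "(real^'n::finite) measure \<Rightarrow> (real^'n \<Rightarrow> real^'n \<Rightarrow> real) \<Rightarrow> (real^'n \<Rightarrow> (real^'n) measure \<Rightarrow> real)
   \<Rightarrow> (real^'n \<Rightarrow> (real^'n) measure \<Rightarrow> real) \<Rightarrow> real \<Rightarrow> nat \<Rightarrow> real \<Rightarrow> real \<Rightarrow> (real \<Rightarrow> (real^'n) measure)
   \<Rightarrow> nat \<Rightarrow> int^'n \<Rightarrow> real" where
  "hjb_back \<nu> L F G T N \<rho> r \<mu> 0 = (\<lambda>i. G (grid \<rho> i) (\<mu> T))"
| "hjb_back \<nu> L F G T N \<rho> r \<mu> (Suc j) =
     (\<lambda>i. schemeS \<nu> L F \<rho> (T / real N) r \<mu> (hjb_back \<nu> L F G T N \<rho> r \<mu> j) i (N - Suc j))"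

definition u_disc :: "(real^'n::finite) measure \<Rightarrow> (real^'n \<Rightarrow> real^'n \<Rightarrow> real) \<Rightarrow> (real^'n \<Rightarrow> (real^'n) measure \<Rightarrow> real) \<Rightarrow> (real^'n \<Rightarrow> (real^'n) measure \<Rightarrow> real) \<Rightarrow> real \<Rightarrow> nat \<Rightarrow> real \<Rightarrow> real \<Rightarrow> (real \<Rightarrow> (real^'n) measure) \<Rightarrow> nat \<Rightarrow> int^'n \<Rightarrow> real" where
  "u_disc \<nu> L F G T N \<rho> r \<mu> k = hjb_back \<nu> L F G T N \<rho> r \<mu> (N - k)"

definition u_interp :: "(real^'n::finite) measure \<Rightarrow> (real^'n \<Rightarrow> real^'n \<Rightarrow> real) \<Rightarrow> (real^'n \<Rightarrow> (real^'n) measure \<Rightarrow> real) \<Rightarrow> (real^'n \<Rightarrow> (real^'n) measure \<Rightarrow> real) \<Rightarrow> real \<Rightarrow> nat \<Rightarrow> real \<Rightarrow> real \<Rightarrow> (real \<Rightarrow> (real^'n) measure) \<Rightarrow> real \<Rightarrow> real^'n \<Rightarrow> real" where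
  "u_interp \<nu> L F G T N \<rho> r \<mu> t x =
     interp \<rho> (u_disc \<nu> L F G T N \<rho> r \<mu> (nat \<lfloor>t / (T / real N)\<rfloor>)) x"

definition moll0 :: "real^'n::finite \<Rightarrow> real" where
  "moll0 x = (if norm x < 1 then exp (1 / (norm x ^ 2 - 1)) else 0)"

definition std_moll :: "real^'n::finite \<Rightarrow> real" where
  "std_moll x = moll0 x / integral\<^sup>L lborel (moll0 :: real^'n \<Rightarrow> real)"

definition moll_eps :: "real \<Rightarrow> real^'n::finite \<Rightarrow> real" where
  "moll_eps \<epsilon> x = \<epsilon> powr (- real CARD('n)) * std_moll ((1 / \<epsilon>) *\<^sub>R x)"

definition u_eps :: "(real^'n::finite) measure \<Rightarrow> (real^'n \<Rightarrow> real^'n \<Rightarrow> real) \<Rightarrow> (real^'n \<Rightarrow> (real^'n) measure \<Rightarrow> real) \<Rightarrow> (real^'n \<Rightarrow> (real^'n) measure \<Rightarrow> real) \<Rightarrow> real \<Rightarrow> nat \<Rightarrow> real \<Rightarrow> real \<Rightarrow> real \<Rightarrow> (real \<Rightarrow> (real^'n) measure) \<Rightarrow> real \<Rightarrow> real^'n \<Rightarrow> real" where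
  "u_eps \<nu> L F G T N \<rho> r \<epsilon> \<mu> t x =
     integral\<^sup>L lborel (\<lambda>y. u_interp \<nu> L F G T N \<rho> r \<mu> t (x - y) * moll_eps \<epsilon> y)"

definition PhiP :: "(real^'n::finite) measure \<Rightarrow> (real^'n \<Rightarrow> real^'n \<Rightarrow> real) \<Rightarrow> (real^'n \<Rightarrow> (real^'n) measure \<Rightarrow> real) \<Rightarrow> (real^'n \<Rightarrow> (real^'n) measure \<Rightarrow> real) \<Rightarrow> real \<Rightarrow> nat \<Rightarrow> real \<Rightarrow> real \<Rightarrow> real \<Rightarrow> (real \<Rightarrow> (real^'n) measure) \<Rightarrow> int^'n \<Rightarrow> nat \<Rightarrow> 'n \<Rightarrow> real^'n" where
  "PhiP \<nu> L F G T N \<rho> r \<epsilon> \<mu> j k p =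
    (let h = T / real N; x = grid \<rho> j;
         Dw = grad (u_eps \<nu> L F G T N \<rho> r \<epsilon> \<mu> (real k * h)) x in
     x - h *\<^sub>R (DpH L x Dw + lev_b \<nu> r) + sqrt (h * real CARD('n)) *\<^sub>R column p (lev_sig \<nu> r))"

definition PhiM :: "(real^'n::finite) measure \<Rightarrow> (real^'n \<Rightarrow> real^'n \<Rightarrow> real) \<Rightarrow> (real^'n \<Rightarrow> (real^'n) measure \<Rightarrow> real) \<Rightarrow> (real^'n \<Rightarrow> (real^'n) measure \<Rightarrow> real) \<Rightarrow> real \<Rightarrow> nat \<Rightarrow> real \<Rightarrow> real \<Rightarrow> real \<Rightarrow> (real \<Rightarrow> (real^'n) measure) \<Rightarrow> int^'n \<Rightarrow> nat \<Rightarrow> 'n \<Rightarrow> real^'n" where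
  "PhiM \<nu> L F G T N \<rho> r \<epsilon> \<mu> j k p =
    (let h = T / real N; x = grid \<rho> j;
         Dw = grad (u_eps \<nu> L F G T N \<rho> r \<epsilon> \<mu> (real k * h)) x in
     x - h *\<^sub>R (DpH L x Dw + lev_b \<nu> r) - sqrt (h * real CARD('n)) *\<^sub>R column p (lev_sig \<nu> r))"

definition Bmat :: "(real^'n::finite) measure \<Rightarrow> (real^'n \<Rightarrow> real^'n \<Rightarrow> real) \<Rightarrow> (real^'n \<Rightarrow> (real^'n) measure \<Rightarrow> real) \<Rightarrow> (real^'n \<Rightarrow> (real^'n) measure \<Rightarrow> real) \<Rightarrow> real \<Rightarrow> nat \<Rightarrow> real \<Rightarrow> real \<Rightarrow> real \<Rightarrow> (real \<Rightarrow> (real^'n) measure) \<Rightarrow> int^'n \<Rightarrow> int^'n \<Rightarrow> nat \<Rightarrow> real" where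
  "Bmat \<nu> L F G T N \<rho> r \<epsilon> \<mu> i j k =
    (let h = T / real N; lam = lev_lam \<nu> r; d = real CARD('n) in
     exp (- h * lam) / (2 * d) *
       (\<Sum>p\<in>UNIV. hat \<rho> i (PhiP \<nu> L F G T N \<rho> r \<epsilon> \<mu> j k p) + hat \<rho> i (PhiM \<nu> L F G T N \<rho> r \<epsilon> \<mu> j k p))
     + (1 - exp (- h * lam)) / lam *
       set_lebesgue_integral \<nu> {z. r < norm z} (\<lambda>z. hat \<rho> i (grid \<rho> j + z)))"

primrec m_disc :: "(real^'n::finite) measure \<Rightarrow> (real^'n \<Rightarrow> real^'n \<Rightarrow> real) \<Rightarrow> (real^'n \<Rightarrow> (real^'n) measure \<Rightarrow> real) \<Rightarrow> (real^'n \<Rightarrow> (real^'n) measure \<Rightarrow> real) \<Rightarrow> (real^'n) measure \<Rightarrow> real \<Rightarrow> nat \<Rightarrow> real \<Rightarrow> real \<Rightarrow> real \<Rightarrow> (real \<Rightarrow> (real^'n) measure) \<Rightarrow> nat \<Rightarrow> int^'n \<Rightarrow> real" where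
  "m_disc \<nu> L F G m0 T N \<rho> r \<epsilon> \<mu> 0 = (\<lambda>i. measure m0 (boxE \<rho> i))"
| "m_disc \<nu> L F G m0 T N \<rho> r \<epsilon> \<mu> (Suc k) =
     (\<lambda>i. \<Sum>\<^sub>\<infinity>j. m_disc \<nu> L F G m0 T N \<rho> r \<epsilon> \<mu> k j * Bmat \<nu> L F G T N \<rho> r \<epsilon> \<mu> i j k)"

definition m_dens_k :: "(real^'n::finite) measure \<Rightarrow> (real^'n \<Rightarrow> real^'n \<Rightarrow> real) \<Rightarrow> (real^'n \<Rightarrow> (real^'n) measure \<Rightarrow> real) \<Rightarrow> (real^'n \<Rightarrow> (real^'n) measure \<Rightarrow> real) \<Rightarrow> (real^'n) measure \<Rightarrow> real \<Rightarrow> nat \<Rightarrow> real \<Rightarrow> real \<Rightarrow> real \<Rightarrow> (real \<Rightarrow> (real^'n) measure) \<Rightarrow> nat \<Rightarrow> real^'n \<Rightarrow> real" where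
  "m_dens_k \<nu> L F G m0 T N \<rho> r \<epsilon> \<mu> k x =
     \<rho> powr (- real CARD('n)) *
       (\<Sum>\<^sub>\<infinity>i. m_disc \<nu> L F G m0 T N \<rho> r \<epsilon> \<mu> k i * indicator (boxE \<rho> i) x)"

definition m_dens :: "(real^'n::finite) measure \<Rightarrow> (real^'n \<Rightarrow> real^'n \<Rightarrow> real) \<Rightarrow> (real^'n \<Rightarrow> (real^'n) measure \<Rightarrow> real) \<Rightarrow> (real^'n \<Rightarrow> (real^'n) measure \<Rightarrow> real) \<Rightarrow> (real^'n) measure \<Rightarrow> real \<Rightarrow> nat \<Rightarrow> real \<Rightarrow> real \<Rightarrow> real \<Rightarrow> (real \<Rightarrow> (real^'n) measure) \<Rightarrow> real \<Rightarrow> real^'n \<Rightarrow> real" where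
  "m_dens \<nu> L F G m0 T N \<rho> r \<epsilon> \<mu> t x =
     (let h = T / real N; k = nat \<lfloor>t / h\<rfloor>; \<theta> = (t - real k * h) / h in
      (1 - \<theta>) * m_dens_k \<nu> L F G m0 T N \<rho> r \<epsilon> \<mu> k x
      + \<theta> * m_dens_k \<nu> L F G m0 T N \<rho> r \<epsilon> \<mu> (Suc k) x)"

definition m_eps :: "(real^'n::finite) measure \<Rightarrow> (real^'n \<Rightarrow> real^'n \<Rightarrow> real) \<Rightarrow> (real^'n \<Rightarrow> (real^'n) measure \<Rightarrow> real) \<Rightarrow> (real^'n \<Rightarrow> (real^'n) measure \<Rightarrow> real) \<Rightarrow> (real^'n) measure \<Rightarrow> real \<Rightarrow> nat \<Rightarrow> real \<Rightarrow> real \<Rightarrow> real \<Rightarrow> (real \<Rightarrow> (real^'n) measure) \<Rightarrow> real \<Rightarrow> (real^'n) measure" where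
  "m_eps \<nu> L F G m0 T N \<rho> r \<epsilon> \<mu> t =
     density lborel (\<lambda>x. ennreal (m_dens \<nu> L F G m0 T N \<rho> r \<epsilon> \<mu> t x))"

end

theory Submission
  imports Defs
begin

text \<open>
  Testing the scheme against a bounded Lipschitz function \<open>f\<close> only involves its cell average, which
  is again bounded by \<open>1\<close> and \<open>1\<close>-Lipschitz. Replace that average by a mollification \<open>\<phi>\<close> at scale
  \<open>\<delta>\<close>: it is \<open>\<delta>\<close>-close and agrees with its first-order Taylor polynomials up to \<open>A / \<delta> * |z|\<^sup>2\<close>. One
  step of the scheme changes the pairing with such a \<open>\<phi>\<close> by at most \<open>C * h * (1 + A / \<delta>)\<close>: the
  interpolation error is of order \<open>\<rho>\<^sup>2 \<le> M * h\<close>, the drift \<open>b\<^sub>r\<close> of the diffusive part cancels the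
  compensator of the jumps up to \<open>h\<^sup>2 * \<lambda>\<^sub>r * |b\<^sub>r|\<close>, and the two restrictions on \<open>(h, r)\<close> are exactly
  what bounds \<open>h * \<lambda>\<^sub>r * |b\<^sub>r|\<close> and \<open>h * |b\<^sub>r|\<^sup>2\<close>. The remaining drift is bounded since the value
  functions are Lipschitz uniformly in the parameters. So the pairing is Lipschitz in time with
  constant \<open>C * (1 + A / \<delta>)\<close>, and \<open>\<delta> = sqrt |t1 - t2|\<close> gives the claim.
\<close>

section \<open>Multilinear interpolation on the grid\<close>

text \<open>The Lipschitz bound for the value functions must survive \<open>N\<close> backward steps
  with \<open>N\<close> unbounded, so no step may multiply the constant. Interpolation, seen as a
  map from grid functions to functions on the whole space, costs a dimensional factor, but it costs
  nothing when two grid points are moved by the same displacement. Comparing nodes under the same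
  control therefore only adds \<open>h * (LF + LL)\<close> per step, and the dimensional factor
  enters once, at the end. Infima, jump integrals, gradients and matrix roots are total functions
  with default values. Their estimates are phrased as comparisons, or with an extra constant, so
  that they also hold for the defaults and existence is never argued. The powers of \<open>r\<close>
  come from counting dyadic shells near the origin: a shell of radius \<open>r\<close> has mass of
  order \<open>r powr - \<sigma>\<close>, and its first moment sums as a geometric series whose
  ratio differs from 1 because \<open>\<sigma> \<noteq> 1\<close>; at \<open>\<sigma> = 1\<close> a
  logarithm would appear. The choice of \<open>\<delta>\<close> balances the mollification error
  \<open>2 * \<delta>\<close> against \<open>C * A * |t1 - t2| / \<delta>\<close>.\<close>

lemma grid_nth [simp]: "grid \<rho> i $ l = \<rho> * of_int (i $ l)"
  by (simp add: grid_def)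

lemma grid_add: "grid \<rho> (i + j) = grid \<rho> i + grid \<rho> j"
  by (simp add: vec_eq_iff algebra_simps)

lemma hat_nonneg: "0 \<le> hat \<rho> i x"
  by (simp add: hat_def prod_nonneg)

lemma hat_le_1: "\<rho> > 0 \<Longrightarrow> hat \<rho> i x \<le> 1"
  unfolding hat_def by (intro prod_le_1) auto

lemma hat_support:
  assumes "\<rho> > 0" "hat \<rho> i x \<noteq> 0"
  shows "\<bar>x $ l - grid \<rho> i $ l\<bar> < \<rho>"
proof -
  have "max 0 (1 - \<bar>x $ l - grid \<rho> i $ l\<bar> / \<rho>) \<noteq> 0"
    using assms(2) unfolding hat_def by (auto simp del: grid_nth)
  then show ?thesis using assms(1) by (auto simp: field_simps max_def split: if_splits)
qed

lemma norm_le_CARD_mult: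
  fixes x :: "real^'n::finite"
  assumes "\<And>l. \<bar>x $ l\<bar> \<le> c"
  shows "norm x \<le> real CARD('n) * c"
proof -
  have "norm x \<le> (\<Sum>l\<in>UNIV. \<bar>x $ l\<bar>)" by (rule norm_le_l1_cart)
  also have "\<dots> \<le> (\<Sum>l\<in>(UNIV::'n set). c)" by (intro sum_mono assms)
  finally show ?thesis by simp
qed

lemma hat_support_norm:
  fixes x :: "real^'n::finite"
  assumes "\<rho> > 0" "hat \<rho> i x \<noteq> 0"
  shows "norm (grid \<rho> i - x) \<le> real CARD('n) * \<rho>"
  by (rule norm_le_CARD_mult)
     (use hat_support[OF assms] in \<open>fastforce simp: abs_minus_commute intro: less_imp_le\<close>)

text \<open>Vertices of a grid cell containing \<open>x\<close>. All hats that are nonzero at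
  \<open>x\<close> sit here, so each infinite interpolation sum becomes a finite one; on a cell face
  the surplus vertices carry weight zero.\<close>

definition cell_corners :: "real \<Rightarrow> real^'n::finite \<Rightarrow> (int^'n) set" where
  "cell_corners \<rho> x = {i. \<forall>l. i $ l \<in> {\<lfloor>x $ l / \<rho>\<rfloor>, \<lfloor>x $ l / \<rho>\<rfloor> + 1}}"

lemma cell_corners_image:
  "cell_corners \<rho> x = vec_lambda ` (\<Pi>\<^sub>E l\<in>UNIV. {\<lfloor>x $ l / \<rho>\<rfloor>, \<lfloor>x $ l / \<rho>\<rfloor> + 1})"
proof (intro equalityI subsetI)
  fix i assume "i \<in> cell_corners \<rho> x"
  then have "vec_nth i \<in> (\<Pi>\<^sub>E l\<in>UNIV. {\<lfloor>x $ l / \<rho>\<rfloor>, \<lfloor>x $ l / \<rho>\<rfloor> + 1})"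
    unfolding cell_corners_def by blast
  then show "i \<in> vec_lambda ` (\<Pi>\<^sub>E l\<in>UNIV. {\<lfloor>x $ l / \<rho>\<rfloor>, \<lfloor>x $ l / \<rho>\<rfloor> + 1})"
    by (rule rev_image_eqI) simp
qed (auto simp: cell_corners_def PiE_iff)

lemma finite_cell_corners [simp]: "finite (cell_corners \<rho> x)"
  unfolding cell_corners_image by (intro finite_imageI finite_PiE) auto

lemma card_cell_corners: "card (cell_corners \<rho> (x::real^'n::finite)) \<le> 2 ^ CARD('n)"
proof -
  have "card (cell_corners \<rho> x) \<le> card (\<Pi>\<^sub>E l\<in>(UNIV::'n set). {\<lfloor>x $ l / \<rho>\<rfloor>, \<lfloor>x $ l / \<rho>\<rfloor> + 1})"
    unfolding cell_corners_image by (intro card_image_le finite_PiE) auto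
  then show ?thesis by (simp add: card_PiE numeral_2_eq_2)
qed

lemma hat_support_cell_corners:
  assumes "\<rho> > 0" "hat \<rho> i x \<noteq> 0"
  shows "i \<in> cell_corners \<rho> x"
proof -
  have "i $ l \<in> {\<lfloor>x $ l / \<rho>\<rfloor>, \<lfloor>x $ l / \<rho>\<rfloor> + 1}" for l
  proof -
    have "\<bar>x $ l - \<rho> * of_int (i $ l)\<bar> < \<rho>" using hat_support[OF assms, of l] by simp
    then have "\<bar>x $ l / \<rho> - of_int (i $ l)\<bar> < 1"
      using assms(1) by (auto simp: abs_less_iff field_simps)
    then have "i $ l = \<lfloor>x $ l / \<rho>\<rfloor> \<or> i $ l = \<lfloor>x $ l / \<rho>\<rfloor> + 1" by linarith
    then show ?thesis by simp
  qed
  then show ?thesis by (simp add: cell_corners_def)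
qed

text \<open>Distributivity over a product of two-point sets. It reduces multidimensional identities
  for the hats to the one-dimensional weights of \<open>hat1_floor\<close>.\<close>

lemma sum_cell_corners_prod:
  fixes \<phi> :: "'n::finite \<Rightarrow> int \<Rightarrow> real"
  shows "(\<Sum>i\<in>cell_corners \<rho> x. \<Prod>l\<in>UNIV. \<phi> l (i $ l)) =
         (\<Prod>l\<in>UNIV. \<phi> l \<lfloor>x $ l / \<rho>\<rfloor> + \<phi> l (\<lfloor>x $ l / \<rho>\<rfloor> + 1))"
proof -
  have inj: "inj_on vec_lambda S" for S :: "('n \<Rightarrow> int) set" by (auto simp: inj_on_def)
  have "(\<Sum>i\<in>cell_corners \<rho> x. \<Prod>l\<in>UNIV. \<phi> l (i $ l)) =
     (\<Sum>g\<in>(\<Pi>\<^sub>E l\<in>UNIV. {\<lfloor>x $ l / \<rho>\<rfloor>, \<lfloor>x $ l / \<rho>\<rfloor> + 1}). \<Prod>l\<in>UNIV. \<phi> l (g l))"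
    unfolding cell_corners_image by (subst sum.reindex[OF inj]) simp
  also have "\<dots> = (\<Prod>l\<in>UNIV. \<Sum>n\<in>{\<lfloor>x $ l / \<rho>\<rfloor>, \<lfloor>x $ l / \<rho>\<rfloor> + 1}. \<phi> l n)"
    by (subst prod_sum_PiE) auto
  finally show ?thesis by simp
qed

lemma hat1_floor:
  fixes t \<rho> :: real
  assumes "\<rho> > 0"
  defines "\<theta> \<equiv> t / \<rho> - of_int \<lfloor>t / \<rho>\<rfloor>"
  shows "max 0 (1 - \<bar>t - \<rho> * of_int \<lfloor>t / \<rho>\<rfloor>\<bar> / \<rho>) = 1 - \<theta>"
    and "max 0 (1 - \<bar>t - \<rho> * of_int (\<lfloor>t / \<rho>\<rfloor> + 1)\<bar> / \<rho>) = \<theta>"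
proof -
  have th: "0 \<le> \<theta>" "\<theta> < 1" unfolding \<theta>_def by linarith+
  have t: "t = \<rho> * (of_int \<lfloor>t / \<rho>\<rfloor> + \<theta>)" using assms(1) by (simp add: \<theta>_def)
  have "\<bar>t - \<rho> * of_int \<lfloor>t / \<rho>\<rfloor>\<bar> = \<rho> * \<theta>"
    by (subst (1) t) (use assms(1) th in \<open>simp add: algebra_simps abs_mult\<close>)
  then show "max 0 (1 - \<bar>t - \<rho> * of_int \<lfloor>t / \<rho>\<rfloor>\<bar> / \<rho>) = 1 - \<theta>"
    using th assms(1) by simp
  have "t - \<rho> * of_int (\<lfloor>t / \<rho>\<rfloor> + 1) = \<rho> * (\<theta> - 1)"
    by (subst (1) t) (simp add: algebra_simps)
  then have "\<bar>t - \<rho> * of_int (\<lfloor>t / \<rho>\<rfloor> + 1)\<bar> = \<rho> * (1 - \<theta>)"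
    using assms(1) th by (simp add: abs_mult)
  then show "max 0 (1 - \<bar>t - \<rho> * of_int (\<lfloor>t / \<rho>\<rfloor> + 1)\<bar> / \<rho>) = \<theta>"
    using th assms(1) by simp
qed

lemma sum_hat_cell_corners:
  assumes "\<rho> > 0"
  shows "(\<Sum>i\<in>cell_corners \<rho> x. hat \<rho> i x) = 1"
proof -
  have "(\<Sum>i\<in>cell_corners \<rho> x. hat \<rho> i x) =
     (\<Sum>i\<in>cell_corners \<rho> x. \<Prod>l\<in>UNIV. (\<lambda>l n. max 0 (1 - \<bar>x $ l - \<rho> * of_int n\<bar> / \<rho>)) l (i $ l))"
    by (simp add: hat_def)
  also have "\<dots> = 1"
    by (subst sum_cell_corners_prod) (simp only: hat1_floor[OF assms], simp)
  finally show ?thesis .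
qed

text \<open>Together with the partition of unity this says that the hats reproduce affine functions,
  the source of second-order accuracy.\<close>

lemma sum_hat_coord:
  assumes "\<rho> > 0"
  shows "(\<Sum>i\<in>cell_corners \<rho> x. hat \<rho> i x * (grid \<rho> i $ k)) = x $ k"
proof -
  \<comment> \<open>The factor \<open>grid \<rho> i $ k\<close> is absorbed into coordinate
    \<open>k\<close> of the product, so that the corner sum still factorizes.\<close>
  let ?\<phi> = "\<lambda>l n. max 0 (1 - \<bar>x $ l - \<rho> * of_int n\<bar> / \<rho>) * (if l = k then \<rho> * of_int n else 1)"
  have "(\<Sum>i\<in>cell_corners \<rho> x. hat \<rho> i x * (grid \<rho> i $ k)) =
     (\<Sum>i\<in>cell_corners \<rho> x. \<Prod>l\<in>UNIV. ?\<phi> l (i $ l))"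
    by (simp add: hat_def prod.distrib prod.delta)
  also have "\<dots> = (\<Prod>l\<in>UNIV. if l = k then x $ k else 1)"
  proof (subst sum_cell_corners_prod, rule prod.cong, simp)
    fix l
    define n \<theta> where "n = \<lfloor>x $ l / \<rho>\<rfloor>" and "\<theta> = x $ l / \<rho> - of_int \<lfloor>x $ l / \<rho>\<rfloor>"
    have "x $ l = \<rho> * (of_int n + \<theta>)" using assms(1) by (simp add: \<theta>_def n_def)
    then have "(1 - \<theta>) * (\<rho> * of_int n) + \<theta> * (\<rho> * of_int (n + 1)) = x $ l"
      by (simp add: algebra_simps)
    then show "?\<phi> l \<lfloor>x $ l / \<rho>\<rfloor> + ?\<phi> l (\<lfloor>x $ l / \<rho>\<rfloor> + 1) = (if l = k then x $ k else 1)"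
      unfolding hat1_floor[OF assms, of "x $ l"] unfolding \<theta>_def[symmetric] unfolding n_def[symmetric]
      by simp
  qed
  also have "\<dots> = x $ k" by (simp add: prod.delta)
  finally show ?thesis .
qed

lemma interp_eq_sum:
  assumes "finite S" "\<And>i. hat \<rho> i x \<noteq> 0 \<Longrightarrow> i \<in> S"
  shows "interp \<rho> v x = (\<Sum>i\<in>S. v i * hat \<rho> i x)"
proof -
  have "interp \<rho> v x = (\<Sum>\<^sub>\<infinity>i\<in>S. v i * hat \<rho> i x)"
    unfolding interp_def by (rule infsum_cong_neutral) (use assms(2) in auto)
  then show ?thesis using assms(1) by simp
qed

lemma interp_cell:
  "\<rho> > 0 \<Longrightarrow> interp \<rho> v x = (\<Sum>i\<in>cell_corners \<rho> x. v i * hat \<rho> i x)"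
  by (rule interp_eq_sum) (auto intro: hat_support_cell_corners)

lemma has_sum_interp:
  assumes "\<rho> > 0"
  shows "((\<lambda>i. v i * hat \<rho> i x) has_sum interp \<rho> v x) UNIV"
proof -
  have "((\<lambda>i. v i * hat \<rho> i x) has_sum interp \<rho> v x) (cell_corners \<rho> x)"
    unfolding interp_cell[OF assms] by (rule has_sum_finite) simp
  then show ?thesis
    by (rule has_sum_cong_neutral[THEN iffD1, rotated -1])
       (use hat_support_cell_corners[OF assms] in auto)
qed

lemma interp_diff_const:
  assumes "\<rho> > 0"
  shows "interp \<rho> v x - c = (\<Sum>i\<in>cell_corners \<rho> x. (v i - c) * hat \<rho> i x)"
  using sum_hat_cell_corners[OF assms, of x]
  by (simp add: interp_cell assms left_diff_distrib sum_subtractf flip: sum_distrib_left)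

text \<open>Interpolation is a convex combination of the nodal values active at \<open>x\<close>, so
  a bound at those nodes passes through without loss.\<close>

lemma interp_dist_le:
  assumes "\<rho> > 0" "\<And>i. hat \<rho> i x \<noteq> 0 \<Longrightarrow> \<bar>v i - c\<bar> \<le> D"
  shows "\<bar>interp \<rho> v x - c\<bar> \<le> D"
proof -
  have "\<bar>interp \<rho> v x - c\<bar> \<le> (\<Sum>i\<in>cell_corners \<rho> x. \<bar>(v i - c) * hat \<rho> i x\<bar>)"
    unfolding interp_diff_const[OF assms(1)] by (rule sum_abs)
  also have "\<dots> \<le> (\<Sum>i\<in>cell_corners \<rho> x. D * hat \<rho> i x)"
  proof (rule sum_mono)
    fix i
    show "\<bar>(v i - c) * hat \<rho> i x\<bar> \<le> D * hat \<rho> i x"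
      using assms(2)[of i] hat_nonneg[of \<rho> i x]
      by (cases "hat \<rho> i x = 0") (auto simp: abs_mult intro: mult_right_mono)
  qed
  also have "\<dots> = D" by (simp add: sum_hat_cell_corners assms flip: sum_distrib_left)
  finally show ?thesis .
qed

lemma interp_dist_le2:
  assumes "\<rho> > 0" "\<And>i. \<bar>v i - w i\<bar> \<le> D"
  shows "\<bar>interp \<rho> v x - interp \<rho> w x\<bar> \<le> D"
proof -
  have "interp \<rho> v x - interp \<rho> w x = interp \<rho> (\<lambda>i. v i - w i) x"
    by (simp add: interp_cell assms algebra_simps sum_subtractf)
  then show ?thesis using interp_dist_le[of \<rho> x "\<lambda>i. v i - w i" 0 D] assms by simp
qed

lemma hat_shift: "hat \<rho> (i + k) (grid \<rho> i + w) = hat \<rho> k w"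
  by (simp add: hat_def grid_add algebra_simps)

lemma interp_shift: "interp \<rho> v (grid \<rho> i + w) = interp \<rho> (\<lambda>k. v (i + k)) w"
proof -
  have "bij_betw ((+) i) UNIV UNIV"
    by (rule bij_betwI[of _ _ _ "\<lambda>k. k - i"]) auto
  from infsum_reindex_bij_betw[OF this, of "\<lambda>k. v k * hat \<rho> k (grid \<rho> i + w)"]
  show ?thesis by (simp add: interp_def hat_shift)
qed

definition grid_lipschitz :: "real \<Rightarrow> real \<Rightarrow> (int^'n::finite \<Rightarrow> real) \<Rightarrow> bool" where
  "grid_lipschitz \<rho> K v \<longleftrightarrow> (\<forall>i j. \<bar>v i - v j\<bar> \<le> K * norm (grid \<rho> i - grid \<rho> j))"

text \<open>By translation invariance of the hats, both sides use the same interpolation weights.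
  The Lipschitz constant survives unchanged, so the estimate can be iterated over arbitrarily many
  time steps.\<close>

lemma interp_grid_shift_le:
  assumes "\<rho> > 0" "grid_lipschitz \<rho> K v"
  shows "\<bar>interp \<rho> v (grid \<rho> i + w) - interp \<rho> v (grid \<rho> j + w)\<bar> \<le> K * norm (grid \<rho> i - grid \<rho> j)"
  unfolding interp_shift
proof (rule interp_dist_le2[OF assms(1)])
  fix k
  show "\<bar>v (i + k) - v (j + k)\<bar> \<le> K * norm (grid \<rho> i - grid \<rho> j)"
    using assms(2)[unfolded grid_lipschitz_def, rule_format, of "i + k" "j + k"]
    by (simp add: grid_add)
qed

lemma hat_lipschitz:
  fixes x y :: "real^'n::finite"
  assumes "\<rho> > 0"
  shows "\<bar>hat \<rho> i x - hat \<rho> i y\<bar> \<le> real CARD('n) * norm (x - y) / \<rho>"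
proof -
  let ?f = "\<lambda>x l. max 0 (1 - \<bar>x $ l - grid \<rho> i $ l\<bar> / \<rho>)"
  have "norm ((\<Prod>l\<in>UNIV. ?f x l) - (\<Prod>l\<in>UNIV. ?f y l)) \<le> (\<Sum>l\<in>(UNIV::'n set). norm (?f x l - ?f y l))"
    using assms by (intro norm_prod_diff) auto
  also have "\<dots> \<le> (\<Sum>l\<in>(UNIV::'n set). norm (x - y) / \<rho>)"
  proof (rule sum_mono)
    fix l
    have "norm (?f x l - ?f y l) \<le> \<bar>\<bar>x $ l - grid \<rho> i $ l\<bar> / \<rho> - \<bar>y $ l - grid \<rho> i $ l\<bar> / \<rho>\<bar>"
      by (auto simp: max_def)
    also have "\<dots> \<le> \<bar>(x - y) $ l\<bar> / \<rho>"
      unfolding diff_divide_distrib[symmetric] abs_divide using assms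
      by (auto intro!: divide_right_mono)
    also have "\<dots> \<le> norm (x - y) / \<rho>"
      using assms by (intro divide_right_mono component_le_norm_cart) auto
    finally show "norm (?f x l - ?f y l) \<le> norm (x - y) / \<rho>" .
  qed
  finally show ?thesis by (simp add: hat_def)
qed

lemma exists_hat_nonzero: "\<rho> > 0 \<Longrightarrow> \<exists>i. hat \<rho> i x \<noteq> 0"
  using sum_hat_cell_corners[of \<rho> x] by (metis sum.neutral zero_neq_one)

lemma CARD_ge_1: "real CARD('n::finite) \<ge> 1"
  by (simp add: Suc_leI)

text \<open>For points closer than \<open>\<rho>\<close>, each hat varies by a multiple of
  \<open>|x - y| / \<rho>\<close> while the relevant nodal values differ by a multiple of
  \<open>K * \<rho>\<close>, so the mesh size cancels. For distant points the interpolation error is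
  itself controlled by \<open>K * |x - y|\<close>.\<close>

lemma interp_lipschitz:
  fixes x y :: "real^'n::finite"
  assumes \<rho>: "\<rho> > 0" and v: "grid_lipschitz \<rho> K v" and K: "K \<ge> 0"
  shows "\<bar>interp \<rho> v x - interp \<rho> v y\<bar> \<le> 6 * 2 ^ CARD('n) * real CARD('n) ^ 2 * K * norm (x - y)"
proof -
  let ?d = "real CARD('n)"
  have d1: "?d \<ge> 1" by (rule CARD_ge_1)
  obtain i0 j0 where i0: "hat \<rho> i0 x \<noteq> 0" and j0: "hat \<rho> j0 y \<noteq> 0"
    using exists_hat_nonzero[OF \<rho>] by blast
  note sup = hat_support_norm[OF \<rho>]
  have vd: "\<bar>v i - v j\<bar> \<le> K * c" if "norm (grid \<rho> i - grid \<rho> j) \<le> c" for i j c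
    using v[unfolded grid_lipschitz_def, rule_format, of i j] mult_left_mono[OF that K] by linarith
  show ?thesis
  proof (cases "norm (x - y) \<le> \<rho>")
    case True
    define S where "S = cell_corners \<rho> x \<union> cell_corners \<rho> y"
    have finS: "finite S" by (simp add: S_def)
    have cS: "card S \<le> 2 * 2 ^ CARD('n)"
      unfolding S_def using card_Un_le[of "cell_corners \<rho> x" "cell_corners \<rho> y"]
        card_cell_corners[of \<rho> x] card_cell_corners[of \<rho> y] by linarith
    have I: "interp \<rho> v z = (\<Sum>i\<in>S. v i * hat \<rho> i z)" "1 = (\<Sum>i\<in>S. hat \<rho> i z)" if "z = x \<or> z = y" for z
    proof -
      show "interp \<rho> v z = (\<Sum>i\<in>S. v i * hat \<rho> i z)"
        using that hat_support_cell_corners[OF \<rho>] by (intro interp_eq_sum finS) (auto simp: S_def)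
      have "(\<Sum>i\<in>S. hat \<rho> i z) = (\<Sum>i\<in>cell_corners \<rho> z. hat \<rho> i z)"
        using that hat_support_cell_corners[OF \<rho>, of _ z] finS
        by (intro sum.mono_neutral_right) (auto simp: S_def)
      then show "1 = (\<Sum>i\<in>S. hat \<rho> i z)" by (simp add: sum_hat_cell_corners \<rho>)
    qed
    \<comment> \<open>The subtracted multiple of \<open>v i0\<close> is zero since both hat sums
      equal 1; it replaces nodal values by increments of order \<open>K * \<rho>\<close>.\<close>
    have "interp \<rho> v x - interp \<rho> v y = (\<Sum>i\<in>S. v i * hat \<rho> i x) - (\<Sum>i\<in>S. v i * hat \<rho> i y)
        - v i0 * ((\<Sum>i\<in>S. hat \<rho> i x) - (\<Sum>i\<in>S. hat \<rho> i y))"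
      using I[of x] I[of y] by simp
    also have "\<dots> = (\<Sum>i\<in>S. (v i - v i0) * (hat \<rho> i x - hat \<rho> i y))"
      by (simp add: left_diff_distrib right_diff_distrib sum_subtractf sum_distrib_left)
    finally have "\<bar>interp \<rho> v x - interp \<rho> v y\<bar> \<le> (\<Sum>i\<in>S. \<bar>v i - v i0\<bar> * \<bar>hat \<rho> i x - hat \<rho> i y\<bar>)"
      by (simp flip: abs_mult)
    also have "\<dots> \<le> (\<Sum>i\<in>S. (K * (3 * ?d * \<rho>)) * (?d * norm (x - y) / \<rho>))"
    proof (rule sum_mono)
      fix i
      show "\<bar>v i - v i0\<bar> * \<bar>hat \<rho> i x - hat \<rho> i y\<bar> \<le> (K * (3 * ?d * \<rho>)) * (?d * norm (x - y) / \<rho>)"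
      proof (cases "hat \<rho> i x = 0 \<and> hat \<rho> i y = 0")
        case True then show ?thesis using K \<rho> by simp
      next
        case False
        have "\<rho> \<le> ?d * \<rho>" using d1 \<rho> by simp
        then have "norm (grid \<rho> i - x) \<le> 2 * ?d * \<rho>"
        proof (cases "hat \<rho> i x = 0")
          case True
          then have "hat \<rho> i y \<noteq> 0" using False by simp
          from sup[OF this] have "norm (grid \<rho> i - x) \<le> ?d * \<rho> + norm (x - y)"
            using norm_triangle_sub[of "grid \<rho> i - x" "grid \<rho> i - y"] by (simp add: norm_minus_commute)
          then show ?thesis using \<open>norm (x - y) \<le> \<rho>\<close> \<open>\<rho> \<le> ?d * \<rho>\<close> by linarith
        next
          case False
          from sup[OF this] show ?thesis using d1 \<rho> \<open>\<rho> \<le> ?d * \<rho>\<close> by linarith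
        qed
        then have "norm (grid \<rho> i - grid \<rho> i0) \<le> 3 * ?d * \<rho>"
          using sup[OF i0] norm_triangle_sub[of "grid \<rho> i - grid \<rho> i0" "grid \<rho> i - x"]
          by (simp add: norm_minus_commute)
        from vd[OF this] show ?thesis
          using hat_lipschitz[OF \<rho>, of i x y] K \<rho> by (intro mult_mono) auto
      qed
    qed
    also have "\<dots> = real (card S) * (3 * ?d\<^sup>2 * K * norm (x - y))"
      using \<rho> by (simp add: power2_eq_square)
    also have "\<dots> \<le> real (2 * 2 ^ CARD('n)) * (3 * ?d\<^sup>2 * K * norm (x - y))"
      using cS K by (intro mult_right_mono) (auto simp del: of_nat_mult of_nat_power)
    finally show ?thesis by (simp add: algebra_simps)
  next
    case False
    then have xy: "\<rho> \<le> norm (x - y)" by simp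
    have "\<bar>interp \<rho> v x - v i0\<bar> \<le> K * (2 * ?d * \<rho>)"
    proof (rule interp_dist_le[OF \<rho>], rule vd)
      fix i assume "hat \<rho> i x \<noteq> 0"
      then show "norm (grid \<rho> i - grid \<rho> i0) \<le> 2 * ?d * \<rho>"
        using sup[of i x] sup[OF i0] norm_triangle_sub[of "grid \<rho> i - grid \<rho> i0" "grid \<rho> i - x"]
        by (simp add: norm_minus_commute)
    qed
    moreover have "\<bar>interp \<rho> v y - v j0\<bar> \<le> K * (2 * ?d * \<rho>)"
    proof (rule interp_dist_le[OF \<rho>], rule vd)
      fix i assume "hat \<rho> i y \<noteq> 0"
      then show "norm (grid \<rho> i - grid \<rho> j0) \<le> 2 * ?d * \<rho>"
        using sup[of i y] sup[OF j0] norm_triangle_sub[of "grid \<rho> i - grid \<rho> j0" "grid \<rho> i - y"]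
        by (simp add: norm_minus_commute)
    qed
    moreover have "\<bar>v i0 - v j0\<bar> \<le> K * (2 * ?d * \<rho> + norm (x - y))"
    proof (rule vd)
      have "grid \<rho> i0 - grid \<rho> j0 = (grid \<rho> i0 - x) + (x - y) - (grid \<rho> j0 - y)" by simp
      then have "norm (grid \<rho> i0 - grid \<rho> j0) \<le> norm (grid \<rho> i0 - x) + norm (x - y) + norm (grid \<rho> j0 - y)"
        by (simp only:) (rule order_trans[OF norm_triangle_ineq4 add_right_mono[OF norm_triangle_ineq]])
      then show "norm (grid \<rho> i0 - grid \<rho> j0) \<le> 2 * ?d * \<rho> + norm (x - y)"
        using sup[OF i0] sup[OF j0] by linarith
    qed
    ultimately have "\<bar>interp \<rho> v x - interp \<rho> v y\<bar> \<le> K * (2 * ?d * \<rho>) + K * (2 * ?d * \<rho>) + K * (2 * ?d * \<rho> + norm (x - y))"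
      by linarith
    also have "\<dots> = K * (6 * ?d * \<rho> + norm (x - y))" by (simp add: algebra_simps)
    also have "\<dots> \<le> K * (12 * ?d\<^sup>2 * norm (x - y))"
    proof (rule mult_left_mono[OF _ K])
      have dd: "?d \<le> ?d\<^sup>2" using d1 by (simp add: power2_eq_square)
      have "6 * ?d * \<rho> + norm (x - y) \<le> 6 * ?d * norm (x - y) + 6 * ?d * norm (x - y)"
      proof (rule add_mono)
        show "6 * ?d * \<rho> \<le> 6 * ?d * norm (x - y)" using xy d1 by (intro mult_left_mono) auto
        show "norm (x - y) \<le> 6 * ?d * norm (x - y)"
          using mult_right_mono[of 1 "6 * ?d" "norm (x - y)"] d1 by simp
      qed
      also have "\<dots> = 12 * ?d * norm (x - y)" by simp
      also have "\<dots> \<le> 12 * ?d\<^sup>2 * norm (x - y)"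
        using dd by (intro mult_right_mono) auto
      finally show "6 * ?d * \<rho> + norm (x - y) \<le> 12 * ?d\<^sup>2 * norm (x - y)" .
    qed
    \<comment> \<open>The far case fits under the constant of the near case because
      \<open>2 ^ CARD('n) \<ge> 2\<close>.\<close>
    also have "\<dots> \<le> K * (6 * 2 ^ CARD('n) * ?d\<^sup>2 * norm (x - y))"
    proof (intro mult_left_mono[OF _ K] mult_right_mono)
      have "(2::real) ^ 1 \<le> 2 ^ CARD('n)" by (intro power_increasing) (auto simp: Suc_leI)
      then show "12 \<le> 6 * (2::real) ^ CARD('n)" by simp
    qed auto
    finally show ?thesis by (simp add: mult_ac)
  qed
qed

text \<open>A C(1,1) bound without derivatives: \<open>g\<close> plays the gradient, and second
  derivatives are only ever used through this remainder. The bound on \<open>g\<close> is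
  independent of \<open>A\<close> and controls the drift terms.\<close>

definition quad_approx :: "real \<Rightarrow> (real^'n::finite \<Rightarrow> real) \<Rightarrow> bool" where
  "quad_approx A \<phi> \<longleftrightarrow> (\<forall>x. \<exists>g. norm g \<le> 1 \<and> (\<forall>z. \<bar>\<phi> (x + z) - \<phi> x - g \<bullet> z\<bar> \<le> A * (norm z)\<^sup>2))"

text \<open>The affine part of the expansion at \<open>x\<close> is reproduced exactly, so only the
  quadratic remainder at nodes within distance \<open>CARD('n) * \<rho>\<close> contributes.\<close>

lemma interp_quad_approx:
  fixes \<phi> :: "real^'n::finite \<Rightarrow> real"
  assumes \<rho>: "\<rho> > 0" and q: "quad_approx A \<phi>" and A: "A \<ge> 0"
  shows "\<bar>interp \<rho> (\<lambda>i. \<phi> (grid \<rho> i)) x - \<phi> x\<bar> \<le> A * real CARD('n) ^ 2 * \<rho>\<^sup>2"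
proof -
  let ?d = "real CARD('n)"
  obtain g where g: "\<And>z. \<bar>\<phi> (x + z) - \<phi> x - g \<bullet> z\<bar> \<le> A * (norm z)\<^sup>2"
    using q unfolding quad_approx_def by blast
  have lin: "(\<Sum>i\<in>cell_corners \<rho> x. hat \<rho> i x *\<^sub>R (grid \<rho> i - x)) = 0"
    by (simp add: vec_eq_iff right_diff_distrib sum_subtractf sum_hat_coord[OF \<rho>, simplified]
        sum_hat_cell_corners[OF \<rho>] flip: sum_distrib_right)
  have "(\<Sum>i\<in>cell_corners \<rho> x. (g \<bullet> (grid \<rho> i - x)) * hat \<rho> i x)
      = g \<bullet> (\<Sum>i\<in>cell_corners \<rho> x. hat \<rho> i x *\<^sub>R (grid \<rho> i - x))"
    by (simp add: inner_sum_right mult.commute)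
  then have z: "(\<Sum>i\<in>cell_corners \<rho> x. (g \<bullet> (grid \<rho> i - x)) * hat \<rho> i x) = 0" using lin by simp
  have "interp \<rho> (\<lambda>i. \<phi> (grid \<rho> i)) x - \<phi> x
     = interp \<rho> (\<lambda>i. \<phi> (grid \<rho> i) - \<phi> x - g \<bullet> (grid \<rho> i - x)) x"
    using z unfolding interp_diff_const[OF \<rho>] interp_cell[OF \<rho>]
    by (simp add: left_diff_distrib sum_subtractf)
      (simp add: sum_hat_cell_corners[OF \<rho>] flip: sum_distrib_left)
  also have "\<bar>\<dots> - 0\<bar> \<le> A * (?d * \<rho>)\<^sup>2"
  proof (rule interp_dist_le[OF \<rho>])
    fix i assume "hat \<rho> i x \<noteq> 0"
    note h = hat_support_norm[OF \<rho> this]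
    have "\<bar>\<phi> (grid \<rho> i) - \<phi> x - g \<bullet> (grid \<rho> i - x)\<bar> \<le> A * (norm (grid \<rho> i - x))\<^sup>2"
      using g[of "grid \<rho> i - x"] by simp
    also have "\<dots> \<le> A * (?d * \<rho>)\<^sup>2" using h A by (intro mult_left_mono power_mono) auto
    finally show "\<bar>\<phi> (grid \<rho> i) - \<phi> x - g \<bullet> (grid \<rho> i - x) - 0\<bar> \<le> A * (?d * \<rho>)\<^sup>2" by simp
  qed
  finally show ?thesis by (simp add: power_mult_distrib mult_ac)
qed

section \<open>Mollification of bounded Lipschitz functions\<close>

lemma integral_lborel_shift:
  fixes F :: "'a::euclidean_space \<Rightarrow> 'b::{banach,second_countable_topology}"
  assumes [measurable]: "F \<in> borel_measurable borel"
  shows "(\<integral>y. F (c + y) \<partial>lborel) = (\<integral>y. F y \<partial>lborel)"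
proof -
  have "(\<integral>y. F y \<partial>lborel) = (\<integral>y. F y \<partial>distr lborel borel ((+) c))"
    by (simp add: lborel_distr_plus)
  also have "\<dots> = (\<integral>y. F (c + y) \<partial>lborel)" by (subst integral_distr) auto
  finally show ?thesis by simp
qed

lemma integrable_indicator_cball [simp]:
  "integrable lborel (indicat_real (cball (c::'a::euclidean_space) R))"
  using emeasure_bounded_finite[OF bounded_cball, of c R] by (simp add: integrable_indicator_iff)

lemma integrable_lborel_bounded_support:
  fixes F :: "'a::euclidean_space \<Rightarrow> real"
  assumes [measurable]: "F \<in> borel_measurable borel"
    and "\<And>y. norm y \<le> R \<Longrightarrow> \<bar>F y\<bar> \<le> B" "\<And>y. norm y > R \<Longrightarrow> F y = 0"
  shows "integrable lborel F"
proof (rule Bochner_Integration.integrable_bound)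
  show "integrable lborel (\<lambda>y. B * indicator (cball (0::'a) R) y)" by simp
  show "AE x in lborel. norm (F x) \<le> norm (B * indicator (cball 0 R) x)"
  proof (rule AE_I2)
    fix y show "norm (F y) \<le> norm (B * indicator (cball 0 R) y)"
      using assms(2)[of y] assms(3)[of y] by (cases "norm y \<le> R") (auto simp: indicator_def)
  qed
qed simp

text \<open>A kernel of class C(1,1) that is polynomial on its support, so that its second-order
  expansion is elementary algebra. It smooths test functions and is distinct from
  \<open>std_moll\<close>.\<close>

definition bump :: "'a::euclidean_space \<Rightarrow> real" where
  "bump y = (max 0 (1 - (norm y)\<^sup>2))\<^sup>2"

lemma continuous_on_bump: "continuous_on S bump"
  unfolding bump_def by (intro continuous_intros)

lemma bump_measurable [measurable]: "bump \<in> borel_measurable borel"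
  by (intro borel_measurable_continuous_onI continuous_on_bump)

lemma bump_nonneg: "0 \<le> bump y" by (simp add: bump_def)

lemma bump_le_1: "bump y \<le> 1"
  unfolding bump_def by (intro power_le_one) auto

lemma bump_eq_0: "1 \<le> norm y \<Longrightarrow> bump y = 0"
  using one_le_power[of "norm y" 2] by (simp add: bump_def)

lemma integral_bump_pos: "(\<integral>y. bump y \<partial>(lborel::'a::euclidean_space measure)) > 0"
proof -
  let ?B = "cball (0::'a) (1/2)"
  have "(1/4) * measure lborel ?B = (\<integral>y. (1/4) * indicator ?B y \<partial>lborel)" by simp
  also have "\<dots> \<le> (\<integral>y. bump y \<partial>(lborel::'a measure))"
  proof (rule Bochner_Integration.integral_mono)
    show "integrable lborel (bump :: 'a \<Rightarrow> real)"
      by (rule integrable_lborel_bounded_support[where R=1 and B=1])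
         (auto simp: bump_nonneg bump_le_1 bump_eq_0)
    fix y :: 'a
    show "1/4 * indicator ?B y \<le> bump y"
    proof (cases "y \<in> ?B")
      case True
      then have "(norm y)\<^sup>2 \<le> (1/2)\<^sup>2" by (intro power_mono) auto
      then have "3/4 \<le> max 0 (1 - (norm y)\<^sup>2)" by (simp add: power2_eq_square)
      then have "(3/4)\<^sup>2 \<le> bump y" unfolding bump_def by (rule power_mono) simp
      then show ?thesis using True by (simp add: power2_eq_square)
    qed (simp add: bump_nonneg)
  qed simp
  finally show ?thesis using content_cball_pos[of "1/2" "0::'a"] by linarith
qed

text \<open>The scalar function \<open>s \<mapsto> (max 0 s)^2\<close> has a first-order remainder
  between 0 and the squared increment. It is applied between \<open>a = 1 - |y|^2\<close> and
  \<open>b = 1 - |y - z|^2\<close>; beyond radius 2 everything vanishes.\<close>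

lemma bump_taylor:
  fixes y z :: "'a::euclidean_space"
  assumes "norm z \<le> 1"
  shows "\<bar>bump (y - z) - bump y - 4 * max 0 (1 - (norm y)\<^sup>2) * (y \<bullet> z)\<bar>
         \<le> 27 * (norm z)\<^sup>2 * indicator (cball 0 2) y"
proof (cases "norm y \<le> 2")
  case True
  define a b where "a = 1 - (norm y)\<^sup>2" and "b = 1 - (norm (y - z))\<^sup>2"
  have pos: "0 \<le> (max 0 b)\<^sup>2 - (max 0 a)\<^sup>2 - 2 * max 0 a * (b - a)"
    "(max 0 b)\<^sup>2 - (max 0 a)\<^sup>2 - 2 * max 0 a * (b - a) \<le> (b - a)\<^sup>2"
  proof -
    have "0 \<le> (max 0 b - max 0 a)\<^sup>2 + 2 * max 0 a * (max 0 b - b)" by simp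
    moreover have "2 * max 0 a * (max 0 b - b) + (max 0 b - max 0 a)\<^sup>2 \<le> (b - a)\<^sup>2"
    proof (cases "a \<ge> 0"; cases "b \<ge> 0")
      assume "a \<ge> 0" "\<not> b \<ge> 0" 
      then have "2 * a * (- b) + a\<^sup>2 \<le> (b - a)\<^sup>2" by (simp add: power2_eq_square algebra_simps)
      then show ?thesis using \<open>a \<ge> 0\<close> \<open>\<not> b \<ge> 0\<close> by simp
    next
      assume *: "\<not> a \<ge> 0" "b \<ge> 0"
      then have "b\<^sup>2 \<le> (b - a)\<^sup>2" by (intro power_mono) auto
      then show ?thesis using * by simp
    qed auto
    moreover have "(max 0 b)\<^sup>2 - (max 0 a)\<^sup>2 - 2 * max 0 a * (b - a) 
        = (max 0 b - max 0 a)\<^sup>2 + 2 * max 0 a * (max 0 b - b)"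
      by (cases "a \<ge> 0") (auto simp: max_def power2_eq_square algebra_simps)
    ultimately show "0 \<le> (max 0 b)\<^sup>2 - (max 0 a)\<^sup>2 - 2 * max 0 a * (b - a)"
      "(max 0 b)\<^sup>2 - (max 0 a)\<^sup>2 - 2 * max 0 a * (b - a) \<le> (b - a)\<^sup>2" by linarith+
  qed
  have ba: "b - a = 2 * (y \<bullet> z) - (norm z)\<^sup>2"
    by (simp add: a_def b_def power2_norm_eq_inner inner_diff inner_commute)
  have "\<bar>b - a\<bar> \<le> 2 * \<bar>y \<bullet> z\<bar> + (norm z)\<^sup>2" 
    unfolding ba using abs_triangle_ineq4[of "2 * (y \<bullet> z)" "(norm z)\<^sup>2"] by (simp add: abs_mult)
  also have "\<dots> \<le> 2 * (2 * norm z) + norm z"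
  proof (intro add_mono mult_left_mono)
    show "\<bar>y \<bullet> z\<bar> \<le> 2 * norm z"
      using Cauchy_Schwarz_ineq2[of y z] mult_right_mono[OF True norm_ge_zero[of z]] by linarith
    show "(norm z)\<^sup>2 \<le> norm z"
      using assms by (simp add: power2_eq_square mult_left_le)
  qed simp
  finally have "\<bar>b - a\<bar>\<^sup>2 \<le> (5 * norm z)\<^sup>2" by (intro power_mono) auto
  then have bab: "(b - a)\<^sup>2 \<le> 25 * (norm z)\<^sup>2" by (simp add: power_mult_distrib)
  have m: "0 \<le> max 0 a" "max 0 a \<le> 1" by (auto simp: a_def)
  then have m': "0 \<le> max 0 a * (norm z)\<^sup>2" "max 0 a * (norm z)\<^sup>2 \<le> (norm z)\<^sup>2"
    by (auto intro: mult_right_le_one_le mult_left_le_one_le)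
  \<comment> \<open>The quadratic part of the increment \<open>b - a\<close> leaves the last term,
    which contributes 2 to the constant; \<open>bab\<close> contributes 25.\<close>
  have "bump (y - z) - bump y - 4 * max 0 a * (y \<bullet> z)
     = ((max 0 b)\<^sup>2 - (max 0 a)\<^sup>2 - 2 * max 0 a * (b - a)) - 2 * (max 0 a * (norm z)\<^sup>2)"
    unfolding ba bump_def a_def[symmetric] b_def[symmetric] by (simp add: algebra_simps)
  also have "\<bar>\<dots>\<bar> \<le> 27 * (norm z)\<^sup>2" using pos bab m' by (simp only: abs_le_iff) linarith
  finally show ?thesis using True by (simp add: a_def)
next
  case False
  have "norm y \<le> norm (y - z) + norm z" by (metis diff_add_cancel norm_triangle_ineq)
  then have "1 \<le> norm (y - z)" using False assms by linarith
  moreover have "max 0 (1 - (norm y)\<^sup>2) = 0" using False one_le_power[of "norm y" 2] by simp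
  ultimately show ?thesis using False by (simp add: bump_eq_0)
qed

text \<open>After a change of variables, differences of the average fall on the kernel, so its
  smoothness transfers to \<open>\<phi>\<close>, while size and Lipschitz bounds come from
  averaging. The bound \<open>B\<close> is arbitrary, with \<open>A\<close> independent of it,
  because rescaling produces functions of size \<open>1 / \<delta>\<close>.\<close>

lemma exists_quad_approx_unit:
  "\<exists>A\<ge>0. \<forall>f :: real^'n::finite \<Rightarrow> real. \<forall>B. 1-lipschitz_on UNIV f \<longrightarrow> (\<forall>x. \<bar>f x\<bar> \<le> B) \<longrightarrow>
     (\<exists>\<phi>. (\<forall>x. \<bar>\<phi> x - f x\<bar> \<le> 1) \<and> (\<forall>x. \<bar>\<phi> x\<bar> \<le> B) \<and> 1-lipschitz_on UNIV \<phi> \<and> quad_approx A \<phi>)"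
proof -
  let ?\<kappa> = "\<integral>y. bump y \<partial>(lborel :: (real^'n) measure)"
  define V where "V = measure lborel (cball (0::real^'n) 2)"
  \<comment> \<open>54 is the Taylor constant 27 times the bound 2 for
    \<open>|f (x + y) - f x|\<close> on the ball of volume \<open>V\<close>. The summand 2 handles
    \<open>|z| > 1\<close>, where the Lipschitz bounds suffice.\<close>
  define A where "A = 2 + 54 * V / ?\<kappa>"
  have \<kappa>: "?\<kappa> > 0" by (rule integral_bump_pos)
  have V0: "0 \<le> V" by (simp add: V_def)
  have A2: "A \<ge> 2" using \<kappa> V0 by (simp add: A_def)
  have "\<exists>\<phi>. (\<forall>x. \<bar>\<phi> x - f x\<bar> \<le> 1) \<and> (\<forall>x. \<bar>\<phi> x\<bar> \<le> B) \<and> 1-lipschitz_on UNIV \<phi> \<and> quad_approx A \<phi>"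
    if lip: "1-lipschitz_on UNIV f" and bd: "\<And>x. \<bar>f x\<bar> \<le> B" for f :: "real^'n \<Rightarrow> real" and B
  proof -
    have fl: "\<bar>f x - f y\<bar> \<le> norm (x - y)" for x y
      using lipschitz_onD[OF lip, of x y] by (simp add: dist_norm)
    have [measurable]: "f \<in> borel_measurable borel"
      by (intro borel_measurable_continuous_onI lipschitz_on_continuous_on[OF lip])
    have B0: "0 \<le> B" using bd[of 0] by linarith
    define \<phi> where "\<phi> x = (\<integral>y. f (x + y) * bump y \<partial>lborel) / ?\<kappa>" for x
    have kint: "integrable lborel (bump :: real^'n \<Rightarrow> real)"
      by (rule integrable_lborel_bounded_support[where R=1 and B=1])
         (auto simp: bump_nonneg bump_le_1 bump_eq_0)
    have kint': "integrable lborel (\<lambda>y::real^'n. bump (y - z))" for z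
    proof (rule integrable_lborel_bounded_support[where R="1 + norm z" and B=1])
      fix y :: "real^'n" assume "norm y > 1 + norm z"
      then have "1 \<le> norm (y - z)" using norm_triangle_sub[of y z] by linarith
      then show "bump (y - z) = 0" by (rule bump_eq_0)
    qed (auto simp: bump_nonneg bump_le_1)
    have fint: "integrable lborel (\<lambda>y. f (x + y) * bump (y - z))" for x z
      by (rule Bochner_Integration.integrable_bound[of _ "\<lambda>y. B * bump (y - z)"])
         (auto simp: kint' abs_mult bump_nonneg B0 intro!: mult_right_mono bd AE_I2)
    have fint0: "integrable lborel (\<lambda>y. f (x + y) * bump y)" for x using fint[of x 0] by simp
    have avg: "\<phi> x - c = (\<integral>y. (f (x + y) - c) * bump y \<partial>lborel) / ?\<kappa>" for x c
      using \<kappa> fint0[of x] kint by (simp add: \<phi>_def left_diff_distrib diff_divide_distrib)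
    have avg_le: "\<bar>(\<integral>y. F y * bump y \<partial>lborel) / ?\<kappa>\<bar> \<le> D"
      if "integrable lborel (\<lambda>y. F y * bump y)" "\<And>y. norm y < 1 \<Longrightarrow> \<bar>F y\<bar> \<le> D" for F :: "real^'n \<Rightarrow> real" and D
    proof -
      have "\<bar>\<integral>y. F y * bump y \<partial>lborel\<bar> \<le> (\<integral>y. D * bump y \<partial>(lborel :: (real^'n) measure))"
      proof (rule order_trans[OF integral_abs_bound Bochner_Integration.integral_mono])
        fix y :: "real^'n"
        show "\<bar>F y * bump y\<bar> \<le> D * bump y"
          using that(2)[of y] bump_eq_0[of y] bump_nonneg[of y]
          by (cases "norm y < 1") (auto simp: abs_mult intro: mult_right_mono)
      qed (use that(1) kint in auto)
      then show ?thesis using \<kappa> by (simp add: field_simps)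
    qed
    have close: "\<bar>\<phi> x - f x\<bar> \<le> 1" for x
      unfolding avg
    proof (rule avg_le)
      show "integrable lborel (\<lambda>y. (f (x + y) - f x) * bump y)"
        using fint0[of x] kint by (simp add: left_diff_distrib)
      fix y :: "real^'n" assume "norm y < 1"
      then show "\<bar>f (x + y) - f x\<bar> \<le> 1" using fl[of "x + y" x] by simp
    qed
    have bnd: "\<bar>\<phi> x\<bar> \<le> B" for x
      unfolding \<phi>_def by (rule avg_le[OF fint0 bd])
    have philip: "\<bar>\<phi> x - \<phi> y\<bar> \<le> norm (x - y)" for x y
    proof -
      have "\<phi> x - \<phi> y = (\<integral>w. (f (x + w) - f (y + w)) * bump w \<partial>lborel) / ?\<kappa>"
        using fint0[of x] fint0[of y] by (simp add: \<phi>_def left_diff_distrib diff_divide_distrib)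
      also have "\<bar>\<dots>\<bar> \<le> norm (x - y)"
      proof (rule avg_le)
        show "integrable lborel (\<lambda>w. (f (x + w) - f (y + w)) * bump w)"
          using fint0[of x] fint0[of y] by (simp add: left_diff_distrib)
        show "\<bar>f (x + w) - f (y + w)\<bar> \<le> norm (x - y)" for w using fl[of "x + w" "y + w"] by simp
      qed
      finally show ?thesis .
    qed
    have "\<exists>g. norm g \<le> 1 \<and> (\<forall>z. \<bar>\<phi> (x + z) - \<phi> x - g \<bullet> z\<bar> \<le> A * (norm z)\<^sup>2)" for x
    proof -
      let ?p = "\<lambda>y::real^'n. max 0 (1 - (norm y)\<^sup>2)"
      let ?G = "\<lambda>y. ((f (x + y) - f x) * (4 * ?p y)) *\<^sub>R y"
      have Gint: "integrable lborel ?G"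
      proof (rule Bochner_Integration.integrable_bound[of _ "\<lambda>y. (8 * indicator (cball 0 2) y) :: real"])
        show "AE y in lborel. norm (?G y) \<le> norm (8 * indicator (cball 0 2) y :: real)"
        proof (rule AE_I2)
          fix y :: "real^'n"
          show "norm (?G y) \<le> norm (8 * indicator (cball 0 2) y :: real)"
          proof (cases "norm y < 1")
            case True
            have "norm (?G y) = \<bar>f (x + y) - f x\<bar> * (4 * ?p y) * norm y" by (simp add: abs_mult)
            also have "\<dots> \<le> 1 * (4 * 1) * 1"
              using fl[of "x + y" x] True by (intro mult_mono) auto
            finally show ?thesis using True by simp
          next
            case False
            then have "1 \<le> (norm y)\<^sup>2" by (simp add: one_le_power)
            then show ?thesis by simp
          qed
        qed
      qed simp_all
      \<comment> \<open>The vector field \<open>4 * ?p y\<close> times \<open>y\<close> is minus the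
        gradient of \<open>bump\<close>, so \<open>g\<close> is the derivative of the average taken
        under the integral. Subtracting \<open>f x\<close> changes nothing, as the field is odd, and
        makes the estimate independent of \<open>B\<close>.\<close>
      define g where "g = (1 / ?\<kappa>) *\<^sub>R (\<integral>y. ?G y \<partial>lborel)"
      have gz: "g \<bullet> z = (\<integral>y. (f (x + y) - f x) * (4 * ?p y * (y \<bullet> z)) \<partial>lborel) / ?\<kappa>" for z
      proof -
        have "(\<integral>y. ?G y \<partial>lborel) \<bullet> z = (\<integral>y. ?G y \<bullet> z \<partial>lborel)"
          using Gint by (rule integral_inner_left[symmetric, rotated]) 
        then show ?thesis by (simp add: g_def mult.assoc)
      qed
      have gzint: "integrable lborel (\<lambda>y. (f (x + y) - f x) * (4 * ?p y * (y \<bullet> z)))" for z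
        using integrable_inner_left[OF Gint, of z] by (simp add: mult.assoc)
      have small: "\<bar>\<phi> (x + z) - \<phi> x - g \<bullet> z\<bar> \<le> A * (norm z)\<^sup>2" if z: "norm z \<le> 1" for z
      proof -
        have sh: "(\<integral>y. f (x + z + y) * bump y \<partial>lborel) = (\<integral>y. f (x + y) * bump (y - z) \<partial>lborel)"
          using integral_lborel_shift[of "\<lambda>y. f (x + y) * bump (y - z)" z]
          by (simp add: add.assoc)
        have kz: "(\<integral>y. bump (y - z) \<partial>lborel) = ?\<kappa>"
          using integral_lborel_shift[of "\<lambda>y. bump (y - z)" z] by simp
        have i1: "integrable lborel (\<lambda>y. (f (x + y) - f x) * (bump (y - z) - bump y))"
          using fint[of x z] fint0[of x] kint kint'[of z] by (simp add: algebra_simps)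
        have "(\<integral>y. (f (x + y) - f x) * (bump (y - z) - bump y) \<partial>lborel)
           = (\<integral>y. f (x + y) * bump (y - z) - f x * bump (y - z) - (f (x + y) * bump y - f x * bump y) \<partial>lborel)"
          by (simp add: algebra_simps)
        also have "\<dots> = (\<integral>y. f (x + y) * bump (y - z) \<partial>lborel) - (\<integral>y. f (x + y) * bump y \<partial>lborel)"
          using fint[of x z] fint0[of x] kint kint'[of z] kz by simp
        finally have "\<phi> (x + z) - \<phi> x = (\<integral>y. (f (x + y) - f x) * (bump (y - z) - bump y) \<partial>lborel) / ?\<kappa>"
          by (simp add: \<phi>_def sh diff_divide_distrib)
        then have "\<phi> (x + z) - \<phi> x - g \<bullet> z = (\<integral>y. (f (x + y) - f x) * (bump (y - z) - bump y)
             - (f (x + y) - f x) * (4 * ?p y * (y \<bullet> z)) \<partial>lborel) / ?\<kappa>"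
          using i1 gzint[of z] by (simp add: gz diff_divide_distrib)
        moreover have "\<bar>\<integral>y. (f (x + y) - f x) * (bump (y - z) - bump y)
             - (f (x + y) - f x) * (4 * ?p y * (y \<bullet> z)) \<partial>lborel\<bar>
             \<le> (\<integral>y. (54 * (norm z)\<^sup>2) * indicator (cball (0::real^'n) 2) y \<partial>lborel)"
        proof (rule order_trans[OF integral_abs_bound Bochner_Integration.integral_mono])
          fix y :: "real^'n"
          have "\<bar>(f (x + y) - f x) * (bump (y - z) - bump y) - (f (x + y) - f x) * (4 * ?p y * (y \<bullet> z))\<bar>
             = \<bar>f (x + y) - f x\<bar> * \<bar>bump (y - z) - bump y - 4 * ?p y * (y \<bullet> z)\<bar>"
            by (simp add: right_diff_distrib flip: abs_mult)
          also have "\<dots> \<le> norm y * (27 * (norm z)\<^sup>2 * indicator (cball 0 2) y)"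
            using fl[of "x + y" x] bump_taylor[OF z, of y] by (intro mult_mono) auto
          also have "\<dots> \<le> 54 * (norm z)\<^sup>2 * indicator (cball 0 2) y"
            using mult_right_mono[of "norm y" 2 "27 * (norm z)\<^sup>2"] by (cases "norm y \<le> 2") auto
          finally show "\<bar>(f (x + y) - f x) * (bump (y - z) - bump y) - (f (x + y) - f x) * (4 * ?p y * (y \<bullet> z))\<bar>
             \<le> 54 * (norm z)\<^sup>2 * indicator (cball 0 2) y" .
        qed (use i1 gzint[of z] in auto)
        ultimately have "\<bar>\<phi> (x + z) - \<phi> x - g \<bullet> z\<bar> \<le> 54 * (norm z)\<^sup>2 * V / ?\<kappa>"
          using \<kappa> by (simp add: V_def divide_right_mono)
        also have "\<dots> \<le> A * (norm z)\<^sup>2" by (simp add: A_def algebra_simps)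
        finally show ?thesis .
      qed
      have g1: "norm g \<le> 1"
      proof (rule ccontr)
        assume ng: "\<not> norm g \<le> 1"
        \<comment> \<open>Testing the expansion along \<open>g\<close> at a step
          \<open>t \<le> e\<close> gives \<open>norm g \<le> 1 + A * t\<close>; this
          \<open>e\<close> makes \<open>A * e\<close> at most half of
          \<open>norm g - 1\<close>.\<close>
        define e where "e = (norm g - 1) / (2 * A * norm g)"
        have gp: "norm g > 0" using ng by linarith
        have e: "e > 0" unfolding e_def using ng A2 gp by (intro divide_pos_pos mult_pos_pos) auto
        define t where "t = min e 1"
        have t: "0 < t" "t \<le> 1" "t \<le> e" using e by (auto simp: t_def)
        let ?z = "(t / norm g) *\<^sub>R g"
        have nz: "norm ?z = t" using gp t by simp
        have gzt: "g \<bullet> ?z = t * norm g" using gp by (simp add: power2_norm_eq_inner[symmetric] power2_eq_square)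
        have "t * norm g \<le> \<bar>\<phi> (x + ?z) - \<phi> x\<bar> + A * t\<^sup>2"
          using small[of ?z, unfolded nz gzt, OF t(2)] by linarith
        also have "\<dots> \<le> t + A * t\<^sup>2" using philip[of "x + ?z" x] nz by simp
        also have "\<dots> = t * (1 + A * t)" by (simp add: power2_eq_square algebra_simps)
        finally have "norm g \<le> 1 + A * t" using t(1) by (simp only: mult_le_cancel_left_pos)
        also have "A * t \<le> A * e" using t A2 by (intro mult_left_mono) auto
        also have "A * e = (norm g - 1) / (2 * norm g)" using A2 by (simp add: e_def)
        also have "\<dots> \<le> (norm g - 1) / 2" using ng by (intro divide_left_mono) auto
        finally show False using ng by (simp add: field_simps)
      qed
      have "\<bar>\<phi> (x + z) - \<phi> x - g \<bullet> z\<bar> \<le> A * (norm z)\<^sup>2" for z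
      proof (cases "norm z \<le> 1")
        case False
        have "\<bar>\<phi> (x + z) - \<phi> x - g \<bullet> z\<bar> \<le> norm z + norm g * norm z"
          using philip[of "x + z" x] Cauchy_Schwarz_ineq2[of g z] by simp
        also have "\<dots> \<le> 2 * norm z" using mult_right_mono[OF g1, of "norm z"] by simp
        also have "\<dots> \<le> 2 * (norm z)\<^sup>2"
          using False by (simp add: power2_eq_square mult_le_cancel_left1)
        also have "\<dots> \<le> A * (norm z)\<^sup>2" using A2 by (intro mult_right_mono) auto
        finally show ?thesis .
      qed (rule small)
      then show ?thesis using g1 by blast
    qed
    then have "quad_approx A \<phi>" unfolding quad_approx_def by blast
    moreover have "1-lipschitz_on UNIV \<phi>"
      using philip by (intro lipschitz_onI) (auto simp: dist_norm)
    ultimately show ?thesis using close bnd by blast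
  qed
  then show ?thesis using A2 by (intro exI[of _ A]) auto
qed

text \<open>Scaling: \<open>f (\<delta> x) / \<delta>\<close> is again 1-Lipschitz. Undoing it
  multiplies the distance to \<open>f\<close> by \<open>\<delta>\<close> and the second-order
  constant by \<open>1 / \<delta>\<close>, and leaves gradients unchanged.\<close>

lemma exists_quad_approx:
  "\<exists>A\<ge>0. \<forall>f :: real^'n::finite \<Rightarrow> real. \<forall>\<delta>>0. 1-lipschitz_on UNIV f \<longrightarrow> (\<forall>x. \<bar>f x\<bar> \<le> 1) \<longrightarrow>
     (\<exists>\<phi>. (\<forall>x. \<bar>\<phi> x - f x\<bar> \<le> \<delta>) \<and> (\<forall>x. \<bar>\<phi> x\<bar> \<le> 1) \<and> 1-lipschitz_on UNIV \<phi> \<and> quad_approx (A / \<delta>) \<phi>)"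
proof -
  obtain A where A0: "A \<ge> 0" and A: "\<And>(f :: real^'n \<Rightarrow> real) B. 1-lipschitz_on UNIV f \<Longrightarrow> (\<forall>x. \<bar>f x\<bar> \<le> B) \<Longrightarrow>
     (\<exists>\<phi>. (\<forall>x. \<bar>\<phi> x - f x\<bar> \<le> 1) \<and> (\<forall>x. \<bar>\<phi> x\<bar> \<le> B) \<and> 1-lipschitz_on UNIV \<phi> \<and> quad_approx A \<phi>)"
    using exists_quad_approx_unit by blast
  have "\<exists>\<phi>. (\<forall>x. \<bar>\<phi> x - f x\<bar> \<le> \<delta>) \<and> (\<forall>x. \<bar>\<phi> x\<bar> \<le> 1) \<and> 1-lipschitz_on UNIV \<phi> \<and> quad_approx (A / \<delta>) \<phi>"
    if \<delta>: "\<delta> > 0" and f: "1-lipschitz_on UNIV f" and b: "\<forall>x. \<bar>f x\<bar> \<le> 1" for f :: "real^'n \<Rightarrow> real" and \<delta>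
  proof -
    have "1-lipschitz_on UNIV (\<lambda>y. f (\<delta> *\<^sub>R y) / \<delta>)"
    proof (rule lipschitz_onI)
      fix x y
      have "\<bar>f (\<delta> *\<^sub>R x) - f (\<delta> *\<^sub>R y)\<bar> \<le> norm (\<delta> *\<^sub>R x - \<delta> *\<^sub>R y)"
        using lipschitz_onD[OF f, of "\<delta> *\<^sub>R x" "\<delta> *\<^sub>R y"] by (simp add: dist_norm)
      also have "\<dots> = \<delta> * norm (x - y)" using \<delta> by (simp flip: scaleR_right_diff_distrib)
      finally show "dist (f (\<delta> *\<^sub>R x) / \<delta>) (f (\<delta> *\<^sub>R y) / \<delta>) \<le> 1 * dist x y"
        using \<delta> by (simp add: dist_norm pos_divide_le_eq mult.commute flip: diff_divide_distrib)
    qed simp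
    moreover have "\<forall>x. \<bar>f (\<delta> *\<^sub>R x) / \<delta>\<bar> \<le> 1 / \<delta>" using b \<delta> by (simp add: divide_right_mono)
    ultimately obtain \<psi> where \<psi>: "\<And>x. \<bar>\<psi> x - f (\<delta> *\<^sub>R x) / \<delta>\<bar> \<le> 1" "\<And>x. \<bar>\<psi> x\<bar> \<le> 1 / \<delta>"
      "1-lipschitz_on UNIV \<psi>" "quad_approx A \<psi>" using A by meson
    define \<phi> where "\<phi> x = \<delta> * \<psi> ((1 / \<delta>) *\<^sub>R x)" for x
    have "\<bar>\<phi> x - f x\<bar> \<le> \<delta>" for x
    proof -
      have "\<phi> x - f x = \<delta> * (\<psi> ((1 / \<delta>) *\<^sub>R x) - f (\<delta> *\<^sub>R ((1 / \<delta>) *\<^sub>R x)) / \<delta>)"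
        using \<delta> by (simp add: \<phi>_def field_simps)
      also have "\<bar>\<dots>\<bar> \<le> \<delta> * 1" unfolding abs_mult using \<delta> by (intro mult_mono \<psi>) auto
      finally show ?thesis by simp
    qed
    moreover have "\<bar>\<phi> x\<bar> \<le> 1" for x
      using mult_left_mono[OF \<psi>(2)[of "(1 / \<delta>) *\<^sub>R x"], of \<delta>] \<delta> by (simp add: \<phi>_def abs_mult)
    moreover have "1-lipschitz_on UNIV \<phi>"
    proof (rule lipschitz_onI)
      fix x y :: "real^'n"
      have "\<bar>\<psi> ((1 / \<delta>) *\<^sub>R x) - \<psi> ((1 / \<delta>) *\<^sub>R y)\<bar> \<le> norm ((1 / \<delta>) *\<^sub>R x - (1 / \<delta>) *\<^sub>R y)"
        using lipschitz_onD[OF \<psi>(3), of "(1 / \<delta>) *\<^sub>R x" "(1 / \<delta>) *\<^sub>R y"] by (simp add: dist_norm)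
      also have "\<dots> = norm (x - y) / \<delta>" using \<delta> by (simp flip: scaleR_right_diff_distrib)
      finally have "\<delta> * \<bar>\<psi> ((1 / \<delta>) *\<^sub>R x) - \<psi> ((1 / \<delta>) *\<^sub>R y)\<bar> \<le> norm (x - y)"
        using \<delta> by (simp add: field_simps)
      moreover have "\<phi> x - \<phi> y = \<delta> * (\<psi> ((1 / \<delta>) *\<^sub>R x) - \<psi> ((1 / \<delta>) *\<^sub>R y))"
        by (simp add: \<phi>_def right_diff_distrib)
      ultimately show "dist (\<phi> x) (\<phi> y) \<le> 1 * dist x y"
        using \<delta> by (simp add: dist_norm abs_mult)
    qed simp
    moreover have "quad_approx (A / \<delta>) \<phi>"
      unfolding quad_approx_def
    proof
      fix x
      obtain g where g: "norm g \<le> 1" "\<And>z. \<bar>\<psi> ((1 / \<delta>) *\<^sub>R x + z) - \<psi> ((1 / \<delta>) *\<^sub>R x) - g \<bullet> z\<bar> \<le> A * (norm z)\<^sup>2"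
        using \<psi>(4) unfolding quad_approx_def by blast
      have "\<bar>\<phi> (x + z) - \<phi> x - g \<bullet> z\<bar> \<le> A / \<delta> * (norm z)\<^sup>2" for z
      proof -
        have "\<phi> (x + z) - \<phi> x - g \<bullet> z = \<delta> * (\<psi> ((1 / \<delta>) *\<^sub>R x + (1 / \<delta>) *\<^sub>R z) - \<psi> ((1 / \<delta>) *\<^sub>R x) - g \<bullet> ((1 / \<delta>) *\<^sub>R z))"
          using \<delta> by (simp add: \<phi>_def field_simps scaleR_add_right)
        also have "\<bar>\<dots>\<bar> \<le> \<delta> * (A * (norm ((1 / \<delta>) *\<^sub>R z))\<^sup>2)"
          unfolding abs_mult using \<delta> by (intro mult_mono g) auto
        also have "\<dots> = A / \<delta> * (norm z)\<^sup>2" using \<delta> by (simp add: power2_eq_square)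
        finally show ?thesis .
      qed
      then show "\<exists>g. norm g \<le> 1 \<and> (\<forall>z. \<bar>\<phi> (x + z) - \<phi> x - g \<bullet> z\<bar> \<le> A / \<delta> * (norm z)\<^sup>2)"
        using g(1) by blast
    qed
    ultimately show ?thesis by blast
  qed
  then show ?thesis using A0 by blast
qed

section \<open>Uniqueness of the positive semidefinite square root\<close>

lemma symmetric_matrix_inner:
  fixes S :: "real^'n^'n::finite"
  assumes "transpose S = S"
  shows "x \<bullet> (S *v y) = (S *v x) \<bullet> y"
  by (metis assms dot_lmul_matrix transpose_matrix_vector)

text \<open>The quadratic form has a minimum at \<open>y\<close>, but if \<open>S *v y\<close> were
  nonzero, a small step in the opposite direction would make it negative.\<close>

lemma psd_kernel:
  fixes S :: "real^'n^'n::finite"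
  assumes sym: "transpose S = S" and psd: "\<And>x. 0 \<le> x \<bullet> (S *v x)" and y: "y \<bullet> (S *v y) = 0"
  shows "S *v y = 0"
proof (rule ccontr)
  assume "S *v y \<noteq> 0"
  define w where "w = S *v y"
  define a c where "a = w \<bullet> w" and "c = w \<bullet> (S *v w)"
  have a: "a > 0" using \<open>S *v y \<noteq> 0\<close> by (simp add: a_def w_def)
  have c: "c \<ge> 0" using psd by (simp add: c_def)
  \<comment> \<open>This step keeps the quadratic term \<open>t * (t * c)\<close> below
    \<open>t * a\<close>, against the linear term \<open>- 2 * t * a\<close>.\<close>
  define t where "t = a / (c + 1)"
  have t: "t > 0" "t * c < a" using a c by (auto simp: t_def field_simps)
  have "0 \<le> (y - t *\<^sub>R w) \<bullet> (S *v (y - t *\<^sub>R w))" by (rule psd)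
  also have "\<dots> = y \<bullet> (S *v y) - t * (y \<bullet> (S *v w)) - t * (w \<bullet> (S *v y)) + t * (t * c)"
    by (simp add: matrix_vector_mult_diff_distrib inner_diff_left inner_diff_right
        matrix_vector_mult_scaleR c_def algebra_simps)
  also have "y \<bullet> (S *v w) = a" using symmetric_matrix_inner[OF sym, of y w] by (simp add: a_def w_def)
  also have "w \<bullet> (S *v y) = a" by (simp add: a_def w_def)
  finally have "0 \<le> t * (t * c - 2 * a)" using y by (simp add: algebra_simps)
  then have "2 * a \<le> t * c" using t(1) by (simp add: zero_le_mult_iff)
  then show False using t a by linarith
qed

text \<open>Writes the trace as a sum of values of the quadratic form of \<open>S\<close>, so that
  nonnegativity can be used term by term.\<close>

lemma trace_sandwich:
  fixes D S :: "real^'n^'n::finite"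
  assumes "transpose D = D"
  shows "trace (D ** (S ** D)) = (\<Sum>i\<in>UNIV. column i D \<bullet> (S *v column i D))"
proof -
  have "(D ** (S ** D)) $ i $ i = column i D \<bullet> (S *v column i D)" for i
  proof -
    have "(D ** (S ** D)) $ i $ i = axis i 1 \<bullet> ((D ** (S ** D)) *v axis i 1)"
      by (simp add: matrix_vector_mult_basis inner_axis' column_def)
    also have "\<dots> = axis i 1 \<bullet> (D *v (S *v (D *v axis i 1)))"
      by (simp add: matrix_vector_mul_assoc matrix_mul_assoc)
    also have "\<dots> = (D *v axis i 1) \<bullet> (S *v (D *v axis i 1))"
      by (rule symmetric_matrix_inner[OF assms])
    finally show ?thesis by (simp add: matrix_vector_mult_basis)
  qed
  then show ?thesis by (simp add: trace_def)
qed

text \<open>With \<open>D = S - S'\<close>, the relation \<open>S D + D S' = S\<^sup>2 - S'\<^sup>2 = 0\<close> gives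
  \<open>tr (D S D) + tr (D S' D) = 0\<close>, so the range of \<open>D\<close> lies in both kernels.\<close>

lemma psd_sqrt_unique:
  fixes S S' :: "real^'n^'n::finite"
  assumes S: "transpose S = S" "\<And>x. 0 \<le> x \<bullet> (S *v x)"
    and S': "transpose S' = S'" "\<And>x. 0 \<le> x \<bullet> (S' *v x)" and eq: "S ** S = S' ** S'"
  shows "S = S'"
proof -
  define D where "D = S - S'"
  have symD: "transpose D = D" using S(1) S'(1) by (simp add: D_def transpose_def vec_eq_iff)
  have "S ** D + D ** S' = 0"
    using eq by (simp add: D_def matrix_matrix_mult_def vec_eq_iff algebra_simps sum_subtractf)
  then have "D ** (S ** D) + D ** (D ** S') = D ** 0" by (simp flip: matrix_add_ldistrib)
  also have "D ** 0 = (0 :: real^'n^'n)" by (simp add: matrix_matrix_mult_def vec_eq_iff)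
  finally have "trace (D ** (S ** D)) + trace (D ** (D ** S')) = 0"
    by (simp flip: trace_add) (simp add: trace_def)
  also have "trace (D ** (D ** S')) = trace (D ** (S' ** D))"
    by (metis trace_mul_sym matrix_mul_assoc)
  finally have sum0: "(\<Sum>i\<in>UNIV. column i D \<bullet> (S *v column i D) + column i D \<bullet> (S' *v column i D)) = 0"
    by (simp add: trace_sandwich[OF symD] sum.distrib)
  have "column i D = 0" for i
  proof -
    have "column i D \<bullet> (S *v column i D) + column i D \<bullet> (S' *v column i D) = 0"
      using sum0 S(2) S'(2) by (subst (asm) sum_nonneg_eq_0_iff) auto
    then have "column i D \<bullet> (S *v column i D) = 0" "column i D \<bullet> (S' *v column i D) = 0"
      using S(2)[of "column i D"] S'(2)[of "column i D"] by linarith+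
    then have "S *v column i D = 0" "S' *v column i D = 0"
      using psd_kernel S S' by blast+
    then have "D *v column i D = 0" by (simp add: D_def matrix_vector_mult_diff_rdistrib)
    \<comment> \<open>\<open>D\<close> annihilates its own columns, and symmetry turns this into a
      vanishing squared norm.\<close>
    then have "D *v (D *v axis i 1) = 0" by (simp add: matrix_vector_mult_basis)
    then have "(D *v axis i 1) \<bullet> (D *v axis i 1) = 0"
      by (metis symmetric_matrix_inner[OF symD] inner_zero_right)
    then show ?thesis by (simp add: matrix_vector_mult_basis)
  qed
  then have "D = 0" by (simp add: vec_eq_iff column_def)
  then show ?thesis by (simp add: D_def)
qed

text \<open>If \<open>A\<close> has no square root, \<open>psd_sqrt A\<close> is the definite description over the empty predicate,
  a matrix that does not depend on \<open>A\<close>; this accounts for the second summand.\<close>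

lemma psd_sqrt_columns:
  fixes A :: "real^'n^'n::finite"
  shows "(\<Sum>p\<in>UNIV. (norm (column p (psd_sqrt A)))\<^sup>2)
    \<le> \<bar>trace A\<bar> + (\<Sum>p\<in>UNIV. (norm (column p (THE S :: real^'n^'n. False)))\<^sup>2)"
proof (cases "\<exists>S. transpose S = S \<and> (\<forall>x. 0 \<le> x \<bullet> (S *v x)) \<and> S ** S = A")
  case True
  then have "\<exists>!S. transpose S = S \<and> (\<forall>x. 0 \<le> x \<bullet> (S *v x)) \<and> S ** S = A"
    using psd_sqrt_unique by metis
  from theI'[OF this] have *: "transpose (psd_sqrt A) = psd_sqrt A" "psd_sqrt A ** psd_sqrt A = A"
    unfolding psd_sqrt_def by blast+
  have "A $ p $ p = (norm (column p (psd_sqrt A)))\<^sup>2" for p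
  proof -
    have "A $ p $ p = (\<Sum>k\<in>UNIV. psd_sqrt A $ p $ k * psd_sqrt A $ k $ p)"
      by (subst *(2)[symmetric]) (simp add: matrix_matrix_mult_def)
    also have "\<dots> = (\<Sum>k\<in>UNIV. psd_sqrt A $ k $ p * psd_sqrt A $ k $ p)"
      by (subst (1) *(1)[symmetric]) (simp add: transpose_def)
    finally show ?thesis by (simp add: power2_norm_eq_inner inner_vec_def column_def)
  qed
  then have "(\<Sum>p\<in>UNIV. (norm (column p (psd_sqrt A)))\<^sup>2) = trace A" by (simp add: trace_def)
  moreover have "0 \<le> (\<Sum>p\<in>UNIV. (norm (column p (THE S :: real^'n^'n. False)))\<^sup>2)"
    by (simp add: sum_nonneg)
  ultimately show ?thesis by linarith
next
  case False
  then have "(\<lambda>S. transpose S = S \<and> (\<forall>x. 0 \<le> x \<bullet> (S *v x)) \<and> S ** S = A) = (\<lambda>S. False)" by blast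
  then show ?thesis unfolding psd_sqrt_def by simp
qed

section \<open>Moments of the Levy measure\<close>

text \<open>Doubling \<open>r\<close> passes 1 after finitely many steps and accumulates a geometric
  series with ratio governed by \<open>2 powr e\<close>. For \<open>e = 0\<close> the sum would grow
  like the logarithm of \<open>1 / r\<close>.\<close>

lemma dyadic_recursion_bound:
  fixes A :: "real \<Rightarrow> real"
  assumes far: "\<And>r. r \<ge> 1 \<Longrightarrow> A r \<le> 0"
    and step: "\<And>r. 0 < r \<Longrightarrow> r < 1 \<Longrightarrow> A r \<le> A (2 * r) + C * r powr e"
    and e: "e \<noteq> 0" and C: "C \<ge> 0"
  shows "\<exists>K\<ge>0. \<forall>r. 0 < r \<longrightarrow> r < 1 \<longrightarrow> A r \<le> K * max 1 (r powr e)"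
proof -
  have dy: "\<exists>n::nat. 1 \<le> 2 ^ n * r" if "r > 0" for r :: real
  proof -
    obtain n where "1 / r < 2 ^ n" using real_arch_pow[of 2 "1 / r"] by auto
    then show ?thesis using that by (intro exI[of _ n]) (simp add: field_simps)
  qed
  show ?thesis
  proof (cases "e < 0")
    case True
    have p: "(2::real) powr e < 1" using True powr_less_mono[of e 0 2] by simp
    \<comment> \<open>Fixed point of the recursion: \<open>K * 2 powr e + C = K\<close>, so the
      bound \<open>K * r powr e\<close> reproduces itself under one doubling.\<close>
    define K where "K = C / (1 - 2 powr e)"
    have "K * (1 - 2 powr e) = C" using p True by (simp add: K_def)
    then have K: "K \<ge> 0" "K * 2 powr e + C = K"
      using p C by (auto simp: K_def right_diff_distrib)
    have "A r \<le> K * r powr e" if "r > 0" "1 \<le> 2 ^ n * r" for n r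
      using that
    proof (induction n arbitrary: r)
      case 0 
      then have "A r \<le> 0" using far by simp
      also have "0 \<le> K * r powr e" using K by simp
      finally show ?case .
    next
      case (Suc n)
      show ?case
      proof (cases "r < 1")
        case True
        have "A r \<le> A (2 * r) + C * r powr e" using step True Suc.prems by simp
        also have "A (2 * r) \<le> K * (2 * r) powr e" using Suc by (intro Suc.IH) (auto simp: mult_ac)
        also have "(2 * r) powr e = 2 powr e * r powr e" using Suc.prems by (simp add: powr_mult)
        also have "K * (2 powr e * r powr e) + C * r powr e = (K * 2 powr e + C) * r powr e"
          by (simp add: algebra_simps)
        finally show ?thesis using K by simp
      next
        case False
        then have "A r \<le> 0" using far by simp
        also have "0 \<le> K * r powr e" using K by simp
        finally show ?thesis .
      qed
    qed
    then have "A r \<le> K * r powr e" if "r > 0" for r using dy[OF that] that by blast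
    moreover have "K * r powr e \<le> K * max 1 (r powr e)" for r using K by (intro mult_left_mono) auto
    ultimately show ?thesis using K(1) by (meson order_trans)
  next
    case False
    then have p: "(2::real) powr e > 1" using e powr_less_mono[of 0 e 2] by simp
    \<comment> \<open>Now the self-reproducing bound is \<open>K * (2 powr e - r powr e)\<close>. It
      is nonnegative for \<open>r < 2\<close>, the range reached by doubling some
      \<open>r < 1\<close>.\<close>
    define K where "K = C / (2 powr e - 1)"
    have K: "K \<ge> 0" "K * (2 powr e - 1) = C" using p C by (auto simp: K_def)
    have pos: "0 \<le> K * (2 powr e - r powr e)" if "0 < r" "r < 2" for r
      using that K e False by (intro mult_nonneg_nonneg) (auto intro: powr_mono2)
    have "A r \<le> K * (2 powr e - r powr e)" if "r > 0" "r < 2" "1 \<le> 2 ^ n * r" for n r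
      using that
    proof (induction n arbitrary: r)
      case 0
      then have "A r \<le> 0" using far by simp
      also have "0 \<le> K * (2 powr e - r powr e)" using 0 by (intro pos) auto
      finally show ?case .
    next
      case (Suc n)
      show ?case
      proof (cases "r < 1")
        case True
        have "A r \<le> A (2 * r) + C * r powr e" using step True Suc.prems by simp
        also have "A (2 * r) \<le> K * (2 powr e - (2 * r) powr e)"
          using Suc True by (intro Suc.IH) (auto simp: mult_ac)
        also have "(2 * r) powr e = 2 powr e * r powr e" using Suc.prems by (simp add: powr_mult)
        also have "K * (2 powr e - 2 powr e * r powr e) + C * r powr e
           = K * (2 powr e - 2 powr e * r powr e) + (K * (2 powr e - 1)) * r powr e"
          by (simp only: K(2))
        also have "\<dots> = K * (2 powr e - r powr e)" by (simp add: algebra_simps)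
        finally show ?thesis by simp
      next
        case False
        then have "A r \<le> 0" using far by simp
        also have "0 \<le> K * (2 powr e - r powr e)" using Suc.prems by (intro pos) auto
        finally show ?thesis .
      qed
    qed
    then have 1: "A r \<le> K * (2 powr e - r powr e)" if "r > 0" "r < 2" for r using dy[of r] that by blast
    have 2: "K * (2 powr e - r powr e) \<le> (K * 2 powr e) * max 1 (r powr e)" for r
    proof -
      have "K * (2 powr e - r powr e) \<le> (K * 2 powr e) * 1" using K by (simp add: mult_left_mono)
      also have "\<dots> \<le> (K * 2 powr e) * max 1 (r powr e)" using K by (intro mult_left_mono) auto
      finally show ?thesis .
    qed
    have "A r \<le> (K * 2 powr e) * max 1 (r powr e)" if "0 < r" "r < 1" for r
      using order_trans[OF 1 2, of r] that by simp
    moreover have "0 \<le> K * 2 powr e" using K by simp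
    ultimately show ?thesis by blast
  qed
qed

locale levy_measure =
  fixes \<nu> :: "(real^'n::finite) measure" and \<sigma> :: real
  assumes nu_sets: "sets \<nu> = sets borel"
    and nu0: "(\<integral>\<^sup>+ z. ennreal (min 1 (norm z ^ 2)) \<partial>\<nu>) < \<infinity>"
    and nu1: "0 < \<sigma> \<and> \<sigma> < 2 \<and> (\<exists>C>0. \<exists>g \<in> borel_measurable borel.
               (\<forall>z. 0 < norm z \<and> norm z < 1 \<longrightarrow> 0 \<le> g z \<and> g z \<le> C * norm z powr (- (real CARD('n) + \<sigma>))) \<and>
               (\<forall>A \<in> sets borel. A \<subseteq> ball 0 1 \<longrightarrow> emeasure \<nu> A = (\<integral>\<^sup>+ z\<in>A. ennreal (g z) \<partial>lborel)))"
    and sigma_ne1: "\<sigma> \<noteq> 1"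
begin

declare nu_sets [measurable_cong]

lemma space_nu [simp]: "space \<nu> = UNIV"
  using sets_eq_imp_space_eq[OF nu_sets] by simp

lemma measurable_nu [simp]: "borel_measurable \<nu> = borel_measurable borel"
  by (rule measurable_cong_sets) (auto simp: nu_sets)

definition W :: real where "W = (\<integral>z. min 1 ((norm z)\<^sup>2) \<partial>\<nu>)"

lemma integrable_min: "integrable \<nu> (\<lambda>z. min 1 ((norm z)\<^sup>2))"
  using nu0 by (intro integrableI_nonneg) auto

lemma W_nonneg: "0 \<le> W" unfolding W_def by (intro integral_nonneg_AE) auto

lemma le_W:
  fixes F :: "real^'n \<Rightarrow> real"
  assumes [measurable]: "F \<in> borel_measurable borel"
    and F: "\<And>z. 0 \<le> F z" "\<And>z. F z \<le> min 1 ((norm z)\<^sup>2)"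
  shows "integrable \<nu> F" "(\<integral>z. F z \<partial>\<nu>) \<le> W"
proof -
  show I: "integrable \<nu> F"
    by (rule Bochner_Integration.integrable_bound[OF integrable_min]) (use F in auto)
  show "(\<integral>z. F z \<partial>\<nu>) \<le> W"
    unfolding W_def by (rule Bochner_Integration.integral_mono[OF I integrable_min]) (rule F)
qed

lemma emeasure_outside:
  assumes "r > 0"
  shows "emeasure \<nu> {z. r \<le> norm z} < \<infinity>"
proof -
  define c where "c = min 1 (r\<^sup>2)"
  have c: "c > 0" using assms by (simp add: c_def)
  have "integrable \<nu> (indicat_real {z. r \<le> norm z})"
  proof (rule Bochner_Integration.integrable_bound)
    show "integrable \<nu> (\<lambda>z. (1 / c) * min 1 ((norm z)\<^sup>2))" using integrable_min by simp
    have "norm (indicat_real {z. r \<le> norm z} z) \<le> norm ((1 / c) * min 1 ((norm z)\<^sup>2))" for z :: "real^'n"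
    proof (cases "r \<le> norm z")
      case True
      then have "r\<^sup>2 \<le> (norm z)\<^sup>2" using assms by (intro power_mono) auto
      then have "c \<le> min 1 ((norm z)\<^sup>2)" unfolding c_def by (rule min.mono[OF order_refl])
      then show ?thesis using c True by (simp add: field_simps)
    qed simp
    then show "AE z in \<nu>. norm (indicat_real {z. r \<le> norm z} z) \<le> norm ((1 / c) * min 1 ((norm z)\<^sup>2))" by simp
  qed simp
  then show ?thesis by (simp add: integrable_indicator_iff nu_sets)
qed

lemma integrable_outside:
  assumes "r > 0" and [measurable]: "A \<in> sets borel" and "A \<subseteq> {z. r \<le> norm z}"
  shows "integrable \<nu> (indicat_real A)" "emeasure \<nu> A < \<infinity>"
proof -
  have "emeasure \<nu> A \<le> emeasure \<nu> {z. r \<le> norm z}" using assms by (intro emeasure_mono) (auto simp: nu_sets)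
  then show "emeasure \<nu> A < \<infinity>" using emeasure_outside[OF assms(1)] by (rule le_less_trans)
  then show "integrable \<nu> (indicat_real A)" by (simp add: integrable_indicator_iff nu_sets)
qed

text \<open>On the shell the density is at most of order
  \<open>r powr - (CARD('n) + \<sigma>)\<close>, and the volume is of order
  \<open>r ^ CARD('n)\<close>.\<close>

lemma dyadic_shell:
  "\<exists>C\<ge>0. \<forall>r>0. measure \<nu> {z. r < norm z \<and> norm z \<le> 2 * r \<and> norm z < 1} \<le> C * r powr - \<sigma>"
proof -
  obtain C g where C: "C > 0" and [measurable]: "g \<in> borel_measurable borel"
    and g: "\<And>z. 0 < norm z \<and> norm z < 1 \<Longrightarrow> 0 \<le> g z \<and> g z \<le> C * norm z powr (- (real CARD('n) + \<sigma>))"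
    and e: "\<And>A. A \<in> sets borel \<Longrightarrow> A \<subseteq> ball 0 1 \<Longrightarrow> emeasure \<nu> A = (\<integral>\<^sup>+ z\<in>A. ennreal (g z) \<partial>lborel)"
    using nu1 by blast
  have s: "\<sigma> > 0" using nu1 by simp
  define V where "V = measure lborel (cball (0::real^'n) 1)"
  have "measure \<nu> {z. r < norm z \<and> norm z \<le> 2 * r \<and> norm z < 1} \<le> (C * 2 ^ CARD('n) * V) * r powr - \<sigma>"
    if r: "r > 0" for r
  proof -
    let ?A = "{z::real^'n. r < norm z \<and> norm z \<le> 2 * r \<and> norm z < 1}"
    let ?c = "C * r powr (- (real CARD('n) + \<sigma>))"
    have [measurable]: "?A \<in> sets borel" by measurable
    have "emeasure \<nu> ?A = (\<integral>\<^sup>+ z\<in>?A. ennreal (g z) \<partial>lborel)" by (rule e) auto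
    also have "\<dots> \<le> (\<integral>\<^sup>+ z. ennreal ?c * indicator (cball 0 (2 * r)) z \<partial>(lborel :: (real^'n) measure))"
    proof (rule nn_integral_mono)
      fix z :: "real^'n"
      show "ennreal (g z) * indicator ?A z \<le> ennreal ?c * indicator (cball 0 (2 * r)) z"
      proof (cases "z \<in> ?A")
        case True
        then have "g z \<le> C * norm z powr (- (real CARD('n) + \<sigma>))" using g[of z] r by fastforce
        also have "\<dots> \<le> ?c" using True C r s by (intro mult_left_mono powr_mono2') auto
        finally show ?thesis using True by (simp add: ennreal_leI)
      qed simp
    qed
    also have "\<dots> = ennreal ?c * emeasure lborel (cball (0::real^'n) (2 * r))"
      by (subst nn_integral_cmult_indicator) auto
    also have "emeasure lborel (cball (0::real^'n) (2 * r)) = ennreal (measure lborel (cball (0::real^'n) (2 * r)))"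
      using emeasure_bounded_finite[OF bounded_cball, of "0::real^'n" "2 * r"]
      by (intro emeasure_eq_ennreal_measure) auto
    also have "measure lborel (cball (0::real^'n) (2 * r)) = (2 * r) ^ CARD('n) * V"
      using content_cball[of "2 * r" "0::real^'n"] content_cball[of 1 "0::real^'n"] r
      by (simp add: V_def mult.commute)
    also have "ennreal ?c * ennreal ((2 * r) ^ CARD('n) * V) = ennreal (?c * ((2 * r) ^ CARD('n) * V))"
      using C r by (subst ennreal_mult) (auto simp: V_def)
    also have "?c * ((2 * r) ^ CARD('n) * V) = (C * 2 ^ CARD('n) * V) * (r powr (- (real CARD('n) + \<sigma>)) * r powr real CARD('n))"
      using r by (simp add: power_mult_distrib powr_realpow)
    also have "r powr (- (real CARD('n) + \<sigma>)) * r powr real CARD('n) = r powr - \<sigma>"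
      by (simp flip: powr_add)
    finally have "emeasure \<nu> ?A \<le> ennreal ((C * 2 ^ CARD('n) * V) * r powr - \<sigma>)" .
    then show ?thesis unfolding measure_def using C by (intro enn2real_leI) (auto simp: V_def)
  qed
  moreover have "0 \<le> C * 2 ^ CARD('n) * V" using C by (simp add: V_def)
  ultimately show ?thesis by blast
qed

text \<open>Removing the shell between \<open>r\<close> and \<open>2 * r\<close> leaves the same
  quantity at \<open>2 * r\<close>, a recursion with exponent \<open>a - \<sigma>\<close>. The case
  \<open>a = 0\<close> gives the intensity and \<open>a = 1\<close> the drift; the latter is where
  \<open>\<sigma> \<noteq> 1\<close> enters.\<close>

lemma annulus_moment:
  fixes a :: nat
  assumes "real a \<noteq> \<sigma>"
  shows "\<exists>K\<ge>0. \<forall>r. 0 < r \<longrightarrow> r < 1 \<longrightarrow>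
     (\<integral>z. indicator {z. r < norm z \<and> norm z < 1} z * norm z ^ a \<partial>\<nu>) \<le> K * max 1 (r powr (real a - \<sigma>))"
proof -
  obtain C where C: "C \<ge> 0" and sh: "\<And>r. r > 0 \<Longrightarrow> measure \<nu> {z. r < norm z \<and> norm z \<le> 2 * r \<and> norm z < 1} \<le> C * r powr - \<sigma>"
    using dyadic_shell by blast
  define A where "A r = (\<integral>z. indicator {z. r < norm z \<and> norm z < 1} z * norm z ^ a \<partial>\<nu>)" for r
  show ?thesis unfolding A_def[symmetric]
  proof (rule dyadic_recursion_bound[where C="2 ^ a * C"])
    fix r :: real assume "r \<ge> 1"
    then have "{z::real^'n. r < norm z \<and> norm z < 1} = {}" by auto
    then show "A r \<le> 0" by (simp add: A_def)
  next
    fix r :: real assume r: "0 < r" "r < 1"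
    let ?S = "{z::real^'n. r < norm z \<and> norm z \<le> 2 * r \<and> norm z < 1}"
    let ?f = "\<lambda>z::real^'n. indicator {z. 2 * r < norm z \<and> norm z < 1} z * norm z ^ a"
    have i1: "integrable \<nu> ?f"
    proof (rule Bochner_Integration.integrable_bound)
      show "integrable \<nu> (indicat_real {z. 2 * r < norm z \<and> norm z < 1})"
        using r by (intro integrable_outside[of "2 * r"]) auto
      show "AE z in \<nu>. norm (?f z) \<le> norm (indicat_real {z. 2 * r < norm z \<and> norm z < 1} z)"
        by (auto simp: indicator_def power_le_one intro!: AE_I2)
    qed simp
    have i2: "integrable \<nu> (\<lambda>z. (2 * r) ^ a * indicat_real ?S z)"
      using r by (intro integrable_mult_right integrable_outside[of r]) auto
    have "A r \<le> (\<integral>z. ?f z + (2 * r) ^ a * indicat_real ?S z \<partial>\<nu>)"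
      unfolding A_def
    proof (rule integral_mono')
      show "integrable \<nu> (\<lambda>z. ?f z + (2 * r) ^ a * indicat_real ?S z)" using i1 i2 by simp
      fix z :: "real^'n"
      show "0 \<le> ?f z + (2 * r) ^ a * indicat_real ?S z" using r by simp
      have "norm z ^ a \<le> (2 * r) ^ a" if "z \<in> ?S" using that by (intro power_mono) auto
      then show "indicator {z. r < norm z \<and> norm z < 1} z * norm z ^ a \<le> ?f z + (2 * r) ^ a * indicat_real ?S z"
        using r by (cases "z \<in> ?S") (auto simp: indicator_def)
    qed
    also have "\<dots> = A (2 * r) + (2 * r) ^ a * measure \<nu> ?S"
      using i1 i2 by (simp add: A_def)
    also have "(2 * r) ^ a * measure \<nu> ?S \<le> (2 * r) ^ a * (C * r powr - \<sigma>)"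
      using r by (intro mult_left_mono sh) auto
    also have "\<dots> = 2 ^ a * C * (r powr real a * r powr - \<sigma>)"
      using r by (simp add: power_mult_distrib powr_realpow)
    also have "r powr real a * r powr - \<sigma> = r powr (real a - \<sigma>)" by (simp flip: powr_add)
    finally show "A r \<le> A (2 * r) + 2 ^ a * C * r powr (real a - \<sigma>)" by simp
  qed (use assms C in auto)
qed

lemma lev_lam_bound: "\<exists>K\<ge>0. \<forall>r. 0 < r \<longrightarrow> r < 1 \<longrightarrow> lev_lam \<nu> r \<le> K * r powr - \<sigma>"
proof -
  have s: "\<sigma> > 0" using nu1 by simp
  obtain K where K: "K \<ge> 0" "\<And>r. 0 < r \<Longrightarrow> r < 1 \<Longrightarrow>
     (\<integral>z. indicator {z. r < norm z \<and> norm z < 1} z * norm z ^ 0 \<partial>\<nu>) \<le> K * max 1 (r powr (real 0 - \<sigma>))"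
    using annulus_moment[of 0] s by auto
  have "lev_lam \<nu> r \<le> (K + W) * r powr - \<sigma>" if r: "0 < r" "r < 1" for r
  proof -
    let ?A = "{z::real^'n. r < norm z \<and> norm z < 1}" and ?B = "{z::real^'n. 1 \<le> norm z}"
    have r1: "1 \<le> r powr - \<sigma>" using r s powr_mono2'[of "- \<sigma>" r 1] by simp
    have "integrable \<nu> (indicat_real ?A)" using r by (intro integrable_outside[of r]) auto
    then have mA: "measure \<nu> ?A \<le> K * r powr - \<sigma>" using K(2)[OF r] r1 by simp
    have "(\<integral>z. indicat_real ?B z \<partial>\<nu>) \<le> W"
      by (rule le_W) (auto simp: indicator_def)
    then have mB: "measure \<nu> ?B \<le> W" by simp
    have "{z. r < norm z} = ?A \<union> ?B" using r by auto
    then have "lev_lam \<nu> r \<le> measure \<nu> ?A + measure \<nu> ?B"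
      unfolding lev_lam_def using r integrable_outside(2)[of r ?A] integrable_outside(2)[of 1 ?B]
      by (auto intro!: measure_Un_le simp: nu_sets fmeasurable_def)
    also have "\<dots> \<le> K * r powr - \<sigma> + W * r powr - \<sigma>"
      using mA mB mult_left_mono[OF r1 W_nonneg] by linarith
    finally show ?thesis by (simp add: algebra_simps)
  qed
  then show ?thesis using K(1) W_nonneg by (meson add_nonneg_nonneg)
qed

lemma integrable_annulus:
  assumes "0 < r"
  shows "integrable \<nu> (\<lambda>z. indicat_real {z. r < norm z \<and> norm z < 1} z *\<^sub>R z)"
proof (rule Bochner_Integration.integrable_bound)
  show "integrable \<nu> (indicat_real {z. r < norm z \<and> norm z < 1})"
    using assms by (intro integrable_outside[of r]) auto
qed (auto simp: indicator_def intro!: AE_I2)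

lemma lev_b_bound: "\<exists>K\<ge>0. \<forall>r. 0 < r \<longrightarrow> r < 1 \<longrightarrow> norm (lev_b \<nu> r) \<le> K * max 1 (r powr (1 - \<sigma>))"
proof -
  obtain K where K: "K \<ge> 0" "\<And>r. 0 < r \<Longrightarrow> r < 1 \<Longrightarrow>
     (\<integral>z. indicator {z. r < norm z \<and> norm z < 1} z * norm z ^ 1 \<partial>\<nu>) \<le> K * max 1 (r powr (real 1 - \<sigma>))"
    using annulus_moment[of 1] sigma_ne1 by auto
  have "norm (lev_b \<nu> r) \<le> K * max 1 (r powr (1 - \<sigma>))" if r: "0 < r" "r < 1" for r
  proof -
    have "norm (lev_b \<nu> r) \<le> (\<integral>z. norm (indicat_real {z. r < norm z \<and> norm z < 1} z *\<^sub>R z) \<partial>\<nu>)"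
      unfolding lev_b_def set_lebesgue_integral_def by (rule integral_norm_bound)
    also have "\<dots> = (\<integral>z. indicator {z. r < norm z \<and> norm z < 1} z * norm z ^ 1 \<partial>\<nu>)" by simp
    finally show ?thesis using K(2)[OF r] by simp
  qed
  then show ?thesis using K(1) by blast
qed

text \<open>The value scheme integrates jumps over the closed exterior but normalizes by the
  intensity of the open one. The two agree because \<open>\<nu>\<close> has a density inside the
  unit ball and spheres are Lebesgue null sets.\<close>

lemma measure_closed_outside:
  assumes r: "0 < r" "r < 1"
  shows "measure \<nu> {z. r \<le> norm z} = lev_lam \<nu> r"
proof -
  obtain g where [measurable]: "g \<in> borel_measurable borel"
    and e: "\<And>A. A \<in> sets borel \<Longrightarrow> A \<subseteq> ball 0 1 \<Longrightarrow> emeasure \<nu> A = (\<integral>\<^sup>+ z\<in>A. ennreal (g z) \<partial>lborel)"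
    using nu1 by blast
  have null: "sphere (0::real^'n) r \<in> null_sets lborel"
    using negligible_sphere[of 0 r] by (simp add: negligible_iff_null_sets null_sets_completion_iff)
  have "emeasure \<nu> (sphere 0 r) = (\<integral>\<^sup>+ z\<in>sphere 0 r. ennreal (g z) \<partial>lborel)" using r by (intro e) auto
  also have "\<dots> = 0" using null by (intro nn_integral_null_set)
  finally have "emeasure \<nu> (sphere 0 r) = 0" .
  then have n: "sphere (0::real^'n) r \<in> null_sets \<nu>" by (auto simp: null_sets_def nu_sets)
  have "{z::real^'n. r \<le> norm z} = {z. r < norm z} \<union> sphere 0 r" by auto
  moreover have "measure \<nu> ({z. r < norm z} \<union> sphere 0 r) = measure \<nu> {z. r < norm z}"
    by (rule measure_Un_null_set) (use n in \<open>auto simp: nu_sets\<close>)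
  ultimately show ?thesis by (simp add: lev_lam_def)
qed

lemma trace_lev_cov:
  assumes "r < 1"
  shows "\<bar>trace (lev_cov \<nu> r)\<bar> \<le> real CARD('n) * W"
proof -
  have "\<bar>lev_cov \<nu> r $ a $ a\<bar> \<le> W" for a
  proof -
    let ?F = "\<lambda>z::real^'n. indicat_real {z. norm z < r} z * (z $ a * z $ a)"
    have F: "0 \<le> ?F z" "?F z \<le> min 1 ((norm z)\<^sup>2)" for z
    proof -
      show "0 \<le> ?F z" by simp
      have "z $ a * z $ a \<le> (norm z)\<^sup>2"
        using power_mono[OF component_le_norm_cart[of z a], of 2] by (simp add: power2_eq_square)
      moreover have "(norm z)\<^sup>2 \<le> 1" if "norm z < r" using that assms by (intro power_le_one) auto
      ultimately show "?F z \<le> min 1 ((norm z)\<^sup>2)" by (auto simp: indicator_def)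
    qed
    have "(\<integral>z. ?F z \<partial>\<nu>) \<le> W" by (rule le_W(2)[OF _ F]) auto
    moreover have "0 \<le> (\<integral>z. ?F z \<partial>\<nu>)" using F by (intro integral_nonneg_AE) auto
    ultimately show ?thesis using W_nonneg by (simp add: lev_cov_def set_lebesgue_integral_def)
  qed
  then have "(\<Sum>a\<in>UNIV. \<bar>lev_cov \<nu> r $ a $ a\<bar>) \<le> (\<Sum>a\<in>(UNIV::'n set). W)" by (intro sum_mono)
  then show ?thesis unfolding trace_def using sum_abs[of "\<lambda>a. lev_cov \<nu> r $ a $ a" UNIV] by (simp only: sum_constant order_trans)
qed

text \<open>For \<open>\<sigma> < 1\<close> the drift is bounded and
  \<open>h * lev_lam \<nu> r\<close> is controlled by \<open>h / r powr \<sigma>\<close>. For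
  \<open>\<sigma> > 1\<close> the rates \<open>r powr - \<sigma>\<close> and
  \<open>r powr (1 - \<sigma>)\<close> multiply to exactly \<open>r powr (1 - 2 * \<sigma>)\<close>,
  and the squared drift rate is smaller by a factor \<open>r\<close>.\<close>

lemma drift_intensity_bound:
  assumes M: "M > 0"
  shows "\<exists>K\<ge>0. \<forall>h r. 0 < h \<longrightarrow> h < 1 \<longrightarrow> 0 < r \<longrightarrow> r < 1 \<longrightarrow> (\<sigma> < 1 \<longrightarrow> h / r powr \<sigma> \<le> M) \<longrightarrow>
     (\<sigma> > 1 \<longrightarrow> h * r powr (1 - 2 * \<sigma>) \<le> M) \<longrightarrow>
     h * (norm (lev_b \<nu> r))\<^sup>2 \<le> K \<and> h * lev_lam \<nu> r * norm (lev_b \<nu> r) \<le> K"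
proof -
  obtain K1 where K1: "K1 \<ge> 0" "\<And>r. 0 < r \<Longrightarrow> r < 1 \<Longrightarrow> lev_lam \<nu> r \<le> K1 * r powr - \<sigma>"
    using lev_lam_bound by blast
  obtain K2 where K2: "K2 \<ge> 0" "\<And>r. 0 < r \<Longrightarrow> r < 1 \<Longrightarrow> norm (lev_b \<nu> r) \<le> K2 * max 1 (r powr (1 - \<sigma>))"
    using lev_b_bound by blast
  define K where "K = K2\<^sup>2 * (1 + M) + K1 * K2 * M"
  have K0: "K \<ge> 0" using K1 K2 M by (simp add: K_def)
  have "h * (norm (lev_b \<nu> r))\<^sup>2 \<le> K \<and> h * lev_lam \<nu> r * norm (lev_b \<nu> r) \<le> K"
    if h: "0 < h" "h < 1" and r: "0 < r" "r < 1" and c1: "\<sigma> < 1 \<Longrightarrow> h / r powr \<sigma> \<le> M"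
      and c2: "\<sigma> > 1 \<Longrightarrow> h * r powr (1 - 2 * \<sigma>) \<le> M" for h r
  proof -
    let ?m = "max 1 (r powr (1 - \<sigma>))"
    have lam: "0 \<le> lev_lam \<nu> r" by (simp add: lev_lam_def)
    have "h * ?m\<^sup>2 \<le> 1 + M \<and> h * r powr - \<sigma> * ?m \<le> M"
    proof (cases "\<sigma> < 1")
      case True
      then have "?m = 1" using r powr_le1[of "1 - \<sigma>" r] by simp
      then show ?thesis using c1[OF True] h M by (simp add: powr_minus field_simps)
    next
      case False
      then have s: "\<sigma> > 1" using sigma_ne1 by simp
      have m: "?m = r powr (1 - \<sigma>)" using r s powr_mono2'[of "1 - \<sigma>" r 1] by simp
      have "r powr (1 - \<sigma>) * r powr (1 - \<sigma>) = r powr (2 - 2 * \<sigma>)" by (simp flip: powr_add)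
      also have "\<dots> \<le> r powr (1 - 2 * \<sigma>)" using r by (intro powr_mono') auto
      finally have "h * ?m\<^sup>2 \<le> h * r powr (1 - 2 * \<sigma>)" using h m by (simp add: power2_eq_square)
      moreover have "r powr - \<sigma> * r powr (1 - \<sigma>) = r powr (1 - 2 * \<sigma>)" by (simp flip: powr_add)
      ultimately show ?thesis using c2[OF s] m by (simp add: mult.assoc)
    qed
    then have m: "h * ?m\<^sup>2 \<le> 1 + M" "h * r powr - \<sigma> * ?m \<le> M" by auto
    have "h * (norm (lev_b \<nu> r))\<^sup>2 \<le> h * (K2 * ?m)\<^sup>2"
      using h K2(2)[OF r] by (intro mult_left_mono power_mono) auto
    also have "\<dots> = K2\<^sup>2 * (h * ?m\<^sup>2)" by (simp add: power_mult_distrib)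
    also have "\<dots> \<le> K2\<^sup>2 * (1 + M)" by (intro mult_left_mono m) auto
    also have "\<dots> \<le> K" using K1 K2 M by (simp add: K_def)
    finally have 1: "h * (norm (lev_b \<nu> r))\<^sup>2 \<le> K" .
    have "h * lev_lam \<nu> r * norm (lev_b \<nu> r) \<le> h * (K1 * r powr - \<sigma>) * (K2 * ?m)"
      using h K1(2)[OF r] K2(2)[OF r] lam K1(1) by (intro mult_mono mult_left_mono) auto
    also have "\<dots> = K1 * K2 * (h * r powr - \<sigma> * ?m)" by (simp add: mult_ac)
    also have "\<dots> \<le> K1 * K2 * M" using K1(1) K2(1) by (intro mult_left_mono m) auto
    also have "\<dots> \<le> K" using K1 K2 M by (simp add: K_def)
    finally show ?thesis using 1 by simp
  qed
  then show ?thesis using K0 by blast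
qed

end

section \<open>Lipschitz bounds for the discrete value function\<close>

text \<open>The infimum of a set that is unbounded below is a fixed junk value; the two ranges are bounded
  below or not simultaneously, and in the second case both infima agree.\<close>

lemma Inf_range_dist_le:
  fixes A B :: "'a \<Rightarrow> real"
  assumes D: "\<And>a. \<bar>A a - B a\<bar> \<le> D"
  shows "\<bar>Inf (range A) - Inf (range B)\<bar> \<le> D"
proof -
  have le: "Inf (range A) - D \<le> Inf (range B)"
    if bdd: "bdd_below (range A)" and D: "\<And>a. \<bar>A a - B a\<bar> \<le> D" for A B :: "'a \<Rightarrow> real"
  proof (rule cINF_greatest)
    fix a
    have "Inf (range A) \<le> A a" using bdd by (rule cInf_lower[rotated]) simp
    then show "Inf (range A) - D \<le> B a" using D[of a] by linarith
  qed simp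
  have bdd: "bdd_below (range B)" if bdd: "bdd_below (range A)" and D: "\<And>a. \<bar>A a - B a\<bar> \<le> D" for A B :: "'a \<Rightarrow> real"
  proof -
    obtain m where m: "\<And>a. m \<le> A a" using bdd by (auto simp: bdd_below_def)
    have "m - D \<le> B a" for a using m[of a] D[of a] by linarith
    then show ?thesis by (intro bdd_belowI2[of _ "m - D"])
  qed
  have D': "\<bar>B a - A a\<bar> \<le> D" for a using D[of a] by linarith
  show ?thesis
  proof (cases "bdd_below (range A)")
    case True
    then show ?thesis using le[OF True D] le[OF bdd[OF True D] D'] by linarith
  next
    case False
    then have "\<not> bdd_below (range B)" using bdd[of B A, OF _ D'] by (rule contrapos_nn)
    \<comment> \<open>\<open>Inf\<close> is minus a \<open>LEAST\<close> over the upper bounds of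
      the reflected set; without such bounds its predicate is constantly false and the value does
      not depend on \<open>X\<close>.\<close>
    have unb: "Inf X = - (LEAST z::real. False)" if "\<not> bdd_below X" for X :: "real set"
    proof -
      have "(\<forall>x\<in>uminus ` X. x \<le> z) = False" for z
      proof -
        have "bdd_below X" if "\<forall>x\<in>uminus ` X. x \<le> z"
          using that by (intro bdd_belowI[of X "- z"]) force
        then show ?thesis using that by blast
      qed
      then show ?thesis unfolding Inf_real_def Sup_real_def by (simp only:)
    qed
    have "D \<ge> 0" using D[of undefined] by linarith
    then show ?thesis using unb[OF False] unb[OF \<open>\<not> bdd_below (range B)\<close>] by simp
  qed
qed

text \<open>The two integrands are integrable or non-integrable simultaneously; in the second case
  both integrals are \<open>0\<close>.\<close>

lemma set_integral_dist_le:
  fixes f g :: "'a \<Rightarrow> real"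
  assumes S [measurable]: "S \<in> sets M" and fin: "emeasure M S < \<infinity>"
    and [measurable]: "f \<in> borel_measurable M" "g \<in> borel_measurable M"
    and D: "\<And>z. \<bar>f z - g z\<bar> \<le> D"
  shows "\<bar>(\<integral>z\<in>S. f z \<partial>M) - (\<integral>z\<in>S. g z \<partial>M)\<bar> \<le> D * measure M S"
proof -
  have D0: "D \<ge> 0" using D[of undefined] by linarith
  have iS: "integrable M (\<lambda>z. D * indicat_real S z)"
    using fin by (simp add: integrable_indicator_iff)
  have bound: "\<bar>indicat_real S z * (f z - g z)\<bar> \<le> D * indicat_real S z" for z
    using D[of z] by (cases "z \<in> S") auto
  \<comment> \<open>The difference is bounded on a set of finite measure, so integrability passes
    from either integrand to the other.\<close>
  have idiff: "integrable M (\<lambda>z. indicat_real S z * (f z - g z))"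
    by (rule Bochner_Integration.integrable_bound[OF iS]) (use bound D0 in auto)
  show ?thesis
  proof (cases "integrable M (\<lambda>z. indicat_real S z * f z)")
    case True
    then have g: "integrable M (\<lambda>z. indicat_real S z * g z)"
      using Bochner_Integration.integrable_diff[OF True idiff] by (simp add: algebra_simps)
    have "(\<integral>z\<in>S. f z \<partial>M) - (\<integral>z\<in>S. g z \<partial>M) = (\<integral>z. indicat_real S z * (f z - g z) \<partial>M)"
      using True g by (simp add: set_lebesgue_integral_def right_diff_distrib)
    also have "\<bar>\<dots>\<bar> \<le> (\<integral>z. D * indicat_real S z \<partial>M)"
      by (rule order_trans[OF integral_abs_bound Bochner_Integration.integral_mono])
         (use idiff iS bound in auto)
    also have "\<dots> = D * measure M S" by simp
    finally show ?thesis .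
  next
    case False
    have "\<not> integrable M (\<lambda>z. indicat_real S z * g z)"
    proof
      assume "integrable M (\<lambda>z. indicat_real S z * g z)"
      from Bochner_Integration.integrable_add[OF this idiff] False show False
        by (simp add: right_diff_distrib)
    qed
    then show ?thesis using False D0
      by (simp add: set_lebesgue_integral_def not_integrable_integral_eq)
  qed
qed

text \<open>Lets the joint Lipschitz condition on \<open>F\<close> and \<open>G\<close> be used at a
  fixed measure.\<close>

lemma d0_refl: "d0 m m = 0" for m :: "(real^'n::finite) measure"
proof -
  have "{integral\<^sup>L m f - integral\<^sup>L m f | f :: real^'n \<Rightarrow> real. (\<forall>x. \<bar>f x\<bar> \<le> 1) \<and> 1-lipschitz_on UNIV f} = {0}"
    by (auto intro!: exI[of _ "\<lambda>_. 0"] lipschitz_onI)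
  then show ?thesis unfolding d0_def by simp
qed

text \<open>If the derivative does not exist, \<open>grad f x\<close> is the definite description over the empty
  predicate, which does not depend on \<open>f\<close> and \<open>x\<close>.\<close>

lemma norm_grad_le:
  fixes f :: "real^'n::finite \<Rightarrow> real"
  assumes lip: "\<And>x y. \<bar>f x - f y\<bar> \<le> K * norm (x - y)"
  shows "norm (grad f x) \<le> max K (norm (THE g :: real^'n. False))"
proof (cases "\<exists>g. (f has_derivative (\<lambda>v. g \<bullet> v)) (at x)")
  case True
  then obtain g where g: "(f has_derivative (\<lambda>v. g \<bullet> v)) (at x)" by blast
  have "g' = g" if "(f has_derivative (\<lambda>v. g' \<bullet> v)) (at x)" for g'
  proof -
    have "(\<lambda>v. g' \<bullet> v) = (\<lambda>v. g \<bullet> v)" using has_derivative_unique[OF that g] .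
    then have "(g' - g) \<bullet> (g' - g) = 0" by (metis inner_diff_left right_minus_eq)
    then show ?thesis by simp
  qed
  with g have gr: "grad f x = g" unfolding grad_def by (intro the_equality)
  \<comment> \<open>Along the ray in direction \<open>g\<close> the derivative is
    \<open>g \<bullet> g\<close>, while all difference quotients stay below
    \<open>K * norm g\<close>.\<close>
  have "((\<lambda>t. x + t *\<^sub>R g) has_derivative (\<lambda>t. t *\<^sub>R g)) (at 0)"
    by (auto intro!: derivative_eq_intros)
  from has_derivative_compose[OF this, of f "\<lambda>v. g \<bullet> v"] g
  have "((\<lambda>t. f (x + t *\<^sub>R g)) has_real_derivative (g \<bullet> g)) (at 0)"
    unfolding has_field_derivative_def by (simp add: mult.commute[of _ "g \<bullet> g"])
  then have lim: "((\<lambda>t. (f (x + t *\<^sub>R g) - f x) / t) \<longlongrightarrow> g \<bullet> g) (at 0)"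
    by (simp add: DERIV_def)
  have "g \<bullet> g \<le> K * norm g"
  proof (rule tendsto_upperbound[OF lim])
    show "\<forall>\<^sub>F t in at 0. (f (x + t *\<^sub>R g) - f x) / t \<le> K * norm g"
    proof (rule eventually_at_filter[THEN iffD2], rule always_eventually, intro allI impI)
      fix t :: real assume t: "t \<noteq> 0"
      have "(f (x + t *\<^sub>R g) - f x) / t \<le> \<bar>f (x + t *\<^sub>R g) - f x\<bar> / \<bar>t\<bar>"
        by (metis abs_divide abs_ge_self)
      also have "\<dots> \<le> (K * norm (t *\<^sub>R g)) / \<bar>t\<bar>"
        using lip[of "x + t *\<^sub>R g" x] by (intro divide_right_mono) auto
      finally show "(f (x + t *\<^sub>R g) - f x) / t \<le> K * norm g" using t by simp
    qed
  qed simp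
  then have "norm g * norm g \<le> K * norm g" by (simp add: power2_norm_eq_inner[symmetric] power2_eq_square)
  moreover have "0 \<le> K" using lip[of "axis undefined 1" 0] abs_ge_zero[of "f (axis undefined 1) - f 0"] 
    by (simp add: norm_axis_1)
  ultimately have "norm g \<le> K" by (cases "g = 0") auto
  then show ?thesis by (simp add: gr)
next
  case False
  then have "(\<lambda>g. (f has_derivative (\<lambda>v. g \<bullet> v)) (at x)) = (\<lambda>g. False)" by blast
  then show ?thesis unfolding grad_def by simp
qed

section \<open>The standard mollifier and Lipschitz bounds under convolution\<close>

lemma moll0_measurable [measurable]: "(moll0 :: real^'n::finite \<Rightarrow> real) \<in> borel_measurable borel"
  unfolding moll0_def by measurable

lemma moll0_bounds: "0 \<le> moll0 x" "moll0 x \<le> 1"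
proof -
  show "0 \<le> moll0 x" by (simp add: moll0_def)
  have "1 / ((norm x)\<^sup>2 - 1) \<le> 0" if "norm x < 1"
    using that power_le_one[of "norm x" 2] by (intro divide_nonneg_nonpos) auto
  then show "moll0 x \<le> 1" by (simp add: moll0_def)
qed

lemma moll_eps_measurable [measurable]: "(moll_eps \<epsilon> :: real^'n::finite \<Rightarrow> real) \<in> borel_measurable borel"
  unfolding moll_eps_def std_moll_def by measurable

lemma std_moll_nonneg: "0 \<le> std_moll x"
  unfolding std_moll_def by (intro divide_nonneg_nonneg integral_nonneg_AE) (auto simp: moll0_bounds)

lemma moll_eps_nonneg: "0 \<le> moll_eps \<epsilon> x"
  unfolding moll_eps_def by (simp add: std_moll_nonneg)

lemma moll_eps_support:
  assumes "\<epsilon> > 0" "norm y > \<epsilon>"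
  shows "moll_eps \<epsilon> y = 0"
  using assms by (simp add: moll_eps_def std_moll_def moll0_def)

lemma moll_eps_bounded: "\<exists>B. \<forall>y::real^'n::finite. moll_eps \<epsilon> y \<le> B"
proof -
  let ?I = "integral\<^sup>L lborel (moll0 :: real^'n \<Rightarrow> real)"
  have I: "0 \<le> ?I" by (intro integral_nonneg_AE) (auto simp: moll0_bounds)
  have "moll_eps \<epsilon> y \<le> \<epsilon> powr (- real CARD('n)) * (1 / ?I)" for y :: "real^'n"
    unfolding moll_eps_def std_moll_def
    by (intro mult_left_mono divide_right_mono moll0_bounds I) simp
  then show ?thesis by blast
qed

text \<open>Rescaling by \<open>\<epsilon>\<close> leaves the integral of \<open>moll0\<close>
  divided by itself, which is at most 1 whatever its value. An upper bound on the mass suffices for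
  Lipschitz estimates.\<close>

lemma integral_moll_eps:
  assumes \<epsilon>: "\<epsilon> > 0"
  shows "(\<integral>y. moll_eps \<epsilon> y \<partial>(lborel :: (real^'n::finite) measure)) \<le> 1"
proof -
  let ?m = "moll_eps \<epsilon> :: real^'n \<Rightarrow> real"
  have "(\<integral>y. ?m y \<partial>lborel) = (\<integral>y. ?m y \<partial>density (distr lborel borel (\<lambda>x. 0 + \<epsilon> *\<^sub>R x)) (\<lambda>_. \<bar>\<epsilon>\<bar> ^ DIM(real^'n)))"
    using lborel_affine[of \<epsilon> "0::real^'n"] \<epsilon> by (metis less_irrefl)
  also have "\<dots> = (\<integral>y. \<epsilon> ^ CARD('n) * ?m (\<epsilon> *\<^sub>R y) \<partial>lborel)"
    using \<epsilon> by (subst integral_density) (auto simp: integral_distr)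
  also have "\<dots> = (\<integral>y. std_moll y \<partial>(lborel :: (real^'n) measure))"
    using \<epsilon> by (simp add: moll_eps_def powr_minus powr_realpow)
  also have "\<dots> \<le> 1" unfolding std_moll_def by simp
  finally show ?thesis .
qed

lemma mollify_lipschitz:
  fixes f :: "real^'n::finite \<Rightarrow> real"
  assumes \<epsilon>: "\<epsilon> > 0" and K: "K \<ge> 0" and lip: "\<And>x y. \<bar>f x - f y\<bar> \<le> K * norm (x - y)"
  shows "\<bar>(\<integral>y. f (x - y) * moll_eps \<epsilon> y \<partial>lborel) - (\<integral>y. f (x' - y) * moll_eps \<epsilon> y \<partial>lborel)\<bar> \<le> K * norm (x - x')"
proof -
  have "K-lipschitz_on UNIV f" using lip K by (intro lipschitz_onI) (auto simp: dist_norm)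
  then have [measurable]: "f \<in> borel_measurable borel"
    by (intro borel_measurable_continuous_onI lipschitz_on_continuous_on)
  obtain B where B: "\<And>y::real^'n. moll_eps \<epsilon> y \<le> B" using moll_eps_bounded by blast
  have B0: "B \<ge> 0" using B[of 0] moll_eps_nonneg[of \<epsilon> "0::real^'n"] by linarith
  have int: "integrable lborel (\<lambda>y. f (x - y) * moll_eps \<epsilon> y)" for x
  proof (rule integrable_lborel_bounded_support[where R=\<epsilon> and B="(\<bar>f x\<bar> + K * \<epsilon>) * B"])
    fix y :: "real^'n" assume y: "norm y \<le> \<epsilon>"
    have "\<bar>f (x - y)\<bar> \<le> \<bar>f x\<bar> + K * norm y" using lip[of "x - y" x] by simp
    also have "\<dots> \<le> \<bar>f x\<bar> + K * \<epsilon>" using y K by (simp add: mult_left_mono)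
    finally show "\<bar>f (x - y) * moll_eps \<epsilon> y\<bar> \<le> (\<bar>f x\<bar> + K * \<epsilon>) * B"
      unfolding abs_mult using B[of y] moll_eps_nonneg[of \<epsilon> y] K \<epsilon> by (intro mult_mono) auto
  qed (auto simp: moll_eps_support[OF \<epsilon>])
  have mint: "integrable lborel (moll_eps \<epsilon> :: real^'n \<Rightarrow> real)"
    by (rule integrable_lborel_bounded_support[where R=\<epsilon> and B=B])
       (auto simp: moll_eps_support[OF \<epsilon>] B moll_eps_nonneg)
  have "(\<integral>y. f (x - y) * moll_eps \<epsilon> y \<partial>lborel) - (\<integral>y. f (x' - y) * moll_eps \<epsilon> y \<partial>lborel)
     = (\<integral>y. (f (x - y) - f (x' - y)) * moll_eps \<epsilon> y \<partial>lborel)"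
    using int[of x] int[of x'] by (simp add: left_diff_distrib)
  also have "\<bar>\<dots>\<bar> \<le> (\<integral>y. (K * norm (x - x')) * moll_eps \<epsilon> y \<partial>(lborel :: (real^'n) measure))"
  proof (rule order_trans[OF integral_abs_bound Bochner_Integration.integral_mono])
    show "integrable lborel (\<lambda>y. \<bar>(f (x - y) - f (x' - y)) * moll_eps \<epsilon> y\<bar>)"
      using int[of x] int[of x'] by (simp add: left_diff_distrib)
    show "integrable lborel (\<lambda>y::real^'n. K * norm (x - x') * moll_eps \<epsilon> y)" using mint by simp
    show "\<bar>(f (x - y) - f (x' - y)) * moll_eps \<epsilon> y\<bar> \<le> K * norm (x - x') * moll_eps \<epsilon> y" for y
      unfolding abs_mult using lip[of "x - y" "x' - y"] moll_eps_nonneg[of \<epsilon> y]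
      by (simp add: mult_right_mono)
  qed
  also have "\<dots> = K * norm (x - x') * (\<integral>y. moll_eps \<epsilon> y \<partial>(lborel :: (real^'n) measure))" by simp
  also have "\<dots> \<le> K * norm (x - x')"
    using integral_moll_eps[OF \<epsilon>, where 'n='n] K by (intro mult_left_le) auto
  finally show ?thesis .
qed

lemma interp_measurable:
  fixes v :: "int^'n::finite \<Rightarrow> real"
  assumes "\<rho> > 0" "grid_lipschitz \<rho> K v" "K \<ge> 0"
  shows "interp \<rho> v \<in> borel_measurable borel"
proof -
  have "(6 * 2 ^ CARD('n) * real CARD('n) ^ 2 * K)-lipschitz_on UNIV (interp \<rho> v)"
    using interp_lipschitz[OF assms] assms(3) by (intro lipschitz_onI) (auto simp: dist_norm)
  then show ?thesis by (intro borel_measurable_continuous_onI lipschitz_on_continuous_on)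
qed

section \<open>Propagation of Lipschitz constants through the backward scheme\<close>

context levy_measure
begin

text \<open>Two nodes are compared under the same control: their evaluation points are common
  displacements, and the weights \<open>E\<close> and \<open>1 - E\<close> of diffusion and jumps
  add up to 1, so only the running cost enlarges the constant. As \<open>v\<close> may be unbounded,
  the comparisons used also hold for default infima and integrals.\<close>

lemma schemeS_lipschitz:
  assumes \<rho>: "\<rho> > 0" and h: "h \<ge> 0" and r: "0 < r" "r < 1"
    and v: "grid_lipschitz \<rho> K v" and K: "K \<ge> 0"
    and F: "\<And>x y. \<bar>F x (\<mu> (real k * h)) - F y (\<mu> (real k * h))\<bar> \<le> LF * norm (x - y)"
    and L: "\<And>x y q. \<bar>L x q - L y q\<bar> \<le> LL * norm (x - y)"
  shows "grid_lipschitz \<rho> (K + h * (LF + LL)) (\<lambda>i. schemeS \<nu> L F \<rho> h r \<mu> v i k)"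
  unfolding grid_lipschitz_def
proof (intro allI)
  fix i j :: "int^'n"
  let ?d = "real CARD('n)" and ?lam = "lev_lam \<nu> r"
  define n where "n = norm (grid \<rho> i - grid \<rho> j)"
  define E where "E = exp (- h * ?lam)"
  have n0: "0 \<le> n" by (simp add: n_def)
  have lam: "0 \<le> ?lam" by (simp add: lev_lam_def)
  have E: "0 < E" "E \<le> 1" using h lam by (auto simp: E_def)
  note Is = interp_grid_shift_le[OF \<rho> v, of i _ j, folded n_def]
  define J where "J \<alpha> i = exp (- h * ?lam) / (2 * ?d) *
            (\<Sum>m\<in>UNIV. interp \<rho> v (grid \<rho> i + h *\<^sub>R (- \<alpha> - lev_b \<nu> r) + sqrt (h * ?d) *\<^sub>R column m (lev_sig \<nu> r))
                       + interp \<rho> v (grid \<rho> i + h *\<^sub>R (- \<alpha> - lev_b \<nu> r) - sqrt (h * ?d) *\<^sub>R column m (lev_sig \<nu> r)))" for \<alpha> i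
  define Q where "Q i = (\<integral>z\<in>{z. r \<le> norm z}. interp \<rho> v (grid \<rho> i + z) \<partial>\<nu>)" for i
  have "\<bar>J \<alpha> i - J \<alpha> j\<bar> \<le> E * (K * n)" for \<alpha>
  proof -
    let ?s = "\<lambda>m. sqrt (h * ?d) *\<^sub>R column m (lev_sig \<nu> r)" and ?w = "h *\<^sub>R (- \<alpha> - lev_b \<nu> r)"
    let ?t = "\<lambda>i m. interp \<rho> v (grid \<rho> i + ?w + ?s m) + interp \<rho> v (grid \<rho> i + ?w - ?s m)"
    have "\<bar>?t i m - ?t j m\<bar> \<le> 2 * (K * n)" for m
      using Is[of "?w + ?s m"] Is[of "?w - ?s m"] by (simp add: algebra_simps)
    then have "(\<Sum>m\<in>(UNIV::'n set). \<bar>?t i m - ?t j m\<bar>) \<le> (\<Sum>m\<in>(UNIV::'n set). 2 * (K * n))"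
      by (intro sum_mono)
    then have s: "\<bar>\<Sum>m\<in>UNIV. ?t i m - ?t j m\<bar> \<le> ?d * (2 * (K * n))"
      using sum_abs[of "\<lambda>m. ?t i m - ?t j m" UNIV] by (simp only: sum_constant order_trans)
    have "J \<alpha> i - J \<alpha> j = E / (2 * ?d) * (\<Sum>m\<in>UNIV. ?t i m - ?t j m)"
      unfolding J_def E_def[symmetric] sum_subtractf by (rule right_diff_distrib[symmetric])
    also have "\<bar>\<dots>\<bar> \<le> E / (2 * ?d) * (?d * (2 * (K * n)))"
      unfolding abs_mult using s E by (intro mult_mono) auto
    finally show ?thesis by simp
  qed
  moreover have "\<bar>(1 - E) / ?lam * Q i - (1 - E) / ?lam * Q j\<bar> \<le> (1 - E) * (K * n)"
  \<comment> \<open>Division by zero gives the jump term weight 0 when the intensity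
    vanishes.\<close>
  proof (cases "?lam = 0")
    case True then show ?thesis using E K n0 by simp
  next
    case False
    note [measurable] = interp_measurable[OF \<rho> v K]
    have "\<bar>Q i - Q j\<bar> \<le> (K * n) * measure \<nu> {z. r \<le> norm z}"
      unfolding Q_def using Is emeasure_outside[OF r(1)]
      by (intro set_integral_dist_le) (auto simp: nu_sets)
    then have "\<bar>Q i - Q j\<bar> \<le> (K * n) * ?lam" by (simp add: measure_closed_outside[OF r])
    then have "(1 - E) / ?lam * \<bar>Q i - Q j\<bar> \<le> (1 - E) / ?lam * ((K * n) * ?lam)"
      using E lam by (intro mult_left_mono) auto
    then show ?thesis using False E lam
      unfolding right_diff_distrib[symmetric] abs_mult by simp
  qed
  moreover have "\<bar>h * F (grid \<rho> i) (\<mu> (real k * h)) - h * F (grid \<rho> j) (\<mu> (real k * h))\<bar> \<le> h * (LF * n)"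
    unfolding right_diff_distrib[symmetric] abs_mult n_def using F h by (intro mult_mono) auto
  moreover have "\<bar>h * L (grid \<rho> i) \<alpha> - h * L (grid \<rho> j) \<alpha>\<bar> \<le> h * (LL * n)" for \<alpha>
    unfolding right_diff_distrib[symmetric] abs_mult n_def using L h by (intro mult_mono) auto
  moreover have "E * (K * n) + (1 - E) * (K * n) + h * (LF * n) + h * (LL * n) = (K + h * (LF + LL)) * n"
    by (simp add: algebra_simps)
  ultimately have A: "\<bar>(h * F (grid \<rho> i) (\<mu> (real k * h)) + h * L (grid \<rho> i) \<alpha> + J \<alpha> i + (1 - E) / ?lam * Q i)
     - (h * F (grid \<rho> j) (\<mu> (real k * h)) + h * L (grid \<rho> j) \<alpha> + J \<alpha> j + (1 - E) / ?lam * Q j)\<bar>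
     \<le> (K + h * (LF + LL)) * n" for \<alpha>
    by (smt (verit))
  have S: "schemeS \<nu> L F \<rho> h r \<mu> v i k = Inf (range (\<lambda>\<alpha>. h * F (grid \<rho> i) (\<mu> (real k * h)) + h * L (grid \<rho> i) \<alpha>
      + J \<alpha> i + (1 - E) / ?lam * Q i))" for i
    unfolding schemeS_def Let_def J_def Q_def E_def ..
  show "\<bar>schemeS \<nu> L F \<rho> h r \<mu> v i k - schemeS \<nu> L F \<rho> h r \<mu> v j k\<bar>
      \<le> (K + h * (LF + LL)) * norm (grid \<rho> i - grid \<rho> j)"
    unfolding S n_def[symmetric] by (rule Inf_range_dist_le) (rule A)
qed

text \<open>The increments accumulate additively, so even after \<open>N\<close> steps the constant
  is at most \<open>LF + T * (LF + LL)\<close>.\<close>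

lemma hjb_back_lipschitz:
  assumes \<rho>: "\<rho> > 0" and T: "T > 0" and N: "N > 0" and r: "0 < r" "r < 1"
    and flow: "cont_flow T \<mu>" and LF: "LF \<ge> 0" and LL: "LL \<ge> 0"
    and FG: "\<And>x y \<mu>. \<mu> \<in> prob_meas \<Longrightarrow> \<bar>F x \<mu> - F y \<mu>\<bar> \<le> LF * norm (x - y)"
      "\<And>x y \<mu>. \<mu> \<in> prob_meas \<Longrightarrow> \<bar>G x \<mu> - G y \<mu>\<bar> \<le> LF * norm (x - y)"
    and L: "\<And>x y q. \<bar>L x q - L y q\<bar> \<le> LL * norm (x - y)"
    and j: "j \<le> N"
  shows "grid_lipschitz \<rho> (LF + real j * (T / real N) * (LF + LL)) (hjb_back \<nu> L F G T N \<rho> r \<mu> j)"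
  using j
proof (induction j)
  case 0
  have "\<mu> T \<in> prob_meas" using flow T by (auto simp: cont_flow_def)
  then show ?case by (simp add: grid_lipschitz_def FG)
next
  case (Suc j)
  have "real (N - Suc j) * (T / real N) \<le> real N * (T / real N)"
    using T by (intro mult_right_mono) auto
  then have "real (N - Suc j) * (T / real N) \<in> {0..T}" using T N by simp
  then have \<mu>: "\<mu> (real (N - Suc j) * (T / real N)) \<in> prob_meas" using flow unfolding cont_flow_def by blast
  have "grid_lipschitz \<rho> (LF + real j * (T / real N) * (LF + LL) + T / real N * (LF + LL))
     (\<lambda>i. schemeS \<nu> L F \<rho> (T / real N) r \<mu> (hjb_back \<nu> L F G T N \<rho> r \<mu> j) i (N - Suc j))"
    using T LF LL Suc by (intro schemeS_lipschitz \<rho> r FG(1) L \<mu> Suc.IH) auto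
  then show ?case by (simp add: algebra_simps add_divide_distrib)
qed

text \<open>The dimensional factor of \<open>interp_lipschitz\<close> enters the gradient bound only
  here, and convolution preserves it. For times beyond \<open>T\<close> truncated subtraction in
  \<open>N - k\<close> returns the terminal data, so the bound holds for every real
  \<open>t\<close>.\<close>

lemma u_eps_lipschitz:
  assumes \<rho>: "\<rho> > 0" and T: "T > 0" and N: "N > 0" and r: "0 < r" "r < 1" and \<epsilon>: "\<epsilon> > 0"
    and flow: "cont_flow T \<mu>" and LF: "LF \<ge> 0" and LL: "LL \<ge> 0"
    and FG: "\<And>x y \<mu>. \<mu> \<in> prob_meas \<Longrightarrow> \<bar>F x \<mu> - F y \<mu>\<bar> \<le> LF * norm (x - y)"
      "\<And>x y \<mu>. \<mu> \<in> prob_meas \<Longrightarrow> \<bar>G x \<mu> - G y \<mu>\<bar> \<le> LF * norm (x - y)"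
    and L: "\<And>x y q. \<bar>L x q - L y q\<bar> \<le> LL * norm (x - y)"
  shows "\<bar>u_eps \<nu> L F G T N \<rho> r \<epsilon> \<mu> t x - u_eps \<nu> L F G T N \<rho> r \<epsilon> \<mu> t y\<bar>
    \<le> 6 * 2 ^ CARD('n) * real CARD('n) ^ 2 * (LF + T * (LF + LL)) * norm (x - y)"
proof -
  define k where "k = nat \<lfloor>t / (T / real N)\<rfloor>"
  let ?K = "LF + real (N - k) * (T / real N) * (LF + LL)"
  have v: "grid_lipschitz \<rho> ?K (u_disc \<nu> L F G T N \<rho> r \<mu> k)"
    unfolding u_disc_def by (rule hjb_back_lipschitz[OF \<rho> T N r flow LF LL FG L]) auto
  have K0: "0 \<le> ?K" using LF LL T by simp
  have "real (N - k) * (T / real N) \<le> real N * (T / real N)" using T by (intro mult_right_mono) auto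
  then have "real (N - k) * (T / real N) \<le> T" using N by simp
  then have "?K \<le> LF + T * (LF + LL)" using LF LL by (intro add_left_mono mult_right_mono) auto
  then have K: "6 * 2 ^ CARD('n) * real CARD('n) ^ 2 * ?K \<le> 6 * 2 ^ CARD('n) * real CARD('n) ^ 2 * (LF + T * (LF + LL))"
    by (intro mult_left_mono) auto
  have lip: "\<bar>u_interp \<nu> L F G T N \<rho> r \<mu> t x - u_interp \<nu> L F G T N \<rho> r \<mu> t y\<bar>
      \<le> 6 * 2 ^ CARD('n) * real CARD('n) ^ 2 * (LF + T * (LF + LL)) * norm (x - y)" for x y
    unfolding u_interp_def k_def[symmetric]
    using interp_lipschitz[OF \<rho> v K0, of x y] mult_right_mono[OF K norm_ge_zero, of "x - y"] by linarith
  show ?thesis unfolding u_eps_def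
    using LF LL T by (intro mollify_lipschitz[OF \<epsilon> _ lip]) auto
qed

lemma drift_bounded:
  assumes T: "T > 0"
    and L2: "\<exists>LL. \<forall>x y q. \<bar>L x q - L y q\<bar> \<le> LL * dist x y"
    and F2: "\<exists>LF. \<forall>x y \<mu>1 \<mu>2. \<mu>1 \<in> prob_meas \<longrightarrow> \<mu>2 \<in> prob_meas \<longrightarrow>
               \<bar>F x \<mu>1 - F y \<mu>2\<bar> \<le> LF * (dist x y + d0 \<mu>1 \<mu>2) \<and>
               \<bar>G x \<mu>1 - G y \<mu>2\<bar> \<le> LF * (dist x y + d0 \<mu>1 \<mu>2)"
    and H1: "\<forall>R. \<exists>C. \<forall>x p. norm p \<le> R \<longrightarrow> norm (DpH L x p) \<le> C"
  shows "\<exists>K\<ge>0. \<forall>\<rho> N r \<epsilon> \<mu> t x. \<rho> > 0 \<longrightarrow> N > 0 \<longrightarrow> 0 < r \<longrightarrow> r < 1 \<longrightarrow> \<epsilon> > 0 \<longrightarrow> cont_flow T \<mu> \<longrightarrow>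
     norm (DpH L x (grad (u_eps \<nu> L F G T N \<rho> r \<epsilon> \<mu> t) x)) \<le> K"
proof -
  obtain LL0 where LL0: "\<And>x y q. \<bar>L x q - L y q\<bar> \<le> LL0 * dist x y" using L2 by blast
  obtain LF0 where LF0: "\<And>x y \<mu>1 \<mu>2. \<mu>1 \<in> prob_meas \<Longrightarrow> \<mu>2 \<in> prob_meas \<Longrightarrow>
               \<bar>F x \<mu>1 - F y \<mu>2\<bar> \<le> LF0 * (dist x y + d0 \<mu>1 \<mu>2) \<and>
               \<bar>G x \<mu>1 - G y \<mu>2\<bar> \<le> LF0 * (dist x y + d0 \<mu>1 \<mu>2)" using F2 by blast
  have L: "\<bar>L x q - L y q\<bar> \<le> \<bar>LL0\<bar> * norm (x - y)" for x y q
    using order_trans[OF LL0[of x q y] mult_right_mono[of LL0 "\<bar>LL0\<bar>" "dist x y"]] by (simp add: dist_norm)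
  have le: "LF0 * norm (x - y) \<le> \<bar>LF0\<bar> * norm (x - y)" for x y :: "real^'n" by (intro mult_right_mono) auto
  have FG: "\<bar>F x \<mu> - F y \<mu>\<bar> \<le> \<bar>LF0\<bar> * norm (x - y)" "\<bar>G x \<mu> - G y \<mu>\<bar> \<le> \<bar>LF0\<bar> * norm (x - y)"
    if "\<mu> \<in> prob_meas" for x y \<mu>
    using LF0[OF that that, of x y] le[of x y] by (simp_all add: d0_refl dist_norm)
  \<comment> \<open>\<open>R\<close> depends only on the data and \<open>T\<close>, hence the bound
    on \<open>DpH\<close> is uniform in the discretization. The second argument of
    \<open>max\<close> covers the default value of \<open>grad\<close>.\<close>
  define R where "R = max (6 * 2 ^ CARD('n) * real CARD('n) ^ 2 * (\<bar>LF0\<bar> + T * (\<bar>LF0\<bar> + \<bar>LL0\<bar>))) (norm (THE g :: real^'n. False))"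
  obtain C where C: "\<And>x p. norm p \<le> R \<Longrightarrow> norm (DpH L x p) \<le> C" using H1 by blast
  have "norm (DpH L x (grad (u_eps \<nu> L F G T N \<rho> r \<epsilon> \<mu> t) x)) \<le> max 0 C"
    if "\<rho> > 0" "N > 0" "0 < r" "r < 1" "\<epsilon> > 0" "cont_flow T \<mu>" for \<rho> N r \<epsilon> \<mu> t x
  proof -
    have "norm (grad (u_eps \<nu> L F G T N \<rho> r \<epsilon> \<mu> t) x) \<le> R"
      unfolding R_def
      by (rule norm_grad_le, rule u_eps_lipschitz) (use that T FG L in auto)
    from C[OF this, of x] show ?thesis by simp
  qed
  then show ?thesis by (intro exI[of _ "max 0 C"]) auto
qed

end

section \<open>Interchange of sums and integrals\<close>

text \<open>Enumerates the index set and pads with zeros, so that results on series over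
  \<open>nat\<close> apply to unordered sums.\<close>

lemma has_sum_countable_nat:
  fixes F :: "'i::countable \<Rightarrow> 'b::{comm_monoid_add,topological_space}"
  shows "(F has_sum s) UNIV \<longleftrightarrow>
    ((\<lambda>n. if n \<in> range (to_nat :: 'i \<Rightarrow> nat) then F (from_nat n) else 0) has_sum s) UNIV" (is "_ \<longleftrightarrow> (?G has_sum s) UNIV")
proof -
  have "(F has_sum s) UNIV \<longleftrightarrow> (?G has_sum s) (range (to_nat :: 'i \<Rightarrow> nat))"
    by (subst has_sum_reindex) (simp_all add: o_def)
  also have "\<dots> \<longleftrightarrow> (?G has_sum s) UNIV"
    by (rule has_sum_cong_neutral) auto
  finally show ?thesis .
qed

lemma integral_has_sum:
  fixes f :: "'i::countable \<Rightarrow> 'a \<Rightarrow> real"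
  assumes int: "\<And>i. integrable M (f i)"
    and pt: "\<And>x. (\<lambda>i. f i x) summable_on UNIV"
    and sm: "(\<lambda>i. \<integral>x. \<bar>f i x\<bar> \<partial>M) summable_on UNIV"
  shows "integrable M (\<lambda>x. \<Sum>\<^sub>\<infinity>i. f i x)"
    and "((\<lambda>i. \<integral>x. f i x \<partial>M) has_sum (\<integral>x. (\<Sum>\<^sub>\<infinity>i. f i x) \<partial>M)) UNIV"
proof -
  let ?R = "range (to_nat :: 'i \<Rightarrow> nat)"
  define g where "g n x = (if n \<in> ?R then f (from_nat n) x else 0)" for n x
  have gint: "integrable M (g n)" for n
    using int[of "from_nat n"] by (cases "n \<in> ?R") (auto simp: g_def[abs_def])
  have hs: "((\<lambda>n. g n x) has_sum (\<Sum>\<^sub>\<infinity>i. f i x)) UNIV" for x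
    unfolding g_def by (rule has_sum_countable_nat[THEN iffD1]) (rule has_sum_infsum[OF pt])
  then have sums: "(\<lambda>n. g n x) sums (\<Sum>\<^sub>\<infinity>i. f i x)" for x by (rule has_sum_imp_sums)
  then have eq: "(\<Sum>n. g n x) = (\<Sum>\<^sub>\<infinity>i. f i x)" for x by (simp add: sums_iff)
  have nrm: "summable (\<lambda>n. norm (g n x))" for x
  proof -
    have "(\<lambda>n. g n x) summable_on UNIV" using hs[of x] by (auto simp: summable_on_def)
    then have "(\<lambda>n. norm (g n x)) summable_on UNIV"
      by (rule summable_on_iff_abs_summable_on_real[THEN iffD1])
    then show ?thesis by (rule summable_on_imp_summable)
  qed
  have gs: "summable (\<lambda>n. \<integral>x. norm (g n x) \<partial>M)"
  proof -
    have e: "(\<integral>x. norm (g n x) \<partial>M) = (if n \<in> ?R then \<integral>x. \<bar>f (from_nat n) x\<bar> \<partial>M else 0)" for n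
      by (auto simp: g_def)
    have "((\<lambda>n. if n \<in> ?R then \<integral>x. \<bar>f (from_nat n) x\<bar> \<partial>M else 0) has_sum (\<Sum>\<^sub>\<infinity>i. \<integral>x. \<bar>f i x\<bar> \<partial>M)) UNIV"
      by (rule has_sum_countable_nat[THEN iffD1]) (rule has_sum_infsum[OF sm])
    then show ?thesis unfolding e by (blast intro: has_sum_imp_sums sums_summable)
  qed
  show "integrable M (\<lambda>x. \<Sum>\<^sub>\<infinity>i. f i x)"
    using integrable_suminf[OF gint _ gs] nrm by (simp add: eq)
  have 1: "(\<lambda>n. \<integral>x. g n x \<partial>M) sums (\<integral>x. (\<Sum>\<^sub>\<infinity>i. f i x) \<partial>M)"
    using sums_integral[OF gint _ gs] nrm by (simp add: eq)
  have 2: "summable (\<lambda>n. norm (\<integral>x. g n x \<partial>M))"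
    by (rule summable_comparison_test'[OF gs, of 0]) (simp add: integral_abs_bound)
  have "((\<lambda>n. \<integral>x. g n x \<partial>M) has_sum (\<integral>x. (\<Sum>\<^sub>\<infinity>i. f i x) \<partial>M)) UNIV"
    by (rule norm_summable_imp_has_sum[OF 2 1])
  moreover have "(\<lambda>n. \<integral>x. g n x \<partial>M) = (\<lambda>n. if n \<in> ?R then \<integral>x. f (from_nat n) x \<partial>M else 0)"
    by (auto simp: g_def)
  ultimately show "((\<lambda>i. \<integral>x. f i x \<partial>M) has_sum (\<integral>x. (\<Sum>\<^sub>\<infinity>i. f i x) \<partial>M)) UNIV"
    by (simp only: has_sum_countable_nat[of "\<lambda>i. \<integral>x. f i x \<partial>M"])
qed

lemma sum_hat_le_1:
  assumes "\<rho> > 0" "finite Fs"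
  shows "(\<Sum>i\<in>Fs. hat \<rho> i x) \<le> 1"
proof -
  have "(\<Sum>i\<in>Fs. hat \<rho> i x) = (\<Sum>i\<in>Fs \<inter> cell_corners \<rho> x. hat \<rho> i x)"
    using hat_support_cell_corners[OF assms(1), of _ x] assms(2)
    by (intro sum.mono_neutral_right) auto
  also have "\<dots> \<le> (\<Sum>i\<in>cell_corners \<rho> x. hat \<rho> i x)"
    by (intro sum_mono2) (auto simp: hat_nonneg)
  finally show ?thesis by (simp add: sum_hat_cell_corners assms)
qed

lemma hat_measurable [measurable]:
  "hat \<rho> (i :: int^'n::finite) \<in> borel_measurable borel"
  unfolding hat_def[abs_def] by measurable

text \<open>Hats sum to at most 1 over any finite index set, so partial sums of the absolute
  integrals stay below \<open>B\<close> times the mass of \<open>S\<close>. This domination permits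
  the exchange of sum and integral.\<close>

lemma has_sum_set_integral_hat:
  fixes v :: "int^'n::finite \<Rightarrow> real" and M :: "(real^'n) measure"
  assumes \<rho>: "\<rho> > 0" and M: "sets M = sets borel" and S: "S \<in> sets borel" "emeasure M S < \<infinity>"
    and v: "\<And>i. \<bar>v i\<bar> \<le> B"
  shows "set_integrable M S (\<lambda>z. interp \<rho> v (x + z))"
    and "((\<lambda>i. v i * (\<integral>z\<in>S. hat \<rho> i (x + z) \<partial>M)) has_sum (\<integral>z\<in>S. interp \<rho> v (x + z) \<partial>M)) UNIV"
proof -
  note [measurable_cong] = M
  note [measurable] = S(1)
  let ?f = "\<lambda>i z. indicat_real S z * (v i * hat \<rho> i (x + z))"
  have B0: "B \<ge> 0" using v[of undefined] by linarith
  have iS: "integrable M (\<lambda>z. B * indicat_real S z)"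
    using S M by (simp add: integrable_indicator_iff)
  have le: "\<bar>?f i z\<bar> \<le> B * indicat_real S z * hat \<rho> i (x + z)" for i z
    using v[of i] hat_nonneg[of \<rho> i "x + z"]
    by (cases "z \<in> S") (auto simp: abs_mult mult_right_mono)
  have le2: "B * indicat_real S z * hat \<rho> i (x + z) \<le> B * indicat_real S z" for i z
    using B0 hat_le_1[OF \<rho>, of i "x + z"] by (intro mult_left_le) auto
  have fint: "integrable M (?f i)" for i
    by (rule Bochner_Integration.integrable_bound[OF iS])
       (use order_trans[OF le le2] B0 in auto)
  have pt0: "((\<lambda>i. ?f i z) has_sum indicat_real S z * interp \<rho> v (x + z)) UNIV" for z
    by (intro has_sum_cmult_right has_sum_interp \<rho>)
  then have pt: "(\<lambda>i. ?f i z) summable_on UNIV" for z by (auto simp: summable_on_def)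
  have inf: "(\<Sum>\<^sub>\<infinity>i. ?f i z) = indicat_real S z * interp \<rho> v (x + z)" for z
    by (rule infsumI) (rule pt0)
  have sm: "(\<lambda>i. \<integral>z. \<bar>?f i z\<bar> \<partial>M) summable_on UNIV"
  proof (rule nonneg_bdd_above_summable_on)
    show "bdd_above (sum (\<lambda>i. \<integral>z. \<bar>?f i z\<bar> \<partial>M) ` {F. F \<subseteq> UNIV \<and> finite F})"
    proof (rule bdd_aboveI2)
      fix Fs :: "(int^'n) set" assume "Fs \<in> {F. F \<subseteq> UNIV \<and> finite F}"
      then have fin: "finite Fs" by simp
      have "(\<Sum>i\<in>Fs. \<integral>z. \<bar>?f i z\<bar> \<partial>M) = (\<integral>z. (\<Sum>i\<in>Fs. \<bar>?f i z\<bar>) \<partial>M)"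
        by (rule Bochner_Integration.integral_sum[symmetric]) (use fint in auto)
      also have "\<dots> \<le> (\<integral>z. B * indicat_real S z \<partial>M)"
      proof (rule Bochner_Integration.integral_mono[OF _ iS])
        show "integrable M (\<lambda>z. \<Sum>i\<in>Fs. \<bar>?f i z\<bar>)" by (intro Bochner_Integration.integrable_sum integrable_abs fint)
        fix z
        have "(\<Sum>i\<in>Fs. \<bar>?f i z\<bar>) \<le> (\<Sum>i\<in>Fs. B * indicat_real S z * hat \<rho> i (x + z))" by (intro sum_mono le)
        also have "\<dots> = B * indicat_real S z * (\<Sum>i\<in>Fs. hat \<rho> i (x + z))" by (simp add: sum_distrib_left)
        also have "\<dots> \<le> B * indicat_real S z"
          using sum_hat_le_1[OF \<rho> fin, of "x + z"] B0 by (intro mult_left_le) auto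
        finally show "(\<Sum>i\<in>Fs. \<bar>?f i z\<bar>) \<le> B * indicat_real S z" .
      qed
      finally show "(\<Sum>i\<in>Fs. \<integral>z. \<bar>?f i z\<bar> \<partial>M) \<le> (\<integral>z. B * indicat_real S z \<partial>M)" .
    qed
  qed simp
  show "set_integrable M S (\<lambda>z. interp \<rho> v (x + z))"
    using integral_has_sum(1)[OF fint pt sm] unfolding inf by (simp add: set_integrable_def)
  have e: "(\<integral>z. ?f i z \<partial>M) = v i * (\<integral>z\<in>S. hat \<rho> i (x + z) \<partial>M)" for i
    by (simp add: set_lebesgue_integral_def mult.left_commute[of _ "v i"])
  show "((\<lambda>i. v i * (\<integral>z\<in>S. hat \<rho> i (x + z) \<partial>M)) has_sum (\<integral>z\<in>S. interp \<rho> v (x + z) \<partial>M)) UNIV"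
    using integral_has_sum(2)[OF fint pt sm] unfolding inf e by (simp add: set_lebesgue_integral_def)
qed

text \<open>Fubini for double sums moves the matrix from the density to the test function. Column
  sums equal to 1 give absolute summability, with total at most \<open>C\<close> times the mass of
  \<open>m\<close>.\<close>

lemma stochastic_step:
  fixes m :: "'i \<Rightarrow> real" and B :: "'i \<Rightarrow> 'i \<Rightarrow> real"
  assumes m: "\<And>j. 0 \<le> m j" "m summable_on UNIV"
    and B: "\<And>i j. 0 \<le> B i j" "\<And>j. ((\<lambda>i. B i j) has_sum 1) UNIV"
    and \<phi>: "\<And>i. \<bar>\<phi> i\<bar> \<le> C"
  shows "(\<lambda>i. \<phi> i * (\<Sum>\<^sub>\<infinity>j. m j * B i j)) summable_on UNIV"
    and "(\<Sum>\<^sub>\<infinity>i. \<phi> i * (\<Sum>\<^sub>\<infinity>j. m j * B i j)) = (\<Sum>\<^sub>\<infinity>j. m j * (\<Sum>\<^sub>\<infinity>i. \<phi> i * B i j))"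
proof -
  let ?f = "\<lambda>j i. \<phi> i * (m j * B i j)"
  have C0: "C \<ge> 0" using \<phi>[of undefined] by linarith
  have Bs: "(\<lambda>i. B i j) summable_on UNIV" for j using B(2)[of j] by (auto simp: summable_on_def)
  have dom: "(\<lambda>i. C * (m j * B i j)) summable_on UNIV" for j
    by (intro summable_on_cmult_right Bs)
  have le: "\<bar>?f j i\<bar> \<le> C * (m j * B i j)" for j i
    using \<phi>[of i] m(1)[of j] B(1)[of i j] by (simp add: abs_mult mult_right_mono)
  have as: "(\<lambda>i. norm (?f j i)) summable_on UNIV" for j
    by (rule Infinite_Sum.abs_summable_on_comparison_test'[OF dom]) (use le in auto)
  have tot: "(\<Sum>\<^sub>\<infinity>i. C * (m j * B i j)) = C * m j" for j
    using infsumI[OF has_sum_cmult_right[OF has_sum_cmult_right[OF B(2)[of j], of "m j"], of C]] by simp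
  have inner: "(\<Sum>\<^sub>\<infinity>i. norm (?f j i)) \<le> C * m j" for j
    unfolding tot[symmetric] by (rule infsum_mono) (use as dom le in auto)
  have "(\<lambda>p. norm ((\<lambda>(j, i). ?f j i) p)) summable_on (UNIV \<times> UNIV)"
    unfolding Infinite_Sum.abs_summable_on_Sigma_iff
  proof (intro conjI ballI)
    fix j show "(\<lambda>i. norm (case (j, i) of (j, i) \<Rightarrow> ?f j i)) summable_on UNIV" using as[of j] by simp
  next
    show "(\<lambda>j. norm (\<Sum>\<^sub>\<infinity>i. norm (case (j, i) of (j, i) \<Rightarrow> ?f j i))) summable_on UNIV"
    proof (rule Infinite_Sum.abs_summable_on_comparison_test')
      show "(\<lambda>j. C * m j) summable_on UNIV" by (intro summable_on_cmult_right m)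
      fix j
      have "0 \<le> (\<Sum>\<^sub>\<infinity>i. norm (?f j i))" by (intro infsum_nonneg) simp
      then show "norm (\<Sum>\<^sub>\<infinity>i. norm (case (j, i) of (j, i) \<Rightarrow> ?f j i)) \<le> C * m j"
        using inner[of j] by simp
    qed
  qed
  then have s: "(\<lambda>(j, i). ?f j i) summable_on (UNIV \<times> UNIV)" by (rule Infinite_Sum.abs_summable_summable)
  then have s': "(\<lambda>(i, j). ?f j i) summable_on (UNIV \<times> UNIV)"
    using summable_on_swap[of "\<lambda>(j, i). ?f j i" UNIV UNIV] by (simp add: case_prod_unfold)
  have e: "(\<Sum>\<^sub>\<infinity>j. ?f j i) = \<phi> i * (\<Sum>\<^sub>\<infinity>j. m j * B i j)" for i by (rule infsum_cmult_right')
  show "(\<lambda>i. \<phi> i * (\<Sum>\<^sub>\<infinity>j. m j * B i j)) summable_on UNIV"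
    using summable_on_Sigma_banach[OF s'] by (simp add: e)
  have e2: "(\<Sum>\<^sub>\<infinity>i. ?f j i) = m j * (\<Sum>\<^sub>\<infinity>i. \<phi> i * B i j)" for j
    by (subst infsum_cmult_right'[symmetric]) (simp add: mult_ac)
  show "(\<Sum>\<^sub>\<infinity>i. \<phi> i * (\<Sum>\<^sub>\<infinity>j. m j * B i j)) = (\<Sum>\<^sub>\<infinity>j. m j * (\<Sum>\<^sub>\<infinity>i. \<phi> i * B i j))"
    using infsum_swap_banach[OF s'] by (simp add: e e2)
qed

text \<open>\<open>Ca\<close> and \<open>Cb\<close> secure summability of the two sums; the size of
  the estimate comes from \<open>D\<close> and the mass bound alone.\<close>

lemma infsum_weighted_dist_le:
  fixes m :: "'i \<Rightarrow> real"
  assumes m: "\<And>j. 0 \<le> m j" "m summable_on UNIV" "(\<Sum>\<^sub>\<infinity>j. m j) \<le> 1"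
    and a: "\<And>j. \<bar>a j\<bar> \<le> Ca" and b: "\<And>j. \<bar>b j\<bar> \<le> Cb" and D: "\<And>j. \<bar>a j - b j\<bar> \<le> D"
  shows "\<bar>(\<Sum>\<^sub>\<infinity>j. m j * a j) - (\<Sum>\<^sub>\<infinity>j. m j * b j)\<bar> \<le> D"
proof -
  have s: "(\<lambda>j. norm (m j * c j)) summable_on UNIV" if "\<And>j. \<bar>c j\<bar> \<le> C" for c C
  proof (rule Infinite_Sum.abs_summable_on_comparison_test')
    show "(\<lambda>j. C * m j) summable_on UNIV" by (intro summable_on_cmult_right m)
    show "norm (m j * c j) \<le> C * m j" for j
      using that[of j] m(1)[of j] by (simp add: abs_mult mult.commute[of _ "m j"] mult_left_mono)
  qed
  have sa: "(\<lambda>j. m j * a j) summable_on UNIV" and sb: "(\<lambda>j. m j * b j) summable_on UNIV"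
    using s[of a, OF a] s[of b, OF b] by (auto intro: Infinite_Sum.abs_summable_summable)
  have D0: "D \<ge> 0" using D[of undefined] by linarith
  have "(\<Sum>\<^sub>\<infinity>j. m j * a j) - (\<Sum>\<^sub>\<infinity>j. m j * b j) = (\<Sum>\<^sub>\<infinity>j. m j * (a j - b j))"
    using infsum_add[OF sb Infinite_Sum.abs_summable_summable[OF s[of "\<lambda>j. a j - b j", OF D]]]
    by (simp add: right_diff_distrib)
  also have "\<bar>\<dots>\<bar> \<le> (\<Sum>\<^sub>\<infinity>j. norm (m j * (a j - b j)))"
    using norm_infsum_bound[OF s[of "\<lambda>j. a j - b j", OF D]] by simp
  also have "\<dots> \<le> (\<Sum>\<^sub>\<infinity>j. D * m j)"
  proof (rule infsum_mono[OF s[of "\<lambda>j. a j - b j", OF D]])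
    show "(\<lambda>j. D * m j) summable_on UNIV" by (intro summable_on_cmult_right m)
    show "norm (m j * (a j - b j)) \<le> D * m j" for j
      using D[of j] m(1)[of j] by (simp add: abs_mult mult.commute[of _ "m j"] mult_left_mono)
  qed
  also have "\<dots> = D * (\<Sum>\<^sub>\<infinity>j. m j)" by (rule infsum_cmult_right')
  also have "\<dots> \<le> D" using m(3) D0 by (simp add: mult_left_le)
  finally show "\<bar>(\<Sum>\<^sub>\<infinity>j. m j * a j) - (\<Sum>\<^sub>\<infinity>j. m j * b j)\<bar> \<le> D" .
qed

section \<open>Consistency of one time step\<close>

text \<open>\<open>q\<close> weights the compensator in the jump part and \<open>E * h\<close>
  weights the drift in the diffusive part; their second-order agreement is what makes the two
  cancel. For \<open>lam = 0\<close> division yields \<open>q = 0\<close>, hence the side condition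
  on the last claim.\<close>

lemma exp_step_bounds:
  fixes h lam :: real
  assumes h: "h > 0" and lam: "lam \<ge> 0"
  defines "E \<equiv> exp (- h * lam)"
  defines "q \<equiv> (1 - E) / lam"
  shows "0 < E" "E \<le> 1" "0 \<le> q" "q \<le> h" "q * lam = 1 - E" "lam \<noteq> 0 \<Longrightarrow> \<bar>q - E * h\<bar> \<le> h * (h * lam)"
proof -
  let ?x = "h * lam"
  have x: "0 \<le> ?x" using h lam by simp
  show E: "0 < E" "E \<le> 1" using x by (auto simp: E_def)
  have E1: "1 - ?x \<le> E" using exp_ge_add_one_self[of "- h * lam"] by (simp add: E_def)
  show "0 \<le> q" using E lam by (simp add: q_def)
  show "q \<le> h"
    using E1 lam h by (cases "lam = 0") (auto simp: q_def field_simps)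
  show ql: "q * lam = 1 - E" by (cases "lam = 0") (auto simp: q_def E_def)
  assume "lam \<noteq> 0"
  then have l: "lam > 0" using lam by simp
  have qE: "(q - E * h) * lam = 1 - E - E * ?x" using ql by (simp add: algebra_simps)
  \<comment> \<open>The inequalities \<open>1 - ?x \<le> E\<close> and
    \<open>E * (1 + ?x) \<le> 1\<close> enclose the quantity between 0 and
    \<open>?x * ?x\<close>.\<close>
  have "\<bar>1 - E - E * ?x\<bar> \<le> ?x * ?x"
  proof -
    have "(1 - ?x) * ?x \<le> E * ?x" using E1 x by (rule mult_right_mono)
    then have "1 - E - E * ?x \<le> ?x * ?x" using E1 by (simp add: algebra_simps)
    moreover have "E * (1 + ?x) \<le> E * exp ?x" using exp_ge_add_one_self[of ?x] E by (intro mult_left_mono) auto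
    then have "E * (1 + ?x) \<le> 1" by (simp add: E_def flip: exp_add)
    then have "0 \<le> 1 - E - E * ?x" by (simp add: algebra_simps)
    ultimately show ?thesis by simp
  qed
  then have "\<bar>q - E * h\<bar> * lam \<le> h * (h * lam) * lam"
    using l unfolding qE[symmetric] by (simp add: abs_mult mult_ac)
  then show "\<bar>q - E * h\<bar> \<le> h * (h * lam)" using l by simp
qed

lemma norm_diff_square_le:
  fixes a b :: "'a::real_inner"
  shows "(norm (a + b))\<^sup>2 \<le> 2 * (norm a)\<^sup>2 + 2 * (norm b)\<^sup>2" "(norm (a - b))\<^sup>2 \<le> 2 * (norm a)\<^sup>2 + 2 * (norm b)\<^sup>2"
proof -
  have "(norm (a + b))\<^sup>2 + (norm (a - b))\<^sup>2 = 2 * (norm a)\<^sup>2 + 2 * (norm b)\<^sup>2"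
    by (simp add: power2_norm_eq_inner inner_add inner_diff inner_commute)
  then show "(norm (a + b))\<^sup>2 \<le> 2 * (norm a)\<^sup>2 + 2 * (norm b)\<^sup>2" "(norm (a - b))\<^sup>2 \<le> 2 * (norm a)\<^sup>2 + 2 * (norm b)\<^sup>2"
    by (smt (verit) zero_le_power2)+
qed

context levy_measure
begin

text \<open>Settles the case \<open>lam = 0\<close> left out in \<open>exp_step_bounds\<close>:
  without jumps beyond \<open>r\<close> there is no drift to cancel either.\<close>

lemma lev_b_eq_0:
  assumes "0 < r" "lev_lam \<nu> r = 0"
  shows "lev_b \<nu> r = 0"
proof -
  have "emeasure \<nu> {z. r < norm z} < \<infinity>" using assms by (intro integrable_outside(2)[of r]) auto
  then have "emeasure \<nu> {z. r < norm z} = 0"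
    using assms(2) by (auto simp: lev_lam_def measure_def enn2real_eq_0_iff)
  then have "{z. r < norm z} \<in> null_sets \<nu>" by (auto simp: null_sets_def nu_sets)
  then have "AE z in \<nu>. z \<notin> {z. r < norm z}" by (rule AE_not_in)
  then have "AE z in \<nu>. indicat_real {z. r < norm z \<and> norm z < 1} z *\<^sub>R z = 0" by eventually_elim auto
  then show ?thesis unfolding lev_b_def set_lebesgue_integral_def by (rule integral_eq_zero_AE)
qed

text \<open>For \<open>r < |z| < 1\<close> the compensator leaves the quadratic remainder; for
  \<open>|z| \<ge> 1\<close> there is no compensation, but two values of \<open>\<phi>\<close>
  differ by at most 2. Both cases are dominated by \<open>(A + 2) * min 1 (|z|^2)\<close>.\<close>

lemma compensated_jump_bound:
  assumes r: "0 < r" "r < 1" and [measurable]: "\<phi> \<in> borel_measurable borel"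
    and b: "\<And>x. \<bar>\<phi> x\<bar> \<le> 1" and A: "A \<ge> 0"
    and g: "\<And>z. \<bar>\<phi> (x + z) - \<phi> x - g \<bullet> z\<bar> \<le> A * (norm z)\<^sup>2"
  shows "\<bar>(\<integral>z\<in>{z. r < norm z}. \<phi> (x + z) \<partial>\<nu>) - lev_lam \<nu> r * \<phi> x - g \<bullet> lev_b \<nu> r\<bar> \<le> (A + 2) * W"
proof -
  let ?S = "{z::real^'n. r < norm z}" and ?U = "{z::real^'n. r < norm z \<and> norm z < 1}"
  have iS: "integrable \<nu> (indicat_real ?S)" using r by (intro integrable_outside[of r]) auto
  have i1: "integrable \<nu> (\<lambda>z. indicat_real ?S z * \<phi> (x + z))"
    by (rule Bochner_Integration.integrable_bound[OF iS]) (auto simp: indicator_def b)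
  have i2: "integrable \<nu> (\<lambda>z. g \<bullet> (indicat_real ?U z *\<^sub>R z))"
    by (intro integrable_inner_right integrable_annulus r)
  have gb: "g \<bullet> lev_b \<nu> r = (\<integral>z. g \<bullet> (indicat_real ?U z *\<^sub>R z) \<partial>\<nu>)"
    unfolding lev_b_def set_lebesgue_integral_def
    by (rule integral_inner_right[symmetric]) (rule integrable_annulus[OF r(1)])
  have "(\<integral>z\<in>?S. \<phi> (x + z) \<partial>\<nu>) - lev_lam \<nu> r * \<phi> x - g \<bullet> lev_b \<nu> r
     = (\<integral>z. indicat_real ?S z * \<phi> (x + z) - indicat_real ?S z * \<phi> x - g \<bullet> (indicat_real ?U z *\<^sub>R z) \<partial>\<nu>)"
    using i1 i2 iS unfolding gb by (simp add: set_lebesgue_integral_def lev_lam_def)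
  also have "\<bar>\<dots>\<bar> \<le> (\<integral>z. (A + 2) * min 1 ((norm z)\<^sup>2) \<partial>\<nu>)"
  proof (rule order_trans[OF integral_abs_bound Bochner_Integration.integral_mono])
    show "integrable \<nu> (\<lambda>z. (A + 2) * min 1 ((norm z)\<^sup>2))" using integrable_min by simp
    show "integrable \<nu> (\<lambda>z. \<bar>indicat_real ?S z * \<phi> (x + z) - indicat_real ?S z * \<phi> x - g \<bullet> (indicat_real ?U z *\<^sub>R z)\<bar>)"
      using i1 i2 iS by simp
    fix z :: "real^'n"
    have p: "0 \<le> (A + 2) * min 1 ((norm z)\<^sup>2)" using A by simp
    consider "norm z \<le> r" | "r < norm z" "norm z < 1" | "r < norm z" "1 \<le> norm z" by linarith
    then show "\<bar>indicat_real ?S z * \<phi> (x + z) - indicat_real ?S z * \<phi> x - g \<bullet> (indicat_real ?U z *\<^sub>R z)\<bar>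
      \<le> (A + 2) * min 1 ((norm z)\<^sup>2)"
    proof cases
      case 1 then show ?thesis using p by (simp add: indicator_def)
    next
      case 2
      then have "min 1 ((norm z)\<^sup>2) = (norm z)\<^sup>2" using power_le_one[of "norm z" 2] by simp
      moreover have "\<bar>\<phi> (x + z) - \<phi> x - g \<bullet> z\<bar> \<le> A * (norm z)\<^sup>2 + 2 * (norm z)\<^sup>2"
        using g[of z] zero_le_power2[of "norm z"] by linarith
      ultimately show ?thesis using 2 by (simp add: indicator_def distrib_right)
    next
      case 3
      then have "min 1 ((norm z)\<^sup>2) = 1" using one_le_power[of "norm z" 2] by simp
      moreover have "\<bar>\<phi> (x + z) - \<phi> x\<bar> \<le> 2" using b[of "x + z"] b[of x] by linarith
      ultimately show ?thesis using 3 A by (simp add: indicator_def)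
    qed
  qed
  also have "\<dots> = (A + 2) * W" using integrable_min by (simp add: W_def)
  finally show ?thesis .
qed

text \<open>Everything is expanded around \<open>x\<close> with one common \<open>g\<close>. In the
  constant, \<open>2 * d^2 * M\<close> collects the interpolation errors of the diffusive and the
  jump part, \<open>4 * K^2 + 4 * Kb + 2 * Sg\<close> comes from squared displacements,
  \<open>2 * W\<close> from the jumps, and the remaining \<open>Kb + K\<close> from the mismatch of
  the drifts.\<close>

lemma one_step_bound:
  fixes s :: "'n \<Rightarrow> real^'n"
  assumes \<rho>: "\<rho> > 0" and h: "0 < h" "h < 1" and r: "0 < r" "r < 1" and M: "\<rho>\<^sup>2 \<le> M * h" "M \<ge> 0"
    and Kb: "h * (norm (lev_b \<nu> r))\<^sup>2 \<le> Kb" "h * lev_lam \<nu> r * norm (lev_b \<nu> r) \<le> Kb"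
    and Sg: "(\<Sum>p\<in>UNIV. (norm (s p))\<^sup>2) \<le> Sg"
    and c: "norm c \<le> K"
    and \<phi>: "1-lipschitz_on UNIV \<phi>" "\<And>x. \<bar>\<phi> x\<bar> \<le> 1" and A: "A \<ge> 0" and q: "quad_approx A \<phi>"
  defines "I \<equiv> interp \<rho> (\<lambda>i. \<phi> (grid \<rho> i))" and "lam \<equiv> lev_lam \<nu> r" and "d \<equiv> real CARD('n)"
  assumes I_int: "set_integrable \<nu> {z. r < norm z} (\<lambda>z. I (x + z))"
  shows "\<bar>exp (- h * lam) / (2 * d) * (\<Sum>p\<in>UNIV. I (x - h *\<^sub>R (c + lev_b \<nu> r) + sqrt (h * d) *\<^sub>R s p)
            + I (x - h *\<^sub>R (c + lev_b \<nu> r) - sqrt (h * d) *\<^sub>R s p))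
          + (1 - exp (- h * lam)) / lam * (\<integral>z\<in>{z. r < norm z}. I (x + z) \<partial>\<nu>) - \<phi> x\<bar>
     \<le> (2 * d\<^sup>2 * M + 4 * K\<^sup>2 + 5 * Kb + 2 * Sg + 2 * W + K) * h * (1 + A)"
proof -
  define E where "E = exp (- h * lam)"
  define qq where "qq = (1 - E) / lam"
  let ?b = "lev_b \<nu> r"
  have lam0: "lam \<ge> 0" by (simp add: lam_def lev_lam_def)
  note ex = exp_step_bounds[OF h(1) lam0, folded E_def, folded qq_def]
  have d1: "d \<ge> 1" unfolding d_def by (rule CARD_ge_1)
  obtain g where g1: "norm g \<le> 1" and g: "\<And>z. \<bar>\<phi> (x + z) - \<phi> x - g \<bullet> z\<bar> \<le> A * (norm z)\<^sup>2"
    using q unfolding quad_approx_def by blast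
  have [measurable]: "\<phi> \<in> borel_measurable borel"
    by (intro borel_measurable_continuous_onI lipschitz_on_continuous_on[OF \<phi>(1)])
  define e0 where "e0 = A * d\<^sup>2 * M * h"
  have e0: "e0 \<ge> 0" using A M h by (simp add: e0_def)
  have I: "\<bar>I y - \<phi> y\<bar> \<le> e0" for y
  proof -
    have "\<bar>I y - \<phi> y\<bar> \<le> A * d\<^sup>2 * \<rho>\<^sup>2"
      unfolding I_def d_def by (rule interp_quad_approx[OF \<rho> q A])
    also have "\<dots> \<le> A * d\<^sup>2 * (M * h)" using A M by (intro mult_left_mono) auto
    finally show ?thesis by (simp add: e0_def mult.assoc)
  qed
  have Kb0: "0 \<le> Kb" using Kb(1) h by (smt (verit) mult_nonneg_nonneg zero_le_power2)
  have K0: "0 \<le> K" using c norm_ge_zero[of c] by linarith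
  have Sg0: "0 \<le> Sg" using Sg by (smt (verit) sum_nonneg zero_le_power2)

  define w where "w = h *\<^sub>R (c + ?b)"
  define t where "t p = sqrt (h * d) *\<^sub>R s p" for p
  \<comment> \<open>Although \<open>?b\<close> may blow up as \<open>r\<close> tends to 0, the bound
    on \<open>h * (norm ?b)^2\<close> keeps the squared displacement of order
    \<open>h\<close>.\<close>
  have nw: "(norm w)\<^sup>2 \<le> h * (2 * K\<^sup>2 + 2 * Kb)"
  proof -
    have "(norm w)\<^sup>2 = h\<^sup>2 * (norm (c + ?b))\<^sup>2" using h by (simp add: w_def power_mult_distrib)
    also have "\<dots> \<le> h\<^sup>2 * (2 * (norm c)\<^sup>2 + 2 * (norm ?b)\<^sup>2)"
      by (intro mult_left_mono norm_diff_square_le) auto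
    also have "\<dots> = h * (2 * (h * (norm c)\<^sup>2) + 2 * (h * (norm ?b)\<^sup>2))" by (simp add: power2_eq_square algebra_simps)
    also have "\<dots> \<le> h * (2 * K\<^sup>2 + 2 * Kb)"
    proof (intro mult_left_mono add_mono Kb(1))
      have "h * (norm c)\<^sup>2 \<le> 1 * K\<^sup>2" using h c by (intro mult_mono power_mono) auto
      then show "h * (norm c)\<^sup>2 \<le> K\<^sup>2" by simp
    qed (use h in auto)
    finally show ?thesis .
  qed
  have nt: "(\<Sum>p\<in>UNIV. (norm (t p))\<^sup>2) \<le> h * d * Sg"
  proof -
    have "(\<Sum>p\<in>UNIV. (norm (t p))\<^sup>2) = h * d * (\<Sum>p\<in>UNIV. (norm (s p))\<^sup>2)"
      using h d1 by (simp add: t_def power_mult_distrib sum_distrib_left)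
    also have "\<dots> \<le> h * d * Sg" using h d1 Sg by (intro mult_left_mono) auto
    finally show ?thesis .
  qed
  define P where "P = (\<Sum>p\<in>UNIV. I (x - w + t p) + I (x - w - t p))"
  have "\<bar>I (x - w + t p) + I (x - w - t p) - 2 * \<phi> x + 2 * (g \<bullet> w)\<bar> \<le> 2 * e0 + 4 * A * (norm w)\<^sup>2 + 4 * A * (norm (t p))\<^sup>2" for p
  proof -
    have "\<bar>\<phi> (x - w + t p) - \<phi> x + g \<bullet> w - g \<bullet> t p\<bar> \<le> A * (norm (t p - w))\<^sup>2"
      using g[of "t p - w"] by (simp add: inner_diff_right algebra_simps)
    also have "\<dots> \<le> A * (2 * (norm (t p))\<^sup>2 + 2 * (norm w)\<^sup>2)"
      using A by (intro mult_left_mono norm_diff_square_le)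
    finally have 1: "\<bar>\<phi> (x - w + t p) - \<phi> x + g \<bullet> w - g \<bullet> t p\<bar> \<le> 2 * A * (norm w)\<^sup>2 + 2 * A * (norm (t p))\<^sup>2"
      by (simp add: algebra_simps)
    have "\<bar>\<phi> (x - w - t p) - \<phi> x + g \<bullet> w + g \<bullet> t p\<bar> \<le> A * (norm (- w - t p))\<^sup>2"
      using g[of "- w - t p"] by (simp add: inner_diff_right algebra_simps)
    also have "\<dots> \<le> A * (2 * (norm (- w))\<^sup>2 + 2 * (norm (t p))\<^sup>2)"
      using A by (intro mult_left_mono norm_diff_square_le)
    finally have 2: "\<bar>\<phi> (x - w - t p) - \<phi> x + g \<bullet> w + g \<bullet> t p\<bar> \<le> 2 * A * (norm w)\<^sup>2 + 2 * A * (norm (t p))\<^sup>2"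
      by (simp add: algebra_simps)
    \<comment> \<open>The terms \<open>g \<bullet> t p\<close> cancel between the two signs, so the
      diffusion enters only through its squared length, again of order \<open>h\<close>.\<close>
    show ?thesis using 1 2 I[of "x - w + t p"] I[of "x - w - t p"] by linarith
  qed
  then have "(\<Sum>p\<in>UNIV. \<bar>I (x - w + t p) + I (x - w - t p) - 2 * \<phi> x + 2 * (g \<bullet> w)\<bar>)
     \<le> (\<Sum>p\<in>UNIV. 2 * e0 + 4 * A * (norm w)\<^sup>2 + 4 * A * (norm (t p))\<^sup>2)" by (intro sum_mono)
  also have "\<dots> = d * (2 * e0 + 4 * A * (norm w)\<^sup>2) + 4 * A * (\<Sum>p\<in>UNIV. (norm (t p))\<^sup>2)"
    by (simp add: sum.distrib d_def sum_distrib_left)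
  also have "\<dots> \<le> d * (2 * e0 + 4 * A * (h * (2 * K\<^sup>2 + 2 * Kb))) + 4 * A * (h * d * Sg)"
    using A d1 nw nt by (intro add_mono mult_left_mono order_refl) auto
  also have "\<dots> = (2 * d) * (e0 + A * h * (4 * K\<^sup>2 + 4 * Kb + 2 * Sg))" by (simp add: algebra_simps)
  finally have "\<bar>\<Sum>p\<in>UNIV. I (x - w + t p) + I (x - w - t p) - 2 * \<phi> x + 2 * (g \<bullet> w)\<bar>
     \<le> (2 * d) * (e0 + A * h * (4 * K\<^sup>2 + 4 * Kb + 2 * Sg))"
    by (rule order_trans[OF sum_abs])
  moreover have "(\<Sum>p\<in>UNIV. I (x - w + t p) + I (x - w - t p) - 2 * \<phi> x + 2 * (g \<bullet> w))
     = P - 2 * d * \<phi> x + 2 * d * (g \<bullet> w)"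
    by (simp add: P_def sum.distrib sum_subtractf d_def)
  ultimately have "\<bar>P - 2 * d * \<phi> x + 2 * d * (g \<bullet> w)\<bar> \<le> (2 * d) * (e0 + A * h * (4 * K\<^sup>2 + 4 * Kb + 2 * Sg))" by simp
  then have "E / (2 * d) * \<bar>P - 2 * d * \<phi> x + 2 * d * (g \<bullet> w)\<bar>
     \<le> E / (2 * d) * ((2 * d) * (e0 + A * h * (4 * K\<^sup>2 + 4 * Kb + 2 * Sg)))"
    using ex(1) d1 by (intro mult_left_mono) auto
  also have "\<dots> = E * (e0 + A * h * (4 * K\<^sup>2 + 4 * Kb + 2 * Sg))" using d1 by simp
  also have "\<dots> \<le> 1 * (e0 + A * h * (4 * K\<^sup>2 + 4 * Kb + 2 * Sg))"
    using ex(1,2) e0 A h Kb0 Sg0 by (intro mult_right_mono) auto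
  finally have "\<bar>E / (2 * d) * (P - 2 * d * \<phi> x + 2 * d * (g \<bullet> w))\<bar> \<le> e0 + A * h * (4 * K\<^sup>2 + 4 * Kb + 2 * Sg)"
    using ex(1) d1 by (simp add: abs_mult)
  moreover have "E / (2 * d) * (P - 2 * d * \<phi> x + 2 * d * (g \<bullet> w)) = E / (2 * d) * P - E * \<phi> x + E * (g \<bullet> w)"
    using d1 by (simp add: field_simps)
  ultimately have diffusion: "\<bar>E / (2 * d) * P - E * \<phi> x + E * (g \<bullet> w)\<bar> \<le> e0 + A * h * (4 * K\<^sup>2 + 4 * Kb + 2 * Sg)"
    by (simp only:)

  let ?S = "{z::real^'n. r < norm z}"
  define R where "R = (\<integral>z\<in>?S. I (x + z) \<partial>\<nu>)"
  have iS: "integrable \<nu> (indicat_real ?S)" using r by (intro integrable_outside[of r]) auto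
  have i1: "integrable \<nu> (\<lambda>z. indicat_real ?S z * \<phi> (x + z))"
    by (rule Bochner_Integration.integrable_bound[OF iS]) (auto simp: indicator_def \<phi>(2))
  have i2: "integrable \<nu> (\<lambda>z. indicat_real ?S z * I (x + z))"
    using I_int by (simp add: set_integrable_def)
  have "\<bar>R - (\<integral>z\<in>?S. \<phi> (x + z) \<partial>\<nu>)\<bar> \<le> e0 * lam"
  proof -
    have "R - (\<integral>z\<in>?S. \<phi> (x + z) \<partial>\<nu>) = (\<integral>z. indicat_real ?S z * I (x + z) - indicat_real ?S z * \<phi> (x + z) \<partial>\<nu>)"
      unfolding R_def set_lebesgue_integral_def using i1 i2 by simp
    also have "\<bar>\<dots>\<bar> \<le> (\<integral>z. e0 * indicat_real ?S z \<partial>\<nu>)"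
    proof (rule order_trans[OF integral_abs_bound Bochner_Integration.integral_mono])
      show "\<bar>indicat_real ?S z * I (x + z) - indicat_real ?S z * \<phi> (x + z)\<bar> \<le> e0 * indicat_real ?S z" for z
        using I[of "x + z"] by (simp add: indicator_def)
    qed (use i1 i2 iS in auto)
    also have "\<dots> = e0 * lam" by (simp add: lam_def lev_lam_def)
    finally show ?thesis .
  qed
  moreover have "\<bar>(\<integral>z\<in>?S. \<phi> (x + z) \<partial>\<nu>) - lam * \<phi> x - g \<bullet> ?b\<bar> \<le> (A + 2) * W"
    unfolding lam_def by (rule compensated_jump_bound[OF r _ \<phi>(2) A g]) simp
  ultimately have "\<bar>R - lam * \<phi> x - g \<bullet> ?b\<bar> \<le> e0 * lam + (A + 2) * W" by linarith
  then have "qq * \<bar>R - lam * \<phi> x - g \<bullet> ?b\<bar> \<le> qq * (e0 * lam + (A + 2) * W)"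
    using ex(3) by (intro mult_left_mono)
  also have "\<dots> = e0 * (qq * lam) + qq * ((A + 2) * W)" by (simp add: algebra_simps)
  also have "\<dots> \<le> e0 * 1 + h * ((A + 2) * W)"
    using ex e0 A W_nonneg by (intro add_mono mult_left_mono mult_right_mono) auto
  finally have "\<bar>qq * (R - lam * \<phi> x - g \<bullet> ?b)\<bar> \<le> e0 + h * ((A + 2) * W)"
    using ex(3) by (simp add: abs_mult)
  moreover have "qq * (R - lam * \<phi> x - g \<bullet> ?b) = qq * R - (1 - E) * \<phi> x - qq * (g \<bullet> ?b)"
    using ex(5) by (simp add: right_diff_distrib mult.assoc[symmetric])
  ultimately have jump: "\<bar>qq * R - (1 - E) * \<phi> x - qq * (g \<bullet> ?b)\<bar> \<le> e0 + h * ((A + 2) * W)" by simp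

  have gb: "\<bar>g \<bullet> y\<bar> \<le> norm y" for y
    using Cauchy_Schwarz_ineq2[of g y] mult_right_mono[OF g1 norm_ge_zero[of y]] by linarith
  have "\<bar>(qq - E * h) * (g \<bullet> ?b)\<bar> \<le> h * Kb"
  proof (cases "lam = 0")
    case True
    then show ?thesis using lev_b_eq_0[OF r(1)] h Kb0 by (simp add: lam_def)
  next
    case False
    have "\<bar>(qq - E * h) * (g \<bullet> ?b)\<bar> \<le> (h * (h * lam)) * norm ?b"
      unfolding abs_mult using ex(6)[OF False] gb[of ?b] h lam0 by (intro mult_mono) auto
    also have "\<dots> = h * (h * lam * norm ?b)" by simp
    also have "\<dots> \<le> h * Kb" using Kb(2) h by (intro mult_left_mono) (auto simp: lam_def)
    finally show ?thesis .
  qed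
  moreover have "\<bar>E * h * (g \<bullet> c)\<bar> \<le> h * K"
  proof -
    have "\<bar>E * h * (g \<bullet> c)\<bar> \<le> (1 * h) * K"
      unfolding abs_mult using ex(1,2) h gb[of c] c by (intro mult_mono) auto
    then show ?thesis by simp
  qed
  moreover have "qq * (g \<bullet> ?b) - E * (g \<bullet> w) = (qq - E * h) * (g \<bullet> ?b) - E * h * (g \<bullet> c)"
    by (simp add: w_def inner_add_right algebra_simps)
  ultimately have drift: "\<bar>qq * (g \<bullet> ?b) - E * (g \<bullet> w)\<bar> \<le> h * Kb + h * K" by linarith

  \<comment> \<open>\<open>E * \<phi> x\<close> and \<open>(1 - E) * \<phi> x\<close> recombine to
    \<open>\<phi> x\<close>, and the two first-order terms are inserted so that their difference
    appears as \<open>drift\<close>.\<close>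
  have "E / (2 * d) * P + qq * R - \<phi> x = (E / (2 * d) * P - E * \<phi> x + E * (g \<bullet> w))
     + (qq * R - (1 - E) * \<phi> x - qq * (g \<bullet> ?b)) + (qq * (g \<bullet> ?b) - E * (g \<bullet> w))"
    by (simp add: algebra_simps)
  then have "\<bar>E / (2 * d) * P + qq * R - \<phi> x\<bar>
     \<le> (e0 + A * h * (4 * K\<^sup>2 + 4 * Kb + 2 * Sg)) + (e0 + h * ((A + 2) * W)) + (h * Kb + h * K)"
    using diffusion jump drift by linarith
  also have "\<dots> = h * (A * (2 * d\<^sup>2 * M + 4 * K\<^sup>2 + 4 * Kb + 2 * Sg + W) + (2 * W + Kb + K))"
    by (simp add: e0_def algebra_simps)
  \<comment> \<open>Enlarged so that one constant multiplies both \<open>A\<close> and 1, which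
    yields the factor \<open>1 + A\<close>.\<close>
  also have "\<dots> \<le> h * (A * (2 * d\<^sup>2 * M + 4 * K\<^sup>2 + 5 * Kb + 2 * Sg + 2 * W + K) + (2 * d\<^sup>2 * M + 4 * K\<^sup>2 + 5 * Kb + 2 * Sg + 2 * W + K))"
  proof (rule mult_left_mono[OF add_mono[OF mult_left_mono[OF _ A]]])
    have "0 \<le> d\<^sup>2 * M" "0 \<le> K\<^sup>2" using M by auto
    then show "2 * d\<^sup>2 * M + 4 * K\<^sup>2 + 4 * Kb + 2 * Sg + W \<le> 2 * d\<^sup>2 * M + 4 * K\<^sup>2 + 5 * Kb + 2 * Sg + 2 * W + K"
      "2 * W + Kb + K \<le> 2 * d\<^sup>2 * M + 4 * K\<^sup>2 + 5 * Kb + 2 * Sg + 2 * W + K"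
      using Kb0 K0 Sg0 W_nonneg by (simp_all add: mult.assoc)
  qed (use h in auto)
  finally have "\<bar>E / (2 * d) * P + qq * R - \<phi> x\<bar> \<le> (2 * d\<^sup>2 * M + 4 * K\<^sup>2 + 5 * Kb + 2 * Sg + 2 * W + K) * h * (1 + A)"
    by (simp add: algebra_simps)
  then show ?thesis unfolding E_def qq_def P_def R_def w_def t_def .
qed

end

section \<open>Evolution of the discrete density\<close>

lemma has_sum_finite_sum:
  fixes f :: "'p \<Rightarrow> 'i \<Rightarrow> real"
  assumes "finite P" "\<And>p. p \<in> P \<Longrightarrow> (f p has_sum s p) A"
  shows "((\<lambda>i. \<Sum>p\<in>P. f p i) has_sum (\<Sum>p\<in>P. s p)) A"
  using assms by (induction P rule: finite_induct) (auto intro!: has_sum_add)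

lemma interp_const: "\<rho> > 0 \<Longrightarrow> interp \<rho> (\<lambda>_. c) x = c"
  by (simp add: interp_cell sum_hat_cell_corners flip: sum_distrib_left)

section \<open>Grid cells and cell averages\<close>

lemma boxE_eq_box:
  "boxE \<rho> i = box (grid \<rho> i - vec (\<rho> / 2)) (grid \<rho> i + vec (\<rho> / 2))"
  unfolding boxE_def set_eq_iff mem_Collect_eq mem_box_cart abs_diff_less_iff by simp

lemma boxE_measurable [measurable]: "boxE \<rho> i \<in> sets borel"
  unfolding boxE_eq_box by simp

lemma emeasure_boxE:
  assumes "\<rho> > 0"
  shows "emeasure lborel (boxE \<rho> (i :: int^'n::finite)) = ennreal (\<rho> ^ CARD('n))"
proof -
  let ?l = "grid \<rho> i - vec (\<rho> / 2)" and ?u = "grid \<rho> i + vec (\<rho> / 2)"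
  have "?u - ?l = vec \<rho>" by (simp add: vec_eq_iff)
  moreover have v: "vec c \<bullet> b = c" if "b \<in> Basis" for b :: "real^'n" and c
    using that by (auto simp: Basis_vec_def inner_axis)
  moreover have "?l \<bullet> b \<le> ?u \<bullet> b" if "b \<in> Basis" for b
    using v[OF that] assms by (simp add: inner_diff_left inner_add_left)
  ultimately show ?thesis
    unfolding boxE_eq_box using assms by (subst emeasure_lborel_box) auto
qed

lemma boxE_disjoint:
  assumes "x \<in> boxE \<rho> i" "x \<in> boxE \<rho> j"
  shows "i = j"
proof -
  have "i $ l = j $ l" for l
  proof -
    have "\<bar>x $ l - \<rho> * of_int (i $ l)\<bar> < \<rho> / 2" "\<bar>x $ l - \<rho> * of_int (j $ l)\<bar> < \<rho> / 2"
      using assms by (auto simp: boxE_def)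
    then have b: "\<bar>\<rho> * of_int (i $ l) - \<rho> * of_int (j $ l)\<bar> < \<rho>" and \<rho>: "\<rho> > 0" by linarith+
    then have "\<rho> * \<bar>of_int (i $ l - j $ l)\<bar> < \<rho> * 1"
      by (simp add: abs_mult flip: right_diff_distrib)
    then have "\<bar>of_int (i $ l - j $ l) :: real\<bar> < 1" using \<rho> by (simp only: mult_less_cancel_left_pos)
    then show ?thesis by linarith
  qed
  then show ?thesis by (simp add: vec_eq_iff)
qed

lemma indicator_boxE_shift: "indicat_real (boxE \<rho> i) (grid \<rho> i + y) = indicat_real (boxE \<rho> 0) y"
  by (simp add: indicator_def boxE_def)

text \<open>Defined at every point rather than only at nodes, so that it is again a bounded
  Lipschitz function that can be mollified.\<close>

definition cell_average :: "real \<Rightarrow> (real^'n::finite \<Rightarrow> real) \<Rightarrow> real^'n \<Rightarrow> real" where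
  "cell_average \<rho> f x = (\<integral>y. f (x + y) * indicator (boxE \<rho> 0) y \<partial>lborel) / \<rho> ^ CARD('n)"

lemma integrable_boxE:
  fixes F :: "real^'n::finite \<Rightarrow> real"
  assumes \<rho>: "\<rho> > 0" and [measurable]: "F \<in> borel_measurable borel" and F: "\<And>x. \<bar>F x\<bar> \<le> D"
  shows "integrable lborel (\<lambda>y. F y * indicator (boxE \<rho> i) y)"
    and "\<bar>\<integral>y. F y * indicator (boxE \<rho> i) y \<partial>lborel\<bar> \<le> D * \<rho> ^ CARD('n)"
    and "(\<integral>y. \<bar>F y * indicator (boxE \<rho> i) y\<bar> \<partial>lborel) \<le> D * \<rho> ^ CARD('n)"
proof -
  have iS: "integrable lborel (\<lambda>y. D * indicat_real (boxE \<rho> i) y)"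
    using emeasure_boxE[OF \<rho>, of i] by (simp add: integrable_indicator_iff)
  have le: "\<bar>F y * indicator (boxE \<rho> i) y\<bar> \<le> D * indicat_real (boxE \<rho> i) y" for y
    using F[of y] by (simp add: indicator_def)
  show I: "integrable lborel (\<lambda>y. F y * indicator (boxE \<rho> i) y)"
  proof (rule Bochner_Integration.integrable_bound[OF iS])
    show "AE y in lborel. norm (F y * indicator (boxE \<rho> i) y) \<le> norm (D * indicat_real (boxE \<rho> i) y)"
      using order_trans[OF le abs_ge_self] by simp
  qed simp
  have "(\<integral>y. \<bar>F y * indicator (boxE \<rho> i) y\<bar> \<partial>lborel) \<le> (\<integral>y. D * indicat_real (boxE \<rho> i) y \<partial>lborel)"
    by (rule Bochner_Integration.integral_mono) (use I iS le in auto)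
  also have "\<dots> = D * \<rho> ^ CARD('n)" using \<rho> by (simp add: measure_def emeasure_boxE)
  finally show 1: "(\<integral>y. \<bar>F y * indicator (boxE \<rho> i) y\<bar> \<partial>lborel) \<le> D * \<rho> ^ CARD('n)" .
  show "\<bar>\<integral>y. F y * indicator (boxE \<rho> i) y \<partial>lborel\<bar> \<le> D * \<rho> ^ CARD('n)"
    by (rule order_trans[OF integral_abs_bound 1])
qed

lemma cell_average_grid:
  fixes f :: "real^'n::finite \<Rightarrow> real"
  assumes [measurable]: "f \<in> borel_measurable borel"
  shows "cell_average \<rho> f (grid \<rho> i) = (\<integral>y. f y * indicator (boxE \<rho> i) y \<partial>lborel) / \<rho> ^ CARD('n)"
  using integral_lborel_shift[of "\<lambda>y. f y * indicator (boxE \<rho> i) y" "grid \<rho> i"]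
  by (simp add: cell_average_def indicator_boxE_shift)

lemma cell_average_bounds:
  fixes f :: "real^'n::finite \<Rightarrow> real"
  assumes \<rho>: "\<rho> > 0" and f: "1-lipschitz_on UNIV f" "\<And>x. \<bar>f x\<bar> \<le> 1"
  shows "\<bar>cell_average \<rho> f x\<bar> \<le> 1" "1-lipschitz_on UNIV (cell_average \<rho> f)"
proof -
  have [measurable]: "f \<in> borel_measurable borel"
    by (intro borel_measurable_continuous_onI lipschitz_on_continuous_on[OF f(1)])
  have p: "0 < \<rho> ^ CARD('n)" using \<rho> by simp
  show "\<bar>cell_average \<rho> f x\<bar> \<le> 1"
    using integrable_boxE(2)[OF \<rho>, of "\<lambda>y. f (x + y)" 1 0] f(2) p
    by (simp add: cell_average_def field_simps)
  show "1-lipschitz_on UNIV (cell_average \<rho> f)"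
  proof (rule lipschitz_onI)
    fix x x' :: "real^'n"
    have I: "integrable lborel (\<lambda>y. f (x + y) * indicator (boxE \<rho> 0) y)" for x
      by (rule integrable_boxE(1)[OF \<rho>, where D=1]) (auto simp: f(2))
    have d: "\<bar>f (x + y) - f (x' + y)\<bar> \<le> norm (x - x')" for y
      using lipschitz_onD[OF f(1), of "x + y" "x' + y"] by (simp add: dist_norm)
    have "(\<integral>y. f (x + y) * indicator (boxE \<rho> 0) y \<partial>lborel) - (\<integral>y. f (x' + y) * indicator (boxE \<rho> 0) y \<partial>lborel)
      = (\<integral>y. (f (x + y) - f (x' + y)) * indicator (boxE \<rho> 0) y \<partial>lborel)"
      using I[of x] I[of x'] by (simp add: left_diff_distrib)
    also have "\<bar>\<dots>\<bar> \<le> norm (x - x') * \<rho> ^ CARD('n)"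
      by (rule integrable_boxE(2)[OF \<rho> _ d]) simp
    finally have "\<bar>(\<integral>y. f (x + y) * indicator (boxE \<rho> 0) y \<partial>lborel) - (\<integral>y. f (x' + y) * indicator (boxE \<rho> 0) y \<partial>lborel)\<bar> / \<rho> ^ CARD('n)
       \<le> norm (x - x')" using p by (simp add: pos_divide_le_eq)
    then show "dist (cell_average \<rho> f x) (cell_average \<rho> f x') \<le> 1 * dist x x'"
      using p by (simp add: dist_norm cell_average_def flip: diff_divide_distrib)
  qed simp
qed

section \<open>Piecewise linear interpolation in time\<close>

definition time_interp :: "real \<Rightarrow> (nat \<Rightarrow> real) \<Rightarrow> real \<Rightarrow> real" where
  "time_interp h a t = (let k = nat \<lfloor>t / h\<rfloor>; \<theta> = (t - real k * h) / h in (1 - \<theta>) * a k + \<theta> * a (Suc k))"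

lemma time_fraction:
  assumes "h > 0" "t \<ge> 0"
  shows "0 \<le> (t - real (nat \<lfloor>t / h\<rfloor>) * h) / h" "(t - real (nat \<lfloor>t / h\<rfloor>) * h) / h \<le> 1"
proof -
  have "real (nat \<lfloor>t / h\<rfloor>) = of_int \<lfloor>t / h\<rfloor>" using assms by simp
  then have "(t - real (nat \<lfloor>t / h\<rfloor>) * h) / h = t / h - of_int \<lfloor>t / h\<rfloor>" using assms by (simp add: field_simps)
  then show "0 \<le> (t - real (nat \<lfloor>t / h\<rfloor>) * h) / h" "(t - real (nat \<lfloor>t / h\<rfloor>) * h) / h \<le> 1" by linarith+
qed

lemma time_interp_dist_le:
  assumes "h > 0" "t \<ge> 0" "\<And>k. \<bar>a k - b k\<bar> \<le> D"
  shows "\<bar>time_interp h a t - time_interp h b t\<bar> \<le> D"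
proof -
  define k where "k = nat \<lfloor>t / h\<rfloor>"
  define \<theta> where "\<theta> = (t - real k * h) / h"
  have th: "0 \<le> \<theta>" "\<theta> \<le> 1" using time_fraction[OF assms(1,2)] by (auto simp: \<theta>_def k_def)
  have "time_interp h a t - time_interp h b t = (1 - \<theta>) * (a k - b k) + \<theta> * (a (Suc k) - b (Suc k))"
    by (simp add: time_interp_def Let_def k_def \<theta>_def algebra_simps)
  also have "\<bar>\<dots>\<bar> \<le> \<bar>(1 - \<theta>) * (a k - b k)\<bar> + \<bar>\<theta> * (a (Suc k) - b (Suc k))\<bar>" by (rule abs_triangle_ineq)
  also have "\<dots> \<le> (1 - \<theta>) * D + \<theta> * D"
    unfolding abs_mult using th assms(3)[of k] assms(3)[of "Suc k"] by (intro add_mono mult_mono) auto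
  finally show ?thesis by (simp add: algebra_simps)
qed

lemma time_interp_lipschitz:
  assumes h: "h > 0" and a: "\<And>k. \<bar>a (Suc k) - a k\<bar> \<le> D * h" and t: "0 \<le> t" "0 \<le> t'"
  shows "\<bar>time_interp h a t - time_interp h a t'\<bar> \<le> D * \<bar>t - t'\<bar>"
proof -
  have D0: "0 \<le> D * h" using a[of 0] by linarith
  have mono: "\<bar>time_interp h a t' - time_interp h a t\<bar> \<le> D * (t' - t)" if t: "0 \<le> t" "t \<le> t'" for t t'
  proof -
    define k k' where "k = nat \<lfloor>t / h\<rfloor>" and "k' = nat \<lfloor>t' / h\<rfloor>"
    define \<theta> \<theta>' where "\<theta> = (t - real k * h) / h" and "\<theta>' = (t' - real k' * h) / h"
    have th: "0 \<le> \<theta>" "\<theta> \<le> 1" "0 \<le> \<theta>'" "\<theta>' \<le> 1"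
      using time_fraction[OF h, of t] time_fraction[OF h, of t'] t by (auto simp: \<theta>_def k_def \<theta>'_def k'_def)
    have tt: "t = (real k + \<theta>) * h" "t' = (real k' + \<theta>') * h" using h by (auto simp: \<theta>_def \<theta>'_def field_simps)
    have kk: "k \<le> k'" unfolding k_def k'_def using t h by (intro nat_mono floor_mono divide_right_mono) auto
    have eq: "time_interp h a t = (1 - \<theta>) * a k + \<theta> * a (Suc k)" "time_interp h a t' = (1 - \<theta>') * a k' + \<theta>' * a (Suc k')"
      by (simp_all add: time_interp_def Let_def k_def \<theta>_def k'_def \<theta>'_def)
    show ?thesis
    proof (cases "k = k'")
      case True
      have "(real k + \<theta>) * h \<le> (real k' + \<theta>') * h" using t tt by simp
      then have le: "\<theta> \<le> \<theta>'" using h True by simp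
      have "time_interp h a t' - time_interp h a t = (\<theta>' - \<theta>) * (a (Suc k) - a k)"
        using True by (simp add: eq algebra_simps)
      also have "\<bar>\<dots>\<bar> \<le> (\<theta>' - \<theta>) * (D * h)" unfolding abs_mult using le a[of k] by (intro mult_mono) auto
      also have "\<dots> = D * (t' - t)" using True by (simp add: tt algebra_simps)
      finally show ?thesis .
    next
      case False
      then have k1: "Suc k \<le> k'" using kk by simp
      have tel: "\<bar>a n - a (Suc k)\<bar> \<le> D * h * real (n - Suc k)" if "Suc k \<le> n" for n
        using that
      proof (induction n rule: dec_induct)
        case (step n)
        have "\<bar>a (Suc n) - a (Suc k)\<bar> \<le> D * h * real (n - Suc k) + D * h" using step a[of n] by linarith
        also have "\<dots> = D * h * real (Suc n - Suc k)" using step by (simp add: of_nat_diff algebra_simps)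
        finally show ?case .
      qed simp
      \<comment> \<open>Passing through the levels \<open>Suc k\<close> and \<open>k'\<close>, the
        lengths \<open>(1 - \<theta>) * h\<close>, \<open>(k' - Suc k) * h\<close> and
        \<open>\<theta>' * h\<close> add up to \<open>t' - t\<close>.\<close>
      have "time_interp h a t' - time_interp h a t = (a k' - a (Suc k)) + \<theta>' * (a (Suc k') - a k') + (1 - \<theta>) * (a (Suc k) - a k)"
        by (simp add: eq algebra_simps)
      moreover have "\<bar>\<theta>' * (a (Suc k') - a k')\<bar> \<le> \<theta>' * (D * h)" unfolding abs_mult using th a[of k'] by (intro mult_mono) auto
      moreover have "\<bar>(1 - \<theta>) * (a (Suc k) - a k)\<bar> \<le> (1 - \<theta>) * (D * h)" unfolding abs_mult using th a[of k] by (intro mult_mono) auto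
      ultimately have "\<bar>time_interp h a t' - time_interp h a t\<bar> \<le> D * h * real (k' - Suc k) + \<theta>' * (D * h) + (1 - \<theta>) * (D * h)"
        using tel[OF k1] by linarith
      also have "\<dots> = D * (t' - t)" using k1 by (simp add: tt of_nat_diff algebra_simps)
      finally show ?thesis .
    qed
  qed
  show ?thesis using mono[of t t'] mono[of t' t] t by (cases "t \<le> t'") (auto simp: abs_minus_commute)
qed

section \<open>The forward scheme as a Markov chain on the grid\<close>

locale fpk_scheme = levy_measure \<nu> \<sigma>
  for \<nu> :: "(real^'n::finite) measure" and \<sigma> :: real +
  fixes L :: "real^'n \<Rightarrow> real^'n \<Rightarrow> real"
    and F G :: "real^'n \<Rightarrow> (real^'n) measure \<Rightarrow> real"
    and m0 :: "(real^'n) measure" and T :: real and N :: nat and \<rho> r \<epsilon> :: real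
    and \<mu> :: "real \<Rightarrow> (real^'n) measure" and h :: real
  assumes rho: "\<rho> > 0" and T: "T > 0" and N: "N > 0" and r: "0 < r" "r < 1"
    and m0: "m0 \<in> prob_meas" and h_def: "h = T / real N"
begin

abbreviation "lam \<equiv> lev_lam \<nu> r"
abbreviation "E \<equiv> exp (- h * lam)"
abbreviation "Phi_plus \<equiv> PhiP \<nu> L F G T N \<rho> r \<epsilon> \<mu>"
abbreviation "Phi_minus \<equiv> PhiM \<nu> L F G T N \<rho> r \<epsilon> \<mu>"
abbreviation "B \<equiv> Bmat \<nu> L F G T N \<rho> r \<epsilon> \<mu>"
abbreviation "m \<equiv> m_disc \<nu> L F G m0 T N \<rho> r \<epsilon> \<mu>"

lemma h_pos: "h > 0" using T N by (simp add: h_def)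

lemma lam_nonneg: "0 \<le> lam" by (simp add: lev_lam_def)

lemmas exp_step = exp_step_bounds[OF h_pos lam_nonneg]

lemma Bmat_eq: "B i j k = E / (2 * real CARD('n)) * (\<Sum>p\<in>UNIV. hat \<rho> i (Phi_plus j k p) + hat \<rho> i (Phi_minus j k p))
     + (1 - E) / lam * (\<integral>z\<in>{z. r < norm z}. hat \<rho> i (grid \<rho> j + z) \<partial>\<nu>)"
  by (simp add: Bmat_def Let_def h_def)

lemma Bmat_nonneg: "0 \<le> B i j k"
  unfolding Bmat_eq
proof (intro add_nonneg_nonneg mult_nonneg_nonneg sum_nonneg hat_nonneg)
  show "0 \<le> (1 - E) / lam" by (rule exp_step)
  show "0 \<le> (\<integral>z\<in>{z. r < norm z}. hat \<rho> i (grid \<rho> j + z) \<partial>\<nu>)"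
    unfolding set_lebesgue_integral_def by (intro integral_nonneg_AE) (auto simp: hat_nonneg)
qed simp

text \<open>The adjoint of \<open>B\<close> on grid functions, that is, the expectation of
  \<open>\<phi>\<close> after one step from node \<open>j\<close>. Interpolation sums the hats in
  closed form.\<close>

definition transport :: "(int^'n \<Rightarrow> real) \<Rightarrow> int^'n \<Rightarrow> nat \<Rightarrow> real" where
  "transport \<phi> j k = E / (2 * real CARD('n)) * (\<Sum>p\<in>UNIV. interp \<rho> \<phi> (Phi_plus j k p) + interp \<rho> \<phi> (Phi_minus j k p))
     + (1 - E) / lam * (\<integral>z\<in>{z. r < norm z}. interp \<rho> \<phi> (grid \<rho> j + z) \<partial>\<nu>)"

lemma emeasure_jumps: "emeasure \<nu> {z. r < norm z} < \<infinity>"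
  using r by (intro integrable_outside(2)[of r]) auto

lemma has_sum_transport:
  assumes "\<And>i. \<bar>\<phi> i\<bar> \<le> C"
  shows "((\<lambda>i. \<phi> i * B i j k) has_sum transport \<phi> j k) UNIV"
proof -
  have J: "((\<lambda>i. \<phi> i * (\<integral>z\<in>{z. r < norm z}. hat \<rho> i (grid \<rho> j + z) \<partial>\<nu>)) has_sum
      (\<integral>z\<in>{z. r < norm z}. interp \<rho> \<phi> (grid \<rho> j + z) \<partial>\<nu>)) UNIV"
    by (rule has_sum_set_integral_hat(2)[OF rho nu_sets _ emeasure_jumps assms]) simp
  have "((\<lambda>i. E / (2 * real CARD('n)) * (\<Sum>p\<in>UNIV. \<phi> i * hat \<rho> i (Phi_plus j k p) + \<phi> i * hat \<rho> i (Phi_minus j k p))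
     + (1 - E) / lam * (\<phi> i * (\<integral>z\<in>{z. r < norm z}. hat \<rho> i (grid \<rho> j + z) \<partial>\<nu>))) has_sum transport \<phi> j k) UNIV"
    unfolding transport_def
    by (intro has_sum_add has_sum_cmult_right has_sum_finite_sum has_sum_interp[OF rho] J) simp
  then show ?thesis
    by (simp add: Bmat_eq distrib_left sum_distrib_left mult.left_commute)
qed

text \<open>The weights of diffusion and jumps add up to 1, also for \<open>lam = 0\<close>, where
  \<open>E = 1\<close>. This makes \<open>B\<close> stochastic.\<close>

lemma transport_1: "transport (\<lambda>_. 1) j k = 1"
proof -
  have "transport (\<lambda>_. 1) j k = E + (1 - E) / lam * (\<integral>z. indicat_real {z. r < norm z} z \<partial>\<nu>)"
    unfolding transport_def by (simp add: interp_const[OF rho] set_lebesgue_integral_def)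
  also have "\<dots> = E + (1 - E) / lam * lam" by (simp add: lev_lam_def)
  also have "\<dots> = 1" using exp_step(5) by simp
  finally show ?thesis .
qed

lemma has_sum_Bmat: "((\<lambda>i. B i j k) has_sum 1) UNIV"
  using has_sum_transport[of "\<lambda>_. 1" 1 j k] by (simp add: transport_1)

text \<open>The initial mass is only bounded by 1, because the cells are open and \<open>m0\<close>
  may charge their faces. From then on stochasticity preserves the total.\<close>

lemma m_disc_mass: "(\<forall>i. 0 \<le> m k i) \<and> m k summable_on UNIV \<and> (\<Sum>\<^sub>\<infinity>i. m k i) \<le> 1"
proof (induction k)
  case 0
  interpret m0: prob_space m0 using m0 by (simp add: prob_meas_def)
  have sm0: "sets m0 = sets borel" using m0 by (simp add: prob_meas_def)
  have fin: "sum (m 0) Fs \<le> 1" if "finite Fs" for Fs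
  proof -
    have "sum (m 0) Fs = measure m0 (\<Union>i\<in>Fs. boxE \<rho> i)"
      using that boxE_disjoint by (subst m0.finite_measure_finite_Union) (auto simp: disjoint_family_on_def sm0)
    then show ?thesis by simp
  qed
  have s: "m 0 summable_on UNIV"
  proof (rule nonneg_bdd_above_summable_on)
    show "bdd_above (sum (m 0) ` {Fs. Fs \<subseteq> UNIV \<and> finite Fs})"
      by (rule bdd_aboveI2[where M=1]) (use fin in blast)
  qed simp
  show ?case using infsum_le_finite_sums[OF s fin] s by simp
next
  case (Suc k)
  then have mk: "\<And>j. 0 \<le> m k j" "m k summable_on UNIV" "(\<Sum>\<^sub>\<infinity>j. m k j) \<le> 1" by auto
  note st = stochastic_step[of "m k" "\<lambda>i j. B i j k" "\<lambda>_. 1" 1, OF mk(1,2) Bmat_nonneg has_sum_Bmat]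
  have "0 \<le> m (Suc k) i" for i
    by (simp add: infsum_nonneg mk(1) Bmat_nonneg)
  moreover have "m (Suc k) summable_on UNIV" using st(1) by simp
  moreover have "(\<Sum>\<^sub>\<infinity>i. m (Suc k) i) = (\<Sum>\<^sub>\<infinity>j. m k j)"
    using st(2) infsumI[OF has_sum_Bmat] by simp
  ultimately show ?case using mk(3) by simp
qed

lemmas m_disc_nonneg = m_disc_mass[THEN conjunct1, rule_format]
  and m_disc_summable = m_disc_mass[THEN conjunct2, THEN conjunct1]
  and m_disc_le_1 = m_disc_mass[THEN conjunct2, THEN conjunct2]

definition pairing :: "(int^'n \<Rightarrow> real) \<Rightarrow> nat \<Rightarrow> real" where
  "pairing \<phi> k = (\<Sum>\<^sub>\<infinity>i. m k i * \<phi> i)"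

lemma pairing_dist_le:
  assumes "\<And>i. \<bar>\<phi> i\<bar> \<le> C" "\<And>i. \<bar>\<psi> i\<bar> \<le> C'" "\<And>i. \<bar>\<phi> i - \<psi> i\<bar> \<le> D"
  shows "\<bar>pairing \<phi> k - pairing \<psi> k\<bar> \<le> D"
  unfolding pairing_def
  by (rule infsum_weighted_dist_le[OF m_disc_nonneg m_disc_summable m_disc_le_1 assms])

lemma pairing_Suc:
  assumes "\<And>i. \<bar>\<phi> i\<bar> \<le> C"
  shows "pairing \<phi> (Suc k) = pairing (\<lambda>j. transport \<phi> j k) k"
  using stochastic_step(2)[of "m k" "\<lambda>i j. B i j k" \<phi> C, OF m_disc_nonneg m_disc_summable Bmat_nonneg has_sum_Bmat assms]
    infsumI[OF has_sum_transport[OF assms]]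
  by (simp add: pairing_def mult.commute)

text \<open>Duality replaces the increment of the density, about whose regularity nothing is known,
  by a pointwise consistency estimate for the test function.\<close>

lemma pairing_step_le:
  assumes \<phi>: "\<And>i. \<bar>\<phi> i\<bar> \<le> C" and D: "\<And>j. \<bar>transport \<phi> j k - \<phi> j\<bar> \<le> D"
  shows "\<bar>pairing \<phi> (Suc k) - pairing \<phi> k\<bar> \<le> D"
  unfolding pairing_Suc[OF \<phi>]
proof (rule pairing_dist_le[OF _ \<phi> D])
  show "\<bar>transport \<phi> j k\<bar> \<le> C + D" for j using \<phi>[of j] D[of j] by linarith
qed

text \<open>The density is constant on cells and its factor
  \<open>\<rho> powr (- real CARD('n))\<close> is the normalization of a cell mean, so integrals
  against it are discrete pairings.\<close>

lemma m_dens_k_integral: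
  assumes [measurable]: "f \<in> borel_measurable borel" and f: "\<And>x. \<bar>f x\<bar> \<le> 1"
  shows "integrable lborel (\<lambda>x. m_dens_k \<nu> L F G m0 T N \<rho> r \<epsilon> \<mu> k x * f x)"
    and "(\<integral>x. m_dens_k \<nu> L F G m0 T N \<rho> r \<epsilon> \<mu> k x * f x \<partial>lborel) = pairing (\<lambda>i. cell_average \<rho> f (grid \<rho> i)) k"
proof -
  let ?c = "\<rho> powr (- real CARD('n))"
  let ?f = "\<lambda>i x. (?c * m k i) * (f x * indicator (boxE \<rho> i) x)"
  have c: "?c = 1 / \<rho> ^ CARD('n)" using rho by (simp add: powr_minus powr_realpow divide_inverse)
  have int: "integrable lborel (?f i)" for i
    by (intro integrable_mult_right integrable_boxE(1)[OF rho _ f]) simp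
  have supp: "(\<lambda>i. m k i * indicator (boxE \<rho> i) x) summable_on UNIV" for x
  proof (rule finite_nonzero_values_imp_summable_on)
    have "{i \<in> UNIV. m k i * indicator (boxE \<rho> i) x \<noteq> 0} \<subseteq> {i. x \<in> boxE \<rho> i}" by (auto simp: indicator_def)
    moreover have "finite {i. x \<in> boxE \<rho> i}"
    proof (cases "\<exists>i. x \<in> boxE \<rho> i")
      case True
      then obtain i where "x \<in> boxE \<rho> i" by blast
      then have "{i. x \<in> boxE \<rho> i} = {i}" using boxE_disjoint by blast
      then show ?thesis by simp
    qed simp
    ultimately show "finite {i \<in> UNIV. m k i * indicator (boxE \<rho> i) x \<noteq> 0}" by (rule finite_subset)
  qed
  have fe: "?f i x = (?c * f x) * (m k i * indicator (boxE \<rho> i) x)" for i x by simp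
  have pt: "(\<lambda>i. ?f i x) summable_on UNIV" for x
    unfolding fe by (rule summable_on_cmult_right[OF supp])
  have inf: "(\<Sum>\<^sub>\<infinity>i. ?f i x) = m_dens_k \<nu> L F G m0 T N \<rho> r \<epsilon> \<mu> k x * f x" for x
    unfolding fe infsum_cmult_right' by (simp add: m_dens_k_def)
  have sm: "(\<lambda>i. \<integral>x. \<bar>?f i x\<bar> \<partial>lborel) summable_on UNIV"
  proof (rule summable_on_comparison_test[OF m_disc_summable[of k]])
    fix i
    have "(\<integral>x. \<bar>?f i x\<bar> \<partial>lborel) = (?c * m k i) * (\<integral>x. \<bar>f x * indicator (boxE \<rho> i) x\<bar> \<partial>lborel)"
      using m_disc_nonneg[of k i] by (simp add: abs_mult)
    also have "\<dots> \<le> (?c * m k i) * (1 * \<rho> ^ CARD('n))"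
      using m_disc_nonneg[of k i] by (intro mult_left_mono integrable_boxE(3)[OF rho _ f]) auto
    also have "\<dots> = m k i" using rho by (simp add: c)
    finally show "(\<integral>x. \<bar>?f i x\<bar> \<partial>lborel) \<le> m k i" .
  qed simp
  show "integrable lborel (\<lambda>x. m_dens_k \<nu> L F G m0 T N \<rho> r \<epsilon> \<mu> k x * f x)"
    using integral_has_sum(1)[OF int pt sm] unfolding inf .
  have e: "(\<integral>x. ?f i x \<partial>lborel) = m k i * cell_average \<rho> f (grid \<rho> i)" for i
    by (simp add: cell_average_grid c)
  show "(\<integral>x. m_dens_k \<nu> L F G m0 T N \<rho> r \<epsilon> \<mu> k x * f x \<partial>lborel) = pairing (\<lambda>i. cell_average \<rho> f (grid \<rho> i)) k"
    using infsumI[OF integral_has_sum(2)[OF int pt sm]] unfolding inf e pairing_def by (rule sym)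
qed

lemma m_dens_k_nonneg: "0 \<le> m_dens_k \<nu> L F G m0 T N \<rho> r \<epsilon> \<mu> k x"
  unfolding m_dens_k_def by (intro mult_nonneg_nonneg infsum_nonneg) (auto simp: m_disc_nonneg)

text \<open>At \<open>t = T\<close> the index \<open>k\<close> is \<open>N\<close> and level
  \<open>N + 1\<close> occurs with weight 0. The recursion is defined and estimated at all levels,
  so the endpoint needs no special case.\<close>

lemma m_eps_integral:
  assumes t: "t \<ge> 0" and [measurable]: "f \<in> borel_measurable borel" and f: "\<And>x. \<bar>f x\<bar> \<le> 1"
  shows "integral\<^sup>L (m_eps \<nu> L F G m0 T N \<rho> r \<epsilon> \<mu> t) f = time_interp h (pairing (\<lambda>i. cell_average \<rho> f (grid \<rho> i))) t"
proof -
  define k where "k = nat \<lfloor>t / h\<rfloor>"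
  define \<theta> where "\<theta> = (t - real k * h) / h"
  let ?m = "m_dens_k \<nu> L F G m0 T N \<rho> r \<epsilon> \<mu>"
  have th: "0 \<le> \<theta>" "\<theta> \<le> 1" using time_fraction[OF h_pos t] by (auto simp: \<theta>_def k_def)
  have md: "m_dens \<nu> L F G m0 T N \<rho> r \<epsilon> \<mu> t x = (1 - \<theta>) * ?m k x + \<theta> * ?m (Suc k) x" for x
    by (simp add: m_dens_def Let_def k_def \<theta>_def h_def)
  have [measurable]: "?m k \<in> borel_measurable borel" for k
    using borel_measurable_integrable[OF m_dens_k_integral(1)[where f="\<lambda>_. 1" and k=k]] by simp
  have "integral\<^sup>L (m_eps \<nu> L F G m0 T N \<rho> r \<epsilon> \<mu> t) f = (\<integral>x. ((1 - \<theta>) * ?m k x + \<theta> * ?m (Suc k) x) *\<^sub>R f x \<partial>lborel)"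
    unfolding m_eps_def md using th by (intro integral_density) (auto simp: m_dens_k_nonneg)
  also have "\<dots> = (\<integral>x. (1 - \<theta>) * (?m k x * f x) + \<theta> * (?m (Suc k) x * f x) \<partial>lborel)"
    by (simp add: algebra_simps)
  also have "\<dots> = (1 - \<theta>) * (\<integral>x. ?m k x * f x \<partial>lborel) + \<theta> * (\<integral>x. ?m (Suc k) x * f x \<partial>lborel)"
    using m_dens_k_integral(1)[OF _ f, where k=k] m_dens_k_integral(1)[OF _ f, where k="Suc k"] by simp
  finally show ?thesis
    using m_dens_k_integral(2)[OF _ f] by (simp add: time_interp_def Let_def k_def \<theta>_def)
qed

lemma d0_m_eps_le:
  assumes h1: "h < 1" and M: "\<rho>\<^sup>2 \<le> M * h" "M \<ge> 0"
    and Kb: "h * (norm (lev_b \<nu> r))\<^sup>2 \<le> Kb" "h * lam * norm (lev_b \<nu> r) \<le> Kb"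
    and Sg: "(\<Sum>p\<in>UNIV. (norm (column p (lev_sig \<nu> r)))\<^sup>2) \<le> Sg"
    and K: "\<And>t x. norm (DpH L x (grad (u_eps \<nu> L F G T N \<rho> r \<epsilon> \<mu> t) x)) \<le> K"
    and A: "A \<ge> 0"
    and approx: "\<And>(f :: real^'n \<Rightarrow> real) \<delta>. \<delta> > 0 \<Longrightarrow> 1-lipschitz_on UNIV f \<Longrightarrow> (\<forall>x. \<bar>f x\<bar> \<le> 1) \<Longrightarrow>
     (\<exists>\<phi>. (\<forall>x. \<bar>\<phi> x - f x\<bar> \<le> \<delta>) \<and> (\<forall>x. \<bar>\<phi> x\<bar> \<le> 1) \<and> 1-lipschitz_on UNIV \<phi> \<and> quad_approx (A / \<delta>) \<phi>)"
    and C: "C = 2 * (real CARD('n))\<^sup>2 * M + 4 * K\<^sup>2 + 5 * Kb + 2 * Sg + 2 * W + K"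
    and t: "t1 \<in> {0..T}" "t2 \<in> {0..T}"
  shows "d0 (m_eps \<nu> L F G m0 T N \<rho> r \<epsilon> \<mu> t1) (m_eps \<nu> L F G m0 T N \<rho> r \<epsilon> \<mu> t2)
     \<le> (2 + C * sqrt T + C * A) * sqrt \<bar>t1 - t2\<bar>"
proof -
  have Kb0: "0 \<le> Kb" using order_trans[OF mult_nonneg_nonneg[OF less_imp_le[OF h_pos] zero_le_power2] Kb(1)] .
  have K0: "0 \<le> K" by (rule order_trans[OF norm_ge_zero K[of 0 0]])
  have Sg0: "0 \<le> Sg" by (rule order_trans[OF sum_nonneg Sg]) simp
  have C0: "0 \<le> C" unfolding C using M Kb0 K0 Sg0 W_nonneg by simp
  let ?m = "m_eps \<nu> L F G m0 T N \<rho> r \<epsilon> \<mu>"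
  have smooth: "\<bar>time_interp h (pairing (\<lambda>i. \<phi> (grid \<rho> i))) t1 - time_interp h (pairing (\<lambda>i. \<phi> (grid \<rho> i))) t2\<bar>
      \<le> (C * (1 + a)) * \<bar>t1 - t2\<bar>"
    if \<phi>: "1-lipschitz_on UNIV \<phi>" "\<And>x. \<bar>\<phi> x\<bar> \<le> 1" and a: "a \<ge> 0" and q: "quad_approx a \<phi>" for \<phi> a
  proof (rule time_interp_lipschitz[OF h_pos])
    fix k
    show "\<bar>pairing (\<lambda>i. \<phi> (grid \<rho> i)) (Suc k) - pairing (\<lambda>i. \<phi> (grid \<rho> i)) k\<bar> \<le> C * (1 + a) * h"
    proof (rule pairing_step_le[OF \<phi>(2)])
      fix j
      let ?c = "DpH L (grid \<rho> j) (grad (u_eps \<nu> L F G T N \<rho> r \<epsilon> \<mu> (real k * h)) (grid \<rho> j))"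
      have int: "set_integrable \<nu> {z. r < norm z} (\<lambda>z. interp \<rho> (\<lambda>i. \<phi> (grid \<rho> i)) (grid \<rho> j + z))"
        by (rule has_sum_set_integral_hat(1)[OF rho nu_sets _ emeasure_jumps \<phi>(2)]) simp
      have P: "Phi_plus j k p = grid \<rho> j - h *\<^sub>R (?c + lev_b \<nu> r) + sqrt (h * real CARD('n)) *\<^sub>R column p (lev_sig \<nu> r)"
        "Phi_minus j k p = grid \<rho> j - h *\<^sub>R (?c + lev_b \<nu> r) - sqrt (h * real CARD('n)) *\<^sub>R column p (lev_sig \<nu> r)" for p
        by (simp_all add: PhiP_def PhiM_def Let_def h_def)
      show "\<bar>transport (\<lambda>i. \<phi> (grid \<rho> i)) j k - \<phi> (grid \<rho> j)\<bar> \<le> C * (1 + a) * h"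
        using one_step_bound[OF rho h_pos h1 r M Kb Sg K[of "grid \<rho> j" "real k * h"] \<phi> a q int]
        unfolding transport_def P C by (simp add: mult_ac)
    qed
  qed (use t in auto)
  have test: "integral\<^sup>L (?m t1) f - integral\<^sup>L (?m t2) f \<le> (2 + C * sqrt T + C * A) * sqrt \<bar>t1 - t2\<bar>"
    if f: "\<And>x. \<bar>f x\<bar> \<le> 1" "1-lipschitz_on UNIV f" for f
  proof (cases "t1 = t2")
    case False
    \<comment> \<open>The mollification scale must be positive, hence the separate case
      \<open>t1 = t2\<close>. The two replacements cost \<open>2 * \<delta>\<close>, and
      \<open>\<delta> \<le> sqrt T\<close> makes the term \<open>C * \<delta> * \<delta>\<close>
      linear in \<open>\<delta>\<close>.\<close>
    define \<delta> where "\<delta> = sqrt \<bar>t1 - t2\<bar>"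
    have \<delta>: "\<delta> > 0" "\<delta> * \<delta> = \<bar>t1 - t2\<bar>" using False by (auto simp: \<delta>_def)
    have "\<delta> \<le> sqrt T" unfolding \<delta>_def using t by (intro real_sqrt_le_mono) auto
    have [measurable]: "f \<in> borel_measurable borel"
      by (intro borel_measurable_continuous_onI lipschitz_on_continuous_on[OF f(2)])
    let ?F = "cell_average \<rho> f"
    note avg = cell_average_bounds[OF rho f(2,1)]
    obtain \<phi> where \<phi>: "\<And>x. \<bar>\<phi> x - ?F x\<bar> \<le> \<delta>" "\<And>x. \<bar>\<phi> x\<bar> \<le> 1" "1-lipschitz_on UNIV \<phi>" "quad_approx (A / \<delta>) \<phi>"
      using approx[OF \<delta>(1) avg(2)] avg(1) by blast
    let ?s = "\<lambda>f t. time_interp h (pairing (\<lambda>i. f (grid \<rho> i))) t"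
    have close: "\<bar>?s \<phi> t - ?s ?F t\<bar> \<le> \<delta>" if "t \<ge> 0" for t
      by (rule time_interp_dist_le[OF h_pos that pairing_dist_le[OF \<phi>(2) avg(1) \<phi>(1)]])
    have "\<bar>?s \<phi> t1 - ?s \<phi> t2\<bar> \<le> (C * (1 + A / \<delta>)) * \<bar>t1 - t2\<bar>"
      using A \<delta> by (intro smooth \<phi>) auto
    also have "\<dots> = C * \<delta> * \<delta> + C * A * \<delta>" unfolding \<delta>(2)[symmetric] using \<delta>(1) by (simp add: field_simps)
    also have "\<dots> \<le> C * sqrt T * \<delta> + C * A * \<delta>"
      using \<open>\<delta> \<le> sqrt T\<close> C0 \<delta>(1) by (intro add_mono mult_right_mono mult_left_mono) auto
    finally have "?s ?F t1 - ?s ?F t2 \<le> 2 * \<delta> + C * sqrt T * \<delta> + C * A * \<delta>"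
      using close[of t1] close[of t2] t by auto
    moreover have "integral\<^sup>L (?m t1) f = ?s ?F t1" "integral\<^sup>L (?m t2) f = ?s ?F t2"
      using t f(1) by (auto intro!: m_eps_integral)
    ultimately show ?thesis by (simp add: \<delta>_def algebra_simps)
  qed simp
  show ?thesis unfolding d0_def
  proof (rule cSup_least)
    have "\<exists>f :: real^'n \<Rightarrow> real. (\<forall>x. \<bar>f x\<bar> \<le> 1) \<and> 1-lipschitz_on UNIV f"
      by (rule exI[of _ "\<lambda>_. 0"]) (auto intro!: lipschitz_onI)
    then show "{integral\<^sup>L (?m t1) f - integral\<^sup>L (?m t2) f | f :: real^'n \<Rightarrow> real. (\<forall>x. \<bar>f x\<bar> \<le> 1) \<and> 1-lipschitz_on UNIV f} \<noteq> {}"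
      by simp
  next
    fix y assume "y \<in> {integral\<^sup>L (?m t1) f - integral\<^sup>L (?m t2) f | f :: real^'n \<Rightarrow> real. (\<forall>x. \<bar>f x\<bar> \<le> 1) \<and> 1-lipschitz_on UNIV f}"
    then obtain f where "y = integral\<^sup>L (?m t1) f - integral\<^sup>L (?m t2) f" "\<And>x. \<bar>f x\<bar> \<le> 1" "1-lipschitz_on UNIV f"
      by auto
    then show "y \<le> (2 + C * sqrt T + C * A) * sqrt \<bar>t1 - t2\<bar>" using test by simp
  qed
qed

end

theorem mainTheorem14:
  fixes \<nu> :: "(real^'n::finite) measure"
    and L :: "real^'n \<Rightarrow> real^'n \<Rightarrow> real"
    and F G :: "real^'n \<Rightarrow> (real^'n) measure \<Rightarrow> real"
    and m0 :: "(real^'n) measure"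
    and T \<sigma> M :: real
  assumes T_pos: "T > 0"
    and nu_sets: "sets \<nu> = sets borel"
    and nu_zero: "emeasure \<nu> {0} = 0"
    and nu0: "(\<integral>\<^sup>+ z. ennreal (min 1 (norm z ^ 2)) \<partial>\<nu>) < \<infinity>"
    and nu1: "0 < \<sigma> \<and> \<sigma> < 2 \<and> (\<exists>C>0. \<exists>g \<in> borel_measurable borel.
               (\<forall>z. 0 < norm z \<and> norm z < 1 \<longrightarrow> 0 \<le> g z \<and> g z \<le> C * norm z powr (- (real CARD('n) + \<sigma>))) \<and>
               (\<forall>A \<in> sets borel. A \<subseteq> ball 0 1 \<longrightarrow> emeasure \<nu> A = (\<integral>\<^sup>+ z\<in>A. ennreal (g z) \<partial>lborel)))"
    and sigma_ne1: "\<sigma> \<noteq> 1"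
    and L1: "\<forall>x. convex_on UNIV (L x) \<and> filterlim (\<lambda>q. L x q / norm q) at_top at_infinity"
    and L2: "\<exists>LL. \<forall>x y q. \<bar>L x q - L y q\<bar> \<le> LL * dist x y"
    and F2: "\<exists>LF. \<forall>x y \<mu>1 \<mu>2. \<mu>1 \<in> prob_meas \<longrightarrow> \<mu>2 \<in> prob_meas \<longrightarrow>
               \<bar>F x \<mu>1 - F y \<mu>2\<bar> \<le> LF * (dist x y + d0 \<mu>1 \<mu>2) \<and>
               \<bar>G x \<mu>1 - G y \<mu>2\<bar> \<le> LF * (dist x y + d0 \<mu>1 \<mu>2)"
    and H1: "(\<forall>x p. \<exists>g. (ham L x has_derivative (\<lambda>v. g \<bullet> v)) (at p)) \<and>
             continuous_on UNIV (\<lambda>(x, p). DpH L x p) \<and>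
             (\<forall>R. \<exists>C. \<forall>x p. norm p \<le> R \<longrightarrow> norm (DpH L x p) \<le> C)"
    and Mm0: "m0 \<in> prob_meas"
    and M_pos: "M > 0"
  shows "\<exists>C0>0. \<forall>(\<rho>::real) (N::nat) (r::real) (\<epsilon>::real) (\<mu>::real \<Rightarrow> (real^'n) measure) t1 t2.
           \<rho> > 0 \<longrightarrow> N > 0 \<longrightarrow> T / real N < 1 \<longrightarrow> 0 < r \<longrightarrow> r < 1 \<longrightarrow> \<epsilon> > 0 \<longrightarrow>
           \<rho>\<^sup>2 / (T / real N) \<le> M \<longrightarrow>
           (\<sigma> < 1 \<longrightarrow> (T / real N) / r powr \<sigma> \<le> M) \<longrightarrow>
           (\<sigma> > 1 \<longrightarrow> (T / real N) * r powr (1 - 2 * \<sigma>) \<le> M) \<longrightarrow>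
           cont_flow T \<mu> \<longrightarrow> t1 \<in> {0..T} \<longrightarrow> t2 \<in> {0..T} \<longrightarrow>
           d0 (m_eps \<nu> L F G m0 T N \<rho> r \<epsilon> \<mu> t1) (m_eps \<nu> L F G m0 T N \<rho> r \<epsilon> \<mu> t2)
             \<le> C0 * sqrt \<bar>t1 - t2\<bar>"
proof -
  interpret levy_measure \<nu> \<sigma> using nu_sets nu0 nu1 sigma_ne1 by unfold_locales
  let ?d = "real CARD('n)"
  \<comment> \<open>All constants are obtained before \<open>\<rho>\<close>, \<open>N\<close>,
    \<open>r\<close>, \<open>\<epsilon>\<close> and \<open>\<mu>\<close> are fixed; this order is
    the uniformity claimed for \<open>C0\<close>.\<close>
  obtain Kb where Kb: "Kb \<ge> 0" "\<And>h r. 0 < h \<Longrightarrow> h < 1 \<Longrightarrow> 0 < r \<Longrightarrow> r < 1 \<Longrightarrow> (\<sigma> < 1 \<longrightarrow> h / r powr \<sigma> \<le> M) \<Longrightarrow>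
     (\<sigma> > 1 \<longrightarrow> h * r powr (1 - 2 * \<sigma>) \<le> M) \<Longrightarrow>
     h * (norm (lev_b \<nu> r))\<^sup>2 \<le> Kb \<and> h * lev_lam \<nu> r * norm (lev_b \<nu> r) \<le> Kb"
    using drift_intensity_bound[OF M_pos] by blast
  obtain K where K: "K \<ge> 0" "\<And>\<rho> N r \<epsilon> \<mu> t x. \<rho> > 0 \<Longrightarrow> N > 0 \<Longrightarrow> 0 < r \<Longrightarrow> r < 1 \<Longrightarrow> \<epsilon> > 0 \<Longrightarrow> cont_flow T \<mu> \<Longrightarrow>
     norm (DpH L x (grad (u_eps \<nu> L F G T N \<rho> r \<epsilon> \<mu> t) x)) \<le> K"
    using drift_bounded[OF T_pos L2 F2] H1 by blast
  obtain A where A: "A \<ge> 0" "\<And>(f :: real^'n \<Rightarrow> real) \<delta>. \<delta> > 0 \<Longrightarrow> 1-lipschitz_on UNIV f \<Longrightarrow> (\<forall>x. \<bar>f x\<bar> \<le> 1) \<Longrightarrow>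
     (\<exists>\<phi>. (\<forall>x. \<bar>\<phi> x - f x\<bar> \<le> \<delta>) \<and> (\<forall>x. \<bar>\<phi> x\<bar> \<le> 1) \<and> 1-lipschitz_on UNIV \<phi> \<and> quad_approx (A / \<delta>) \<phi>)"
    using exists_quad_approx[where 'n='n] by blast
  \<comment> \<open>The first summand bounds the trace of the small-jump covariance, the second the
    columns of the default matrix of \<open>psd_sqrt\<close>.\<close>
  define Sg where "Sg = ?d * W + (\<Sum>p\<in>UNIV. (norm (column p (THE S :: real^'n^'n. False)))\<^sup>2)"
  have Sg: "(\<Sum>p\<in>UNIV. (norm (column p (lev_sig \<nu> r)))\<^sup>2) \<le> Sg" if "r < 1" for r
    unfolding Sg_def lev_sig_def using psd_sqrt_columns[of "lev_cov \<nu> r"] trace_lev_cov[OF that] by linarith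
  define C where "C = 2 * ?d\<^sup>2 * M + 4 * K\<^sup>2 + 5 * Kb + 2 * Sg + 2 * W + K"
  have Sg0: "0 \<le> Sg" unfolding Sg_def using W_nonneg by (intro add_nonneg_nonneg sum_nonneg) auto
  have C0: "C \<ge> 0" unfolding C_def using M_pos K(1) Kb(1) Sg0 W_nonneg by simp
  have "2 + C * sqrt T + C * A > 0"
    using C0 A(1) T_pos by (intro add_pos_nonneg mult_nonneg_nonneg) auto
  moreover have "d0 (m_eps \<nu> L F G m0 T N \<rho> r \<epsilon> \<mu> t1) (m_eps \<nu> L F G m0 T N \<rho> r \<epsilon> \<mu> t2)
             \<le> (2 + C * sqrt T + C * A) * sqrt \<bar>t1 - t2\<bar>"
    if \<rho>: "\<rho> > 0" and N: "N > 0" and h1: "T / real N < 1" and r: "0 < r" "r < 1" and \<epsilon>: "\<epsilon> > 0"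
      and M: "\<rho>\<^sup>2 / (T / real N) \<le> M" and s: "\<sigma> < 1 \<longrightarrow> (T / real N) / r powr \<sigma> \<le> M"
        "\<sigma> > 1 \<longrightarrow> (T / real N) * r powr (1 - 2 * \<sigma>) \<le> M"
      and flow: "cont_flow T \<mu>" and t: "t1 \<in> {0..T}" "t2 \<in> {0..T}" for \<rho> N r \<epsilon> \<mu> t1 t2
  proof -
    interpret fpk_scheme \<nu> \<sigma> L F G m0 T N \<rho> r \<epsilon> \<mu> "T / real N"
      using \<rho> T_pos N r Mm0 by unfold_locales auto
    have "\<rho>\<^sup>2 \<le> M * (T / real N)" using M h_pos by (simp only: pos_divide_le_eq)
    then show ?thesis
      using Kb(2)[OF h_pos h1 r s] Sg[OF r(2)] K(2)[OF \<rho> N r \<epsilon> flow] A C_def M_pos t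
      by (intro d0_m_eps_le[OF h1, where Kb=Kb and Sg=Sg and K=K and M=M]) auto
  qed
  ultimately show ?thesis by (intro exI[of _ "2 + C * sqrt T + C * A"]) auto
qed

end
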